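(* Suppose $I+K\in G$. Then $I+K$ has a unique factorization $$I+K=b_-\circ b_+^{-1}$$ with $b_-\in\mathcal L$ and $b_+\in\mathcal K$. Moreover, let $S=K+K^*+K\circ K^*\in\mathfrak g$, with kernel $S(x,y)$, and let $C_+(x,y)$ be the kernel of $(b_-^{-1})^*-I$. Then $C_+$ is given explicitly by $$C_+(x,y)=-\Big(\big((I+S)|_{(-\infty,y)}\big)^{-1}S(\cdot,y)\Big)(x)=-S(x,y)-\frac{\big(D_2(S|_{(-\infty,y)})\,S(\cdot,y)\big)(x)}{\det_2\big((I+S)|_{(-\infty,y)}\big)},\qquad x<y,$$ and $C_+(x,y)=0$ for $y<x$.
   Context: Let $\mathcal H=L^2(\mathbb R)$ (real-valued functions) and let $\mathfrak g$ be the space of Hilbert-Schmidt operators on $\mathcal H$; every $A\in\mathfrak g$ is an integral operator $(A\varphi)(x)=\int_{\mathbb R}A(x,y)\varphi(y)\,dy$ with a unique kernel $A(\cdot,\cdot)\in L^2(\mathbb R^2)$ (kernels are identified up to null sets), and the adjoint $A^*$ has kernel $A(y,x)$. Let $I$ be the identity operator, $GL(\mathcal H)$ the group of invertible bounded operators, and $G=GL(\mathcal H)\cap(I+\mathfrak g)$ (the Hilbert-Schmidt group). Let $\mathfrak l\subset\mathfrak g$ be the set of Volterra operators $(A\varphi)(x)=\int_{-\infty}^xA(x,y)\varphi(y)\,dy$, i.e. those whose kernel vanishes for $y>x$. Put $\mathcal L=I+\mathfrak l$ and $\mathcal K=\{k\in G: k\circ k^*=k^*\circ k=I\}$; both are subgroups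 of $G$. For $A\in\mathfrak g$ and $y\in\mathbb R$, $A|_{(-\infty,y)}$ is the operator on $L^2(-\infty,y)$ given by $(A|_{(-\infty,y)}\varphi)(x)=\int_{-\infty}^yA(x,z)\varphi(z)\,dz$; $(I+A)|_{(-\infty,y)}$ is the identity on $L^2(-\infty,y)$ plus $A|_{(-\infty,y)}$. For a Hilbert-Schmidt operator $A$, the regularized determinant is $\det_2(I+A)=\det\big((I+A)e^{-A}\big)$ (Fredholm determinant; $(I+A)e^{-A}-I$ is trace class). If $I+A$ is invertible, $D_2(A)=-A(I+A)^{-1}\det_2(I+A)$, so that $(I+A)^{-1}=I+D_2(A)/\det_2(I+A)$. *)

theory Defs
  imports
    "HOL-Analysis.Analysis"
    "HOL-Combinatorics.Permutations"
    "HOL-Library.Function_Algebras"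
begin

text \<open>
  The real Hilbert space \<open>L\<^sup>2(M)\<close> is handled through representatives: its elements are the
  square integrable functions, and two of them stand for the same element iff they agree almost
  everywhere. Accordingly an operator on \<open>L\<^sup>2(M)\<close> is a map \<open>T\<close> on functions; linearity is required
  almost everywhere, and together with boundedness it makes \<open>T\<close> respect almost-everywhere equality.
  Operators are compared by \<open>op_eq\<close>. Composition is \<open>(\<circ>)\<close>, the identity is \<open>id\<close>, and \<open>(+)\<close>, \<open>(-)\<close> on
  operators are the pointwise operations of \<open>HOL-Library.Function_Algebras\<close>. Operators on
  \<open>L\<^sup>2(-\<infinity>,y)\<close> are obtained by taking for \<open>M\<close> the restriction of Lebesgue measure to \<open>(-\<infinity>,y)\<close>;
  the values of functions outside \<open>(-\<infinity>,y)\<close> are then irrelevant.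
\<close>

type_synonym 'a operator = "('a \<Rightarrow> real) \<Rightarrow> 'a \<Rightarrow> real"

definition L2 :: "'a measure \<Rightarrow> ('a \<Rightarrow> real) set" where
  "L2 M = {f \<in> borel_measurable M. integrable M (\<lambda>x. (f x)\<^sup>2)}"

definition L2_inner :: "'a measure \<Rightarrow> ('a \<Rightarrow> real) \<Rightarrow> ('a \<Rightarrow> real) \<Rightarrow> real" where
  "L2_inner M f g = (\<integral>x. f x * g x \<partial>M)"

definition L2_norm :: "'a measure \<Rightarrow> ('a \<Rightarrow> real) \<Rightarrow> real" where
  "L2_norm M f = sqrt (L2_inner M f f)"

definition orthonormal_basis :: "'a measure \<Rightarrow> ('a \<Rightarrow> real) set \<Rightarrow> bool" where
  "orthonormal_basis M B \<longleftrightarrow>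
     B \<subseteq> L2 M \<and>
     (\<forall>e\<in>B. \<forall>f\<in>B. L2_inner M e f = (if e = f then 1 else 0)) \<and>
     (\<forall>g\<in>L2 M. (\<forall>e\<in>B. L2_inner M e g = 0) \<longrightarrow> (AE x in M. g x = 0))"


subsection \<open>Bounded operators\<close>

definition bounded_operator :: "'a measure \<Rightarrow> 'a operator \<Rightarrow> bool" where
  "bounded_operator M T \<longleftrightarrow>
     (\<forall>f\<in>L2 M. T f \<in> L2 M) \<and>
     (\<forall>f\<in>L2 M. \<forall>g\<in>L2 M. AE x in M. T (\<lambda>t. f t + g t) x = T f x + T g x) \<and>
     (\<forall>c. \<forall>f\<in>L2 M. AE x in M. T (\<lambda>t. c * f t) x = c * T f x) \<and>
     (\<exists>C. \<forall>f\<in>L2 M. L2_norm M (T f) \<le> C * L2_norm M f)"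

definition op_eq :: "'a measure \<Rightarrow> 'a operator \<Rightarrow> 'a operator \<Rightarrow> bool" where
  "op_eq M T U \<longleftrightarrow> (\<forall>f\<in>L2 M. AE x in M. T f x = U f x)"

definition is_op_inverse :: "'a measure \<Rightarrow> 'a operator \<Rightarrow> 'a operator \<Rightarrow> bool" where
  "is_op_inverse M T V \<longleftrightarrow>
     bounded_operator M V \<and> op_eq M (T \<circ> V) id \<and> op_eq M (V \<circ> T) id"

definition op_invertible :: "'a measure \<Rightarrow> 'a operator \<Rightarrow> bool" where
  "op_invertible M T \<longleftrightarrow> bounded_operator M T \<and> (\<exists>V. is_op_inverse M T V)"

text \<open>Inverse, adjoint and exponential are unique up to \<open>op_eq\<close>; a representative is chosen.\<close>

definition op_inv :: "'a measure \<Rightarrow> 'a operator \<Rightarrow> 'a operator" where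
  "op_inv M T = (SOME V. is_op_inverse M T V)"

definition op_adj :: "'a measure \<Rightarrow> 'a operator \<Rightarrow> 'a operator" where
  "op_adj M T = (SOME U. bounded_operator M U \<and>
     (\<forall>f\<in>L2 M. \<forall>g\<in>L2 M. L2_inner M (T f) g = L2_inner M f (U g)))"

definition op_exp :: "'a measure \<Rightarrow> 'a operator \<Rightarrow> 'a operator" where
  "op_exp M A f = (SOME g. g \<in> L2 M \<and>
     (\<lambda>N. L2_norm M (\<lambda>x. g x - (\<Sum>n<N. (A ^^ n) f x / fact n))) \<longlonglongrightarrow> 0)"


subsection \<open>Hilbert-Schmidt operators and kernels\<close>

definition hilbert_schmidt :: "'a measure \<Rightarrow> 'a operator \<Rightarrow> bool" where
  "hilbert_schmidt M T \<longleftrightarrow> bounded_operator M T \<and>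
     (\<exists>B. orthonormal_basis M B \<and> (\<lambda>e. (L2_norm M (T e))\<^sup>2) summable_on B)"

definition integral_op :: "'a measure \<Rightarrow> ('a \<times> 'a \<Rightarrow> real) \<Rightarrow> 'a operator" where
  "integral_op M A \<phi> = (\<lambda>x. \<integral>y. A (x, y) * \<phi> y \<partial>M)"

definition has_kernel :: "'a measure \<Rightarrow> 'a operator \<Rightarrow> ('a \<times> 'a \<Rightarrow> real) \<Rightarrow> bool" where
  "has_kernel M T A \<longleftrightarrow> A \<in> L2 (M \<Otimes>\<^sub>M M) \<and> op_eq M T (integral_op M A)"


subsection \<open>Determinants\<close>

text \<open>
  The Fredholm determinant is \<open>det (I + T) = (\<Sum>k. tr (\<Lambda>\<^sup>k T))\<close> for trace class \<open>T\<close>. Evaluating the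
  traces in the orthonormal basis \<open>e\<^sub>1 \<and> \<dots> \<and> e\<^sub>k\<close> of the exterior power, where \<open>{e\<^sub>1, \<dots>, e\<^sub>k}\<close>
  runs through the \<open>k\<close>-element subsets of an orthonormal basis \<open>B\<close>, turns this into the absolutely
  convergent sum of the principal minors of the matrix of \<open>T\<close>; it does not depend on \<open>B\<close>.
\<close>

definition principal_minor :: "'a measure \<Rightarrow> 'a operator \<Rightarrow> ('a \<Rightarrow> real) set \<Rightarrow> real" where
  "principal_minor M T F =
     (\<Sum>p | p permutes F. of_int (sign p) * (\<Prod>e\<in>F. L2_inner M e (T (p e))))"

definition fredholm_det :: "'a measure \<Rightarrow> 'a operator \<Rightarrow> real" where
  "fredholm_det M U =
     (let B = (SOME B. orthonormal_basis M B)
      in \<Sum>\<^sub>\<infinity>F\<in>{F. finite F \<and> F \<subseteq> B}. principal_minor M (U - id) F)"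

text \<open>\<open>det2 M A\<close> is \<open>det\<^sub>2(I + A)\<close>: the argument is the Hilbert-Schmidt part.\<close>

definition det2 :: "'a measure \<Rightarrow> 'a operator \<Rightarrow> real" where
  "det2 M A = fredholm_det M ((id + A) \<circ> op_exp M (- A))"

definition D2 :: "'a measure \<Rightarrow> 'a operator \<Rightarrow> 'a operator" where
  "D2 M A f = (\<lambda>x. - (A (op_inv M (id + A) f) x * det2 M A))"


subsection \<open>The groups\<close>

definition hs_group :: "real operator set" where
  "hs_group = {T. op_invertible lborel T \<and> hilbert_schmidt lborel (T - id)}"

definition volterra_ops :: "real operator set" where
  "volterra_ops = {T. hilbert_schmidt lborel T \<and>
     (\<exists>A. has_kernel lborel T A \<and>
          (AE (x, y) in lborel \<Otimes>\<^sub>M lborel. x < y \<longrightarrow> A (x, y) = 0))}"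

definition volterra_group :: "real operator set" where
  "volterra_group = {T. T - id \<in> volterra_ops}"

definition orthogonal_group :: "real operator set" where
  "orthogonal_group = {k \<in> hs_group.
     op_eq lborel (k \<circ> op_adj lborel k) id \<and> op_eq lborel (op_adj lborel k \<circ> k) id}"


subsection \<open>Restriction to half lines\<close>

definition below :: "real \<Rightarrow> real measure" where
  "below y = restrict_space lborel {..<y}"

text \<open>\<open>A|\<^bsub>(-\<infinity>,y)\<^esub>\<close> as an operator on \<open>L\<^sup>2(-\<infinity>,y)\<close>, i.e. over the measure \<open>below y\<close>.\<close>

definition restrict_op :: "(real \<times> real \<Rightarrow> real) \<Rightarrow> real \<Rightarrow> real operator" where
  "restrict_op A y = integral_op (below y) A"

end

theory Submission
  imports Defs
begin

text \<open>
  Since \<open>b\<^sub>+\<close> is orthogonal, \<open>I + S = (I + K)(I + K)\<^sup>* = b\<^sub>- b\<^sub>-\<^sup>*\<close>, so the problem is to factor the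
  coercive operator \<open>I + S\<close>. By Lax-Milgram on the upper triangular kernels in \<open>L\<^sup>2(\<real>\<^sup>2)\<close> there is an
  upper triangular \<open>C\<close> for which \<open>L = (I + S)(I + C)\<close> is \<open>I\<close> plus a lower triangular kernel. Then
  \<open>(I + C\<^sup>*)(I + S)(I + C) - I\<close> is both symmetric and lower triangular, hence \<open>0\<close>; and \<open>I + C\<^sup>*\<close> is injective
  by a Gronwall argument, so \<open>L\<close> and \<open>I + C\<^sup>*\<close> are inverse to each other. One takes \<open>b\<^sub>- = L\<close> and
  \<open>b\<^sub>+ = (I + K)\<^sup>* (I + C)\<close>. Column by column, the equation defining \<open>C\<close> is the half line formula.

  The regularized determinant is positive: for symmetric \<open>A\<close> with \<open>I + A \<ge> c > 0\<close>, the matrix of \<open>(I + A) e\<^bsup>-A\<^esup>\<close>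
  is \<open>I - Q\<close> with \<open>Q\<close> of trace class and \<open>0 \<le> Q \<le> (1 - c') I\<close>. Schur complements bound the finite sections of
  its determinant below by a positive constant, and Hadamard's inequality makes the sum of all principal minors converge.
\<close>

section \<open>Square integrable functions\<close>

text \<open>The coercivity behind every inversion comes from the invertibility of I + K: if its
  inverse has norm at most D, then <f, (I + S) f> = |(I + K)^T f|^2 >= |f|^2 / D^2. A quadratic
  lower bound of this kind survives compression to a half line and integration over the columns of a
  kernel, so one constant serves every y. Inverses of Volterra factors are not known beforehand to
  be of the same kind. Uniqueness therefore rests on a regularity statement: in (I + l)(I + W) = I +
  L with l and L lower triangular, each column of W solves a homogeneous Volterra equation above the
  diagonal, so W is lower triangular as well. Spectral calculus for e^{-A} is replaced by the scalar
  sequences <f, A^n f>: bounds on A become positivity of Hankel forms, and monotonicity in one real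
  variable does the rest. The determinant is an unordered sum over the finite subsets of an
  arbitrary basis, and such a sum is 0 by convention when it diverges; its positivity therefore
  requires summability as well as a lower bound that is uniform in the finite sections.\<close>

lemma L2_measurable [measurable_dest]: "f \<in> L2 M \<Longrightarrow> f \<in> borel_measurable M"
  by (simp add: L2_def)

lemma L2_integrable_square: "f \<in> L2 M \<Longrightarrow> integrable M (\<lambda>x. (f x)\<^sup>2)"
  by (simp add: L2_def)

lemma L2_integrable_mult:
  assumes "f \<in> L2 M" "g \<in> L2 M"
  shows "integrable M (\<lambda>x. f x * g x)"
proof (rule Bochner_Integration.integrable_bound)
  show "integrable M (\<lambda>x. (f x)\<^sup>2 + (g x)\<^sup>2)"
    using assms by (intro Bochner_Integration.integrable_add L2_integrable_square)
  show "(\<lambda>x. f x * g x) \<in> borel_measurable M"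
    using assms by (auto dest!: L2_measurable)
  have "\<bar>a * b\<bar> \<le> a\<^sup>2 + b\<^sup>2" for a b :: real
  proof -
    have "2 * \<bar>a\<bar> * \<bar>b\<bar> \<le> \<bar>a\<bar>\<^sup>2 + \<bar>b\<bar>\<^sup>2" by (rule sum_squares_bound)
    moreover have "0 \<le> \<bar>a\<bar> * \<bar>b\<bar>" by simp
    ultimately show ?thesis unfolding abs_mult power2_abs by linarith
  qed
  then show "AE x in M. norm (f x * g x) \<le> norm ((f x)\<^sup>2 + (g x)\<^sup>2)"
    by auto
qed

lemma L2_add:
  assumes "f \<in> L2 M" "g \<in> L2 M"
  shows "(\<lambda>x. f x + g x) \<in> L2 M"
proof -
  have "integrable M (\<lambda>x. (f x)\<^sup>2 + (g x)\<^sup>2 + 2 * (f x * g x))"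
    using assms by (intro Bochner_Integration.integrable_add L2_integrable_square integrable_mult_right L2_integrable_mult)
  moreover have "(\<lambda>x. (f x)\<^sup>2 + (g x)\<^sup>2 + 2 * (f x * g x)) = (\<lambda>x. (f x + g x)\<^sup>2)"
    by (auto simp: power2_eq_square algebra_simps)
  ultimately show ?thesis
    using assms by (auto simp: L2_def)
qed

lemma L2_scale: "f \<in> L2 M \<Longrightarrow> (\<lambda>x. c * f x) \<in> L2 M"
  by (auto simp: L2_def power_mult_distrib)

lemma L2_zero: "(\<lambda>x. 0) \<in> L2 M"
  by (simp add: L2_def)

lemma L2_uminus: "f \<in> L2 M \<Longrightarrow> (\<lambda>x. - f x) \<in> L2 M"
  by (auto simp: L2_def)

lemma L2_diff:
  assumes "f \<in> L2 M" "g \<in> L2 M"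
  shows "(\<lambda>x. f x - g x) \<in> L2 M"
  using L2_add[OF assms(1) L2_uminus[OF assms(2)]] by simp

lemma L2_sum: "(\<And>i. i \<in> I \<Longrightarrow> f i \<in> L2 M) \<Longrightarrow> (\<lambda>x. \<Sum>i\<in>I. f i x) \<in> L2 M"
  by (induction I rule: infinite_finite_induct) (auto intro: L2_zero L2_add)

lemmas L2_closed = L2_zero L2_add L2_scale L2_uminus L2_diff L2_sum

section \<open>Inner product and norm\<close>

lemma L2_inner_commute: "L2_inner M f g = L2_inner M g f"
  by (simp add: L2_inner_def mult.commute)

lemma L2_inner_add_right:
  assumes "f \<in> L2 M" "g \<in> L2 M" "h \<in> L2 M"
  shows "L2_inner M f (\<lambda>x. g x + h x) = L2_inner M f g + L2_inner M f h"
  unfolding L2_inner_def distrib_left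
  by (rule Bochner_Integration.integral_add) (use assms L2_integrable_mult in auto)

lemma L2_inner_add_left:
  assumes "f \<in> L2 M" "g \<in> L2 M" "h \<in> L2 M"
  shows "L2_inner M (\<lambda>x. g x + h x) f = L2_inner M g f + L2_inner M h f"
  using L2_inner_add_right[OF assms] by (simp add: L2_inner_commute)

lemma L2_inner_scale_right: "L2_inner M f (\<lambda>x. c * g x) = c * L2_inner M f g"
  unfolding L2_inner_def by (subst integral_mult_right_zero[symmetric]) (simp add: mult.left_commute)

lemma L2_inner_scale_left: "L2_inner M (\<lambda>x. c * g x) f = c * L2_inner M g f"
  by (metis L2_inner_scale_right L2_inner_commute)

lemma L2_inner_uminus_right: "L2_inner M f (\<lambda>x. - g x) = - L2_inner M f g"
  using L2_inner_scale_right[of M f "-1" g] by simp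

lemma L2_inner_zero_right: "L2_inner M f (\<lambda>x. 0) = 0"
  by (simp add: L2_inner_def)

lemma L2_inner_zero_left: "L2_inner M (\<lambda>x. 0) f = 0"
  by (simp add: L2_inner_def)

lemma L2_inner_diff_right:
  assumes "f \<in> L2 M" "g \<in> L2 M" "h \<in> L2 M"
  shows "L2_inner M f (\<lambda>x. g x - h x) = L2_inner M f g - L2_inner M f h"
  using L2_inner_add_right[OF assms(1,2) L2_uminus[OF assms(3)]] by (simp add: L2_inner_uminus_right)

lemma L2_inner_sum_right:
  assumes "f \<in> L2 M" "\<And>i. i \<in> I \<Longrightarrow> g i \<in> L2 M"
  shows "L2_inner M f (\<lambda>x. \<Sum>i\<in>I. g i x) = (\<Sum>i\<in>I. L2_inner M f (g i))"
  using assms(2)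
proof (induction I rule: infinite_finite_induct)
  case (insert i I)
  then have "L2_inner M f (\<lambda>x. g i x + (\<Sum>i\<in>I. g i x)) = L2_inner M f (g i) + L2_inner M f (\<lambda>x. (\<Sum>i\<in>I. g i x))"
    by (intro L2_inner_add_right L2_sum) (use assms insert in auto)
  with insert show ?case by simp
qed (simp_all add: L2_inner_zero_right)

lemma L2_inner_sum_left:
  assumes "f \<in> L2 M" "\<And>i. i \<in> I \<Longrightarrow> g i \<in> L2 M"
  shows "L2_inner M (\<lambda>x. \<Sum>i\<in>I. g i x) f = (\<Sum>i\<in>I. L2_inner M (g i) f)"
  using L2_inner_sum_right[OF assms] by (simp add: L2_inner_commute)

lemma L2_inner_cong_AE:
  assumes "f \<in> L2 M" "g \<in> L2 M" "f' \<in> L2 M" "g' \<in> L2 M"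
    and "AE x in M. f x = f' x" "AE x in M. g x = g' x"
  shows "L2_inner M f g = L2_inner M f' g'"
  unfolding L2_inner_def
  by (rule integral_cong_AE) (use assms in \<open>auto dest!: L2_measurable\<close>)

lemma L2_inner_self_nonneg: "0 \<le> L2_inner M f f"
  by (simp add: L2_inner_def)

lemma L2_norm_nonneg: "0 \<le> L2_norm M f"
  by (simp add: L2_norm_def L2_inner_self_nonneg)

lemma L2_norm_power2: "(L2_norm M f)\<^sup>2 = L2_inner M f f"
  by (simp add: L2_norm_def L2_inner_self_nonneg)

lemma L2_norm_zero: "L2_norm M (\<lambda>x. 0) = 0"
  by (simp add: L2_norm_def L2_inner_zero_left)

lemma L2_norm_scale: "L2_norm M (\<lambda>x. c * f x) = \<bar>c\<bar> * L2_norm M f"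
  by (simp add: L2_norm_def L2_inner_scale_left L2_inner_scale_right real_sqrt_mult flip: mult.assoc)

lemma L2_norm_uminus: "L2_norm M (\<lambda>x. - f x) = L2_norm M f"
  using L2_norm_scale[of M "-1" f] by simp

lemma L2_norm_minus_commute: "L2_norm M (\<lambda>x. f x - g x) = L2_norm M (\<lambda>x. g x - f x)"
  using L2_norm_uminus[of M "\<lambda>x. f x - g x"] by simp

lemma L2_norm_cong_AE:
  assumes "f \<in> L2 M" "g \<in> L2 M" "AE x in M. f x = g x"
  shows "L2_norm M f = L2_norm M g"
  using L2_inner_cong_AE[OF assms(1,1,2,2,3,3)] by (simp add: L2_norm_def)

lemma L2_norm_eq_0_iff:
  assumes "f \<in> L2 M"
  shows "L2_norm M f = 0 \<longleftrightarrow> (AE x in M. f x = 0)"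
  using integral_nonneg_eq_0_iff_AE[of M "\<lambda>x. f x * f x"] assms
  by (auto simp: L2_norm_def L2_inner_def L2_integrable_mult)

lemma L2_inner_eq_0_AE:
  assumes "f \<in> L2 M" "L2_inner M f f = 0"
  shows "AE x in M. f x = 0"
  using L2_norm_eq_0_iff[OF assms(1)] assms(2) by (simp add: L2_norm_def)

text \<open>Cauchy-Schwarz for positive semidefinite forms, in scalar form: \<open>a\<close>, \<open>b\<close>, \<open>d\<close> are the values of
  the form at \<open>(f, f)\<close>, \<open>(f, g)\<close>, \<open>(g, g)\<close>.\<close>

lemma quadratic_nonneg_imp_discriminant:
  fixes a b d :: real
  assumes "\<And>t. 0 \<le> a + 2 * t * b + t\<^sup>2 * d"
  shows "b\<^sup>2 \<le> a * d"
proof (cases "d = 0")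
  case True
  have "b = 0"
  proof (rule ccontr)
    assume "b \<noteq> 0"
    \<comment> \<open>With \<open>d = 0\<close> the form is affine in \<open>t\<close> and takes the
      value -1 here.\<close>
    then show False using assms[of "- (a + 1) / (2 * b)"] True by (simp add: field_simps)
  qed
  then show ?thesis using True by simp
next
  case False
  have "d \<ge> 0"
  proof (rule ccontr)
    assume "\<not> d \<ge> 0"
    \<comment> \<open>If \<open>d < 0\<close>, this \<open>t >= 1\<close> gives
      \<open>t * d < - (|a| + 2 |b| + 1)\<close>, so the quadratic term outweighs the other
      two.\<close>
    define t where "t = (\<bar>a\<bar> + 2 * \<bar>b\<bar> + 1) / - d + 1"
    have t: "t \<ge> 1" using \<open>\<not> d \<ge> 0\<close> by (simp add: t_def field_simps)
    have "t * d = - (\<bar>a\<bar> + 2 * \<bar>b\<bar> + 1) + d" using \<open>\<not> d \<ge> 0\<close> by (simp add: t_def field_simps)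
    then have "t * d < - (\<bar>a\<bar> + 2 * \<bar>b\<bar> + 1)" using \<open>\<not> d \<ge> 0\<close> by simp
    then have "t * (t * d) < t * (- (\<bar>a\<bar> + 2 * \<bar>b\<bar> + 1))" using t by (intro mult_strict_left_mono) auto
    moreover have "t * (- (\<bar>a\<bar> + 2 * \<bar>b\<bar> + 1)) = - (t * \<bar>a\<bar>) - 2 * (t * \<bar>b\<bar>) - t" by algebra
    moreover have "t * \<bar>a\<bar> \<ge> \<bar>a\<bar>" "t * \<bar>b\<bar> \<ge> t * b"
      using t by (auto simp: mult_le_cancel_right1 intro: mult_left_mono)
    moreover have "0 \<le> a + 2 * (t * b) + t * (t * d)"
      using assms[of t] by (simp add: power2_eq_square mult.assoc)
    ultimately show False using t by linarith
  qed
  with False have "d > 0" by simp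
  then show ?thesis using assms[of "- b / d"] by (simp add: field_simps power2_eq_square)
qed

lemma L2_inner_line:
  assumes "f \<in> L2 M" "g \<in> L2 M"
  shows "L2_inner M (\<lambda>x. f x + t * g x) (\<lambda>x. f x + t * g x)
    = L2_inner M f f + 2 * t * L2_inner M f g + t\<^sup>2 * L2_inner M g g"
  using assms
  by (simp add: L2_inner_add_left L2_inner_add_right L2_scale L2_add L2_inner_scale_left
      L2_inner_scale_right L2_inner_commute[of M g f] power2_eq_square algebra_simps)

lemma L2_Cauchy_Schwarz:
  assumes "f \<in> L2 M" "g \<in> L2 M"
  shows "\<bar>L2_inner M f g\<bar> \<le> L2_norm M f * L2_norm M g"
proof -
  have "(L2_inner M f g)\<^sup>2 \<le> L2_inner M f f * L2_inner M g g"
    by (rule quadratic_nonneg_imp_discriminant)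
       (metis L2_inner_self_nonneg L2_inner_line[OF assms])
  then have "(L2_inner M f g)\<^sup>2 \<le> (L2_norm M f * L2_norm M g)\<^sup>2"
    by (simp add: power_mult_distrib L2_norm_power2)
  then show ?thesis
    by (metis L2_norm_nonneg abs_le_square_iff abs_of_nonneg mult_nonneg_nonneg)
qed

lemma L2_norm_triangle:
  assumes "f \<in> L2 M" "g \<in> L2 M"
  shows "L2_norm M (\<lambda>x. f x + g x) \<le> L2_norm M f + L2_norm M g"
proof -
  have "(L2_norm M (\<lambda>x. f x + g x))\<^sup>2 = L2_inner M f f + 2 * L2_inner M f g + L2_inner M g g"
    using L2_inner_line[OF assms, of 1] by (simp add: L2_norm_power2)
  also have "\<dots> \<le> (L2_norm M f + L2_norm M g)\<^sup>2"
    using L2_Cauchy_Schwarz[OF assms] by (simp add: power2_sum L2_norm_power2)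
  finally show ?thesis
    by (rule power2_le_imp_le) (simp add: L2_norm_nonneg)
qed

lemma L2_norm_triangle_diff:
  assumes "f \<in> L2 M" "g \<in> L2 M" "h \<in> L2 M"
  shows "L2_norm M (\<lambda>x. f x - h x) \<le> L2_norm M (\<lambda>x. f x - g x) + L2_norm M (\<lambda>x. g x - h x)"
  using L2_norm_triangle[OF L2_diff[OF assms(1,2)] L2_diff[OF assms(2,3)]] by simp

lemma L2_norm_sum_le:
  assumes "\<And>i. i \<in> I \<Longrightarrow> f i \<in> L2 M"
  shows "L2_norm M (\<lambda>x. \<Sum>i\<in>I. f i x) \<le> (\<Sum>i\<in>I. L2_norm M (f i))"
  using assms
proof (induction I rule: infinite_finite_induct)
  case (insert i I)
  then have "L2_norm M (\<lambda>x. f i x + (\<Sum>i\<in>I. f i x)) \<le> L2_norm M (f i) + L2_norm M (\<lambda>x. (\<Sum>i\<in>I. f i x))"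
    by (intro L2_norm_triangle L2_sum) auto
  with insert show ?case by force
qed (simp_all add: L2_norm_zero)

lemma L2_inner_tendsto:
  assumes "\<And>n. f n \<in> L2 M" "g \<in> L2 M" "h \<in> L2 M"
    and "(\<lambda>n. L2_norm M (\<lambda>x. g x - f n x)) \<longlonglongrightarrow> 0"
  shows "(\<lambda>n. L2_inner M h (f n)) \<longlonglongrightarrow> L2_inner M h g"
proof -
  have "(\<lambda>n. L2_inner M h g - L2_inner M h (f n)) \<longlonglongrightarrow> 0"
  proof (rule Lim_null_comparison)
    show "\<forall>\<^sub>F n in sequentially. norm (L2_inner M h g - L2_inner M h (f n))
        \<le> L2_norm M h * L2_norm M (\<lambda>x. g x - f n x)"
      using L2_Cauchy_Schwarz[OF assms(3) L2_diff[OF assms(2,1)]] assms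
      by (simp add: L2_inner_diff_right)
    show "(\<lambda>n. L2_norm M h * L2_norm M (\<lambda>x. g x - f n x)) \<longlonglongrightarrow> 0"
      using tendsto_mult_left[OF assms(4)] by simp
  qed
  from tendsto_diff[OF tendsto_const[of "L2_inner M h g"] this] show ?thesis by simp
qed

section \<open>Completeness\<close>

lemma nn_integral_L2_norm:
  assumes "f \<in> L2 M"
  shows "(\<integral>\<^sup>+x. ennreal ((f x)\<^sup>2) \<partial>M) = ennreal ((L2_norm M f)\<^sup>2)"
  unfolding L2_norm_power2 L2_inner_def
  by (subst nn_integral_eq_integral[OF L2_integrable_square[OF assms]])
     (auto simp: power2_eq_square)

text \<open>The Bochner integral of a function that is not integrable is 0, so square integrability
  cannot be read off from it. A bound on the nonnegative integral yields membership and the norm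
  estimate together.\<close>

lemma L2I_nn_integral:
  assumes "f \<in> borel_measurable M" "(\<integral>\<^sup>+x. ennreal ((f x)\<^sup>2) \<partial>M) \<le> ennreal C" "C \<ge> 0"
  shows "f \<in> L2 M" "L2_inner M f f \<le> C"
proof -
  have "(\<integral>\<^sup>+x. ennreal ((f x)\<^sup>2) \<partial>M) < \<infinity>"
    using assms(2) by (simp add: le_less_trans)
  then have "integrable M (\<lambda>x. (f x)\<^sup>2)"
    using assms(1) by (intro integrableI_nonneg) auto
  then show L: "f \<in> L2 M" using assms by (simp add: L2_def)
  show "L2_inner M f f \<le> C"
    using nn_integral_L2_norm[OF L] assms(2,3) by (simp add: L2_norm_power2)
qed

text \<open>The partial sums \<open>S N\<close> of the absolute increments stay bounded in norm. By
  monotone convergence the supremum of their squares has a finite integral, hence is finite almost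
  everywhere, and the increments are absolutely summable there.\<close>

lemma L2_telescope_AE_convergent:
  assumes f: "\<And>n. f n \<in> L2 M"
    and le: "\<And>n. L2_norm M (\<lambda>x. f (Suc n) x - f n x) \<le> c n" and c: "summable c"
  shows "AE x in M. convergent (\<lambda>n. f n x)"
proof -
  define S where "S N x = (\<Sum>n<N. \<bar>f (Suc n) x - f n x\<bar>)" for N x
  have d: "(\<lambda>x. \<bar>f (Suc n) x - f n x\<bar>) \<in> L2 M" for n
    using L2_diff[OF f f, of "Suc n" n] by (auto simp: L2_def)
  have dn: "L2_norm M (\<lambda>x. \<bar>f (Suc n) x - f n x\<bar>) = L2_norm M (\<lambda>x. f (Suc n) x - f n x)" for n
    by (simp add: L2_norm_def L2_inner_def)
  have SL: "S N \<in> L2 M" for N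
    unfolding S_def by (intro L2_sum d)
  have cn: "c n \<ge> 0" for n using le[of n] L2_norm_nonneg order_trans by blast
  have "L2_norm M (S N) \<le> (\<Sum>n<N. L2_norm M (\<lambda>x. \<bar>f (Suc n) x - f n x\<bar>))" for N
    unfolding S_def by (intro L2_norm_sum_le d)
  also have "(\<Sum>n<N. L2_norm M (\<lambda>x. \<bar>f (Suc n) x - f n x\<bar>)) \<le> (\<Sum>n<N. c n)" for N
    by (intro sum_mono) (simp add: dn le)
  also have "(\<Sum>n<N. c n) \<le> suminf c" for N
    by (intro sum_le_suminf c) (auto simp: cn)
  finally have Sn: "L2_norm M (S N) \<le> suminf c" for N .
  have "(\<integral>\<^sup>+x. (SUP N. ennreal ((S N x)\<^sup>2)) \<partial>M) = (SUP N. \<integral>\<^sup>+x. ennreal ((S N x)\<^sup>2) \<partial>M)"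
  proof (rule nn_integral_monotone_convergence_SUP)
    show "incseq (\<lambda>i x. ennreal ((S i x)\<^sup>2))"
      by (auto simp: incseq_def le_fun_def S_def intro!: ennreal_leI power_mono sum_mono2 sum_nonneg)
    show "(\<lambda>x. ennreal ((S i x)\<^sup>2)) \<in> borel_measurable M" for i
      using SL[of i] by (auto dest: L2_measurable)
  qed
  also have "\<dots> \<le> ennreal ((suminf c)\<^sup>2)"
    by (auto simp: nn_integral_L2_norm[OF SL] intro!: SUP_least ennreal_leI power_mono Sn L2_norm_nonneg)
  finally have "(\<integral>\<^sup>+x. (SUP N. ennreal ((S N x)\<^sup>2)) \<partial>M) \<noteq> \<infinity>"
    by (auto simp: top_unique)
  moreover have "(\<lambda>x. SUP N. ennreal ((S N x)\<^sup>2)) \<in> borel_measurable M"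
    using SL by (auto dest: L2_measurable)
  ultimately have "AE x in M. (SUP N. ennreal ((S N x)\<^sup>2)) \<noteq> \<infinity>"
    by (intro nn_integral_PInf_AE)
  then show ?thesis
  proof eventually_elim
    case (elim x)
    then obtain r where r: "(SUP N. ennreal ((S N x)\<^sup>2)) = ennreal r" "r \<ge> 0"
      by (cases "(SUP N. ennreal ((S N x)\<^sup>2))") auto
    have "(S N x)\<^sup>2 \<le> r" for N
      using r SUP_upper[of N UNIV "\<lambda>N. ennreal ((S N x)\<^sup>2)"] by (simp)
    then have "S N x \<le> sqrt r" for N
      by (meson real_le_rsqrt)
    then have "summable (\<lambda>n. \<bar>f (Suc n) x - f n x\<bar>)"
      unfolding S_def by (intro summableI_nonneg_bounded) auto
    then have "summable (\<lambda>n. f (Suc n) x - f n x)"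
      by (rule summable_rabs_cancel)
    then have "convergent (\<lambda>n. \<Sum>i<n. f (Suc i) x - f i x)"
      by (simp add: summable_iff_convergent)
    then have "convergent (\<lambda>n. (f n x - f 0 x) + f 0 x)"
      by (intro convergent_add convergent_const) (simp add: sum_lessThan_telescope[where f="\<lambda>i. f i x"])
    then show ?case by simp
  qed
qed

text \<open>Riesz-Fischer for rapidly converging sequences: the pointwise limit is also the limit in
  norm, because Fatou's lemma bounds its distance to \<open>f n\<close> by the tail
  \<open>R n\<close> of the majorant.\<close>

lemma L2_complete_telescope:
  assumes f: "\<And>n. f n \<in> L2 M"
    and le: "\<And>n. L2_norm M (\<lambda>x. f (Suc n) x - f n x) \<le> c n" and c: "summable c"
  obtains g where "g \<in> L2 M" "(\<lambda>n. L2_norm M (\<lambda>x. g x - f n x)) \<longlonglongrightarrow> 0"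
proof -
  \<comment> \<open>\<open>lim\<close> has some unspecified value where the sequence diverges;
    \<open>g\<close> is measurable all the same, and the exceptional set is null.\<close>
  define g where "g x = lim (\<lambda>n. f n x)" for x
  have gm: "g \<in> borel_measurable M"
    unfolding g_def using f by (intro borel_measurable_lim_metric) (auto dest: L2_measurable)
  have cn: "c n \<ge> 0" for n using le[of n] L2_norm_nonneg order_trans by blast
  define R where "R n = (\<Sum>k. c (k + n))" for n
  have Rn: "R n \<ge> 0" for n unfolding R_def by (intro suminf_nonneg summable_ignore_initial_segment c cn)
  have bnd: "L2_norm M (\<lambda>x. f (n + m) x - f n x) \<le> R n" for n m
  proof -
    have "L2_norm M (\<lambda>x. f (n + m) x - f n x) \<le> (\<Sum>k<m. c (k + n))"
    proof (induction m)
      case 0 show ?case by (simp add: L2_norm_zero)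
    next
      case (Suc m)
      have "L2_norm M (\<lambda>x. f (n + Suc m) x - f n x) \<le> L2_norm M (\<lambda>x. f (Suc (n + m)) x - f (n + m) x) + L2_norm M (\<lambda>x. f (n + m) x - f n x)"
        using L2_norm_triangle_diff[of "f (n + Suc m)" M "f (n + m)" "f n"] f by simp
      with Suc le[of "n + m"] show ?case by (simp add: add.commute)
    qed
    also have "\<dots> \<le> R n"
      unfolding R_def using c cn by (intro sum_le_suminf) (auto simp: summable_ignore_initial_segment)
    finally show ?thesis .
  qed
  have key: "(\<integral>\<^sup>+x. ennreal ((g x - f n x)\<^sup>2) \<partial>M) \<le> ennreal ((R n)\<^sup>2)" for n
  proof -
    have "AE x in M. ennreal ((g x - f n x)\<^sup>2) = liminf (\<lambda>m. ennreal ((f (n + m) x - f n x)\<^sup>2))"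
      using L2_telescope_AE_convergent[OF f le c]
    proof eventually_elim
      case (elim x)
      then have "(\<lambda>m. f m x) \<longlonglongrightarrow> g x" by (simp add: g_def convergent_LIMSEQ_iff)
      then have "(\<lambda>m. f (m + n) x) \<longlonglongrightarrow> g x" by (rule LIMSEQ_ignore_initial_segment)
      then have "(\<lambda>m. ennreal ((f (n + m) x - f n x)\<^sup>2)) \<longlonglongrightarrow> ennreal ((g x - f n x)\<^sup>2)"
        by (intro tendsto_ennrealI tendsto_intros) (simp add: add.commute)
      then show ?case by (metis lim_imp_Liminf sequentially_bot)
    qed
    then have "(\<integral>\<^sup>+x. ennreal ((g x - f n x)\<^sup>2) \<partial>M) = (\<integral>\<^sup>+x. liminf (\<lambda>m. ennreal ((f (n + m) x - f n x)\<^sup>2)) \<partial>M)"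
      by (rule nn_integral_cong_AE)
    also have "\<dots> \<le> liminf (\<lambda>m. \<integral>\<^sup>+x. ennreal ((f (n + m) x - f n x)\<^sup>2) \<partial>M)"
      using f by (intro nn_integral_liminf) (auto dest!: L2_measurable)
    also have "\<dots> = liminf (\<lambda>m. ennreal ((L2_norm M (\<lambda>x. f (n + m) x - f n x))\<^sup>2))"
      by (subst nn_integral_L2_norm[OF L2_diff[OF f f]]) simp
    also have "\<dots> \<le> liminf (\<lambda>m. ennreal ((R n)\<^sup>2))"
      by (intro Liminf_mono always_eventually allI ennreal_leI power_mono bnd L2_norm_nonneg)
    finally show ?thesis by (simp add: Liminf_const)
  qed
  have gf: "(\<lambda>x. g x - f n x) \<in> L2 M" "L2_inner M (\<lambda>x. g x - f n x) (\<lambda>x. g x - f n x) \<le> (R n)\<^sup>2" for n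
    using L2I_nn_integral[of "\<lambda>x. g x - f n x" M "(R n)\<^sup>2"] key[of n] gm L2_measurable[OF f[of n]]
    by auto
  have "g \<in> L2 M" using L2_add[OF gf(1)[of 0] f[of 0]] by simp
  moreover have "(\<lambda>n. L2_norm M (\<lambda>x. g x - f n x)) \<longlonglongrightarrow> 0"
  proof (rule Lim_null_comparison)
    show "\<forall>\<^sub>F n in sequentially. norm (L2_norm M (\<lambda>x. g x - f n x)) \<le> R n"
      using gf(2) Rn by (auto simp: L2_norm_def L2_inner_self_nonneg real_le_lsqrt)
    show "R \<longlonglongrightarrow> 0" unfolding R_def by (rule suminf_exist_split2[OF c])
  qed
  ultimately show thesis by (rule that)
qed

lemma L2_complete:
  assumes f: "\<And>n. f n \<in> L2 M"
    and Cauchy: "\<And>e. e > 0 \<Longrightarrow> \<exists>N. \<forall>m\<ge>N. \<forall>n\<ge>N. L2_norm M (\<lambda>x. f m x - f n x) < e"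
  obtains g where "g \<in> L2 M" "(\<lambda>n. L2_norm M (\<lambda>x. g x - f n x)) \<longlonglongrightarrow> 0"
proof -
  have "\<forall>k. \<exists>N. \<forall>m\<ge>N. \<forall>n\<ge>N. L2_norm M (\<lambda>x. f m x - f n x) < (1/2)^k"
    using Cauchy by simp
  then obtain N where N: "\<And>k m n. m \<ge> N k \<Longrightarrow> n \<ge> N k \<Longrightarrow> L2_norm M (\<lambda>x. f m x - f n x) < (1/2)^k"
    by metis
  \<comment> \<open>Summing the thresholds makes the index sequence nondecreasing while keeping
    \<open>N k <= r k\<close>, so consecutive terms of the subsequence differ by at most
    \<open>(1/2)^k\<close>.\<close>
  define r where "r k = (\<Sum>i\<le>k. N i)" for k
  have r: "N k \<le> r k" "r k \<le> r (Suc k)" for k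
    by (auto simp: r_def intro: member_le_sum)
  have "L2_norm M (\<lambda>x. f (r (Suc k)) x - f (r k) x) \<le> (1/2)^k" for k
    using N[of k "r (Suc k)" "r k"] r[of k] by simp
  moreover have "summable (\<lambda>k. (1/2::real)^k)" by simp
  ultimately obtain g where g: "g \<in> L2 M" "(\<lambda>k. L2_norm M (\<lambda>x. g x - f (r k) x)) \<longlonglongrightarrow> 0"
    using L2_complete_telescope[of "\<lambda>k. f (r k)" M] f by metis
  have "(\<lambda>n. L2_norm M (\<lambda>x. g x - f n x)) \<longlonglongrightarrow> 0"
  proof (rule LIMSEQ_I)
    fix e :: real assume "e > 0"
    then obtain k0 where k0: "\<And>k. k \<ge> k0 \<Longrightarrow> L2_norm M (\<lambda>x. g x - f (r k) x) < e / 2"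
      using LIMSEQ_D[OF g(2), of "e / 2"] by (auto simp: L2_norm_nonneg)
    obtain k1 where k1: "(1/2::real)^k1 < e / 2"
      using \<open>e > 0\<close> real_arch_pow_inv[of "e/2" "1/2"] by auto
    define k where "k = max k0 k1"
    have "(1/2::real)^k \<le> (1/2)^k1" by (rule power_decreasing) (auto simp: k_def)
    show "\<exists>no. \<forall>n\<ge>no. norm (L2_norm M (\<lambda>x. g x - f n x) - 0) < e"
    proof (intro exI[of _ "r k"] allI impI)
      fix n assume "n \<ge> r k"
      then have "L2_norm M (\<lambda>x. f (r k) x - f n x) < (1/2)^k"
        using N[of k "r k" n] r(1)[of k] by simp
      moreover have "L2_norm M (\<lambda>x. g x - f n x) \<le> L2_norm M (\<lambda>x. g x - f (r k) x) + L2_norm M (\<lambda>x. f (r k) x - f n x)"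
        by (intro L2_norm_triangle_diff g f)
      moreover have "L2_norm M (\<lambda>x. g x - f (r k) x) < e / 2" by (rule k0) (simp add: k_def)
      ultimately have "L2_norm M (\<lambda>x. g x - f n x) < e"
        using k1 \<open>(1/2::real)^k \<le> (1/2)^k1\<close> by linarith
      then show "norm (L2_norm M (\<lambda>x. g x - f n x) - 0) < e"
        using L2_norm_nonneg[of M "\<lambda>x. g x - f n x"] by simp
    qed
  qed
  with g(1) show thesis by (rule that)
qed

section \<open>Determinants of matrices indexed by finite sets\<close>

text \<open>The Leibniz formula over an arbitrary finite index set, since minors for varying subsets
  of one basis have to be compared. \<open>principal_minor\<close> is the case of the entries
  \<open>L2_inner M i (T j)\<close>.\<close>

definition pdet :: "'a set \<Rightarrow> ('a \<Rightarrow> 'a \<Rightarrow> real) \<Rightarrow> real" where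
  "pdet F M = (\<Sum>p | p permutes F. of_int (sign p) * (\<Prod>i\<in>F. M i (p i)))"

lemma pdet_empty [simp]: "pdet {} M = 1"
  by (simp add: pdet_def)

lemma pdet_cong: "(\<And>i j. i \<in> F \<Longrightarrow> j \<in> F \<Longrightarrow> M i j = N i j) \<Longrightarrow> pdet F M = pdet F N"
  unfolding pdet_def
  by (intro sum.cong refl arg_cong2[where f="(*)"] prod.cong) (auto simp: permutes_in_image)

text \<open>Composition with the transposition of \<open>a\<close> and \<open>b\<close> changes the
  sign of a permutation but not the product of entries, so the determinant equals its own
  negative.\<close>

lemma pdet_identical_rows:
  assumes "finite F" "a \<in> F" "b \<in> F" "a \<noteq> b" and eq: "\<And>j. j \<in> F \<Longrightarrow> M a j = M b j"
  shows "pdet F M = 0"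
proof -
  let ?t = "Transposition.transpose a b"
  have t: "?t permutes F" using assms by (simp add: permutes_swap_id)
  have "pdet F M = (\<Sum>p | p permutes F. of_int (sign (p \<circ> ?t)) * (\<Prod>i\<in>F. M i ((p \<circ> ?t) i)))"
    unfolding pdet_def
    by (rule sum.reindex_bij_witness[of _ "\<lambda>p. p \<circ> ?t" "\<lambda>p. p \<circ> ?t"])
       (auto simp: o_assoc[symmetric] intro: permutes_compose t)
  also have "\<dots> = (\<Sum>p | p permutes F. - (of_int (sign p) * (\<Prod>i\<in>F. M i (p i))))"
  proof (rule sum.cong[OF refl])
    fix p assume "p \<in> {p. p permutes F}"
    then have p: "p permutes F" by simp
    have "sign (p \<circ> ?t) = - sign p"
    proof -
      have "permutation p" using permutation_permutes assms(1) p by blast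
      then show ?thesis using assms(4) by (simp add: sign_compose permutation_swap_id sign_swap_id)
    qed
    moreover have "(\<Prod>i\<in>F. M i ((p \<circ> ?t) i)) = (\<Prod>i\<in>F. M (?t i) (p i))"
      by (rule prod.reindex_bij_witness[of _ ?t ?t]) (use t in \<open>auto simp: permutes_in_image\<close>)
    moreover have "(\<Prod>i\<in>F. M (?t i) (p i)) = (\<Prod>i\<in>F. M i (p i))"
      by (rule prod.cong) (use eq p assms(2,3) in \<open>auto simp: Transposition.transpose_def permutes_in_image\<close>)
    ultimately show "of_int (sign (p \<circ> ?t)) * (\<Prod>i\<in>F. M i ((p \<circ> ?t) i)) = - (of_int (sign p) * (\<Prod>i\<in>F. M i (p i)))"
      by simp
  qed
  also have "\<dots> = - pdet F M" by (simp add: pdet_def sum_negf)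
  finally show ?thesis by simp
qed

lemma pdet_row_sum:
  assumes "finite F" "e \<in> F"
  shows "pdet F (M(e := (\<lambda>j. \<Sum>k\<in>K. w k * R k j))) = (\<Sum>k\<in>K. w k * pdet F (M(e := R k)))"
proof -
  have split: "(\<Prod>i\<in>F. (M(e := r)) i (p i)) = r (p e) * (\<Prod>i\<in>F-{e}. M i (p i))" for r p
    using assms by (subst prod.remove[of F e]) auto
  show ?thesis
    unfolding pdet_def split sum_distrib_left sum_distrib_right
    by (subst sum.swap) (simp add: mult_ac)
qed

lemma pdet_row_add:
  assumes "finite F" "e \<in> F"
  shows "pdet F (M(e := (\<lambda>j. R j + R' j))) = pdet F (M(e := R)) + pdet F (M(e := R'))"
proof -
  have split: "(\<Prod>i\<in>F. (M(e := r)) i (p i)) = r (p e) * (\<Prod>i\<in>F-{e}. M i (p i))" for r p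
    using assms by (subst prod.remove[of F e]) auto
  show ?thesis
    unfolding pdet_def split by (simp add: algebra_simps sum.distrib)
qed

text \<open>A permutation that moves \<open>e\<close> picks a zero from row \<open>e\<close>; the
  remaining ones are the permutations of \<open>F\<close>.\<close>

lemma pdet_row_unit:
  assumes "finite F" "e \<notin> F"
  shows "pdet (insert e F) (M(e := (\<lambda>j. if j = e then s else 0))) = s * pdet F M"
proof -
  let ?M = "M(e := (\<lambda>j. if j = e then s else 0))"
  have "pdet (insert e F) ?M = (\<Sum>p | p permutes F. of_int (sign p) * (\<Prod>i\<in>insert e F. ?M i (p i)))"
    unfolding pdet_def
  proof (rule sum.mono_neutral_right)
    show "finite {p. p permutes insert e F}" using assms by (simp add: finite_permutations)
    show "{p. p permutes F} \<subseteq> {p. p permutes insert e F}"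
      by (auto intro: permutes_subset)
    show "\<forall>p\<in>{p. p permutes insert e F} - {p. p permutes F}. of_int (sign p) * (\<Prod>i\<in>insert e F. ?M i (p i)) = 0"
    proof
      fix p assume p: "p \<in> {p. p permutes insert e F} - {p. p permutes F}"
      have "p e \<noteq> e"
      proof
        assume "p e = e"
        then have "p permutes F" using p by (auto intro!: permutes_superset[of p "insert e F"])
        with p show False by simp
      qed
      then have "?M e (p e) = 0" by simp
      then have "(\<Prod>i\<in>insert e F. ?M i (p i)) = 0" using assms by (subst prod.insert) auto
      then show "of_int (sign p) * (\<Prod>i\<in>insert e F. ?M i (p i)) = 0" by simp
    qed
  qed
  also have "\<dots> = (\<Sum>p | p permutes F. s * (of_int (sign p) * (\<Prod>i\<in>F. M i (p i))))"
  proof (rule sum.cong[OF refl])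
    fix p assume "p \<in> {p. p permutes F}"
    then have "p e = e" using assms by (auto simp: permutes_def)
    moreover have "(\<Prod>i\<in>F. ?M i (p i)) = (\<Prod>i\<in>F. M i (p i))" by (rule prod.cong) (use assms in auto)
    ultimately show "of_int (sign p) * (\<Prod>i\<in>insert e F. ?M i (p i)) = s * (of_int (sign p) * (\<Prod>i\<in>F. M i (p i)))"
      using assms by (subst prod.insert) auto
  qed
  finally show ?thesis by (simp add: pdet_def sum_distrib_left)
qed

text \<open>Apart from column \<open>e\<close>, where the Schur complement is left over, row
  \<open>e\<close> is the combination of the other rows with weights \<open>w\<close>. By linearity
  in this row, the repeated rows contribute nothing.\<close>

lemma pdet_Schur:
  assumes F: "finite F" "e \<notin> F"
    and w: "\<And>j. j \<in> F \<Longrightarrow> (\<Sum>i\<in>F. w i * M i j) = M e j"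
  shows "pdet (insert e F) M = (M e e - (\<Sum>i\<in>F. w i * M i e)) * pdet F M"
proof -
  let ?s = "M e e - (\<Sum>i\<in>F. w i * M i e)"
  have "pdet (insert e F) M
      = pdet (insert e F) (M(e := (\<lambda>j. (\<Sum>i\<in>F. w i * M i j) + (if j = e then ?s else 0))))"
    by (rule pdet_cong) (use w in auto)
  also have "\<dots> = (\<Sum>i\<in>F. w i * pdet (insert e F) (M(e := M i))) + ?s * pdet F M"
    using F by (subst pdet_row_add) (auto simp: pdet_row_sum pdet_row_unit)
  also have "(\<Sum>i\<in>F. w i * pdet (insert e F) (M(e := M i))) = 0"
  proof (rule sum.neutral, rule ballI)
    fix i assume "i \<in> F"
    then have "pdet (insert e F) (M(e := M i)) = 0"
      using F by (intro pdet_identical_rows[of _ e i]) auto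
    then show "w i * pdet (insert e F) (M(e := M i)) = 0" by simp
  qed
  finally show ?thesis by simp
qed

text \<open>Each product is expanded by the set \<open>F\<close> of rows in which the entry of
  \<open>T\<close> is taken; the unit entries in the other rows force the permutation to fix
  everything outside \<open>F\<close>. This links finite sections of I + T with sums of principal
  minors.\<close>

lemma pdet_one_plus:
  assumes "finite G"
  shows "pdet G (\<lambda>i j. (if i = j then 1 else 0) + T i j) = (\<Sum>F\<in>Pow G. pdet F T)"
proof -
  have "pdet G (\<lambda>i j. (if i = j then 1 else 0) + T i j)
      = (\<Sum>p | p permutes G. \<Sum>F\<in>Pow G. of_int (sign p) * ((\<Prod>i\<in>F. T i (p i)) * (\<Prod>i\<in>G-F. if i = p i then 1 else 0)))"
    unfolding pdet_def
    by (subst add.commute, subst prod_add[OF assms], simp add: sum_distrib_left)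
  also have "\<dots> = (\<Sum>F\<in>Pow G. \<Sum>p | p permutes G. of_int (sign p) * ((\<Prod>i\<in>F. T i (p i)) * (\<Prod>i\<in>G-F. if i = p i then 1 else 0)))"
    by (rule sum.swap)
  also have "\<dots> = (\<Sum>F\<in>Pow G. pdet F T)"
  proof (rule sum.cong[OF refl])
    fix F assume "F \<in> Pow G"
    then have FG: "F \<subseteq> G" and fin: "finite F" using assms finite_subset by auto
    show "(\<Sum>p | p permutes G. of_int (sign p) * ((\<Prod>i\<in>F. T i (p i)) * (\<Prod>i\<in>G-F. if i = p i then 1 else 0))) = pdet F T"
      unfolding pdet_def
    proof (rule sum.mono_neutral_cong_right)
      show "finite {p. p permutes G}" using assms by (simp add: finite_permutations)
      show "{p. p permutes F} \<subseteq> {p. p permutes G}" using FG by (auto intro: permutes_subset)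
      show "\<forall>p\<in>{p. p permutes G} - {p. p permutes F}. of_int (sign p) * ((\<Prod>i\<in>F. T i (p i)) * (\<Prod>i\<in>G-F. if i = p i then 1 else 0)) = (0::real)"
      proof
        fix p assume p: "p \<in> {p. p permutes G} - {p. p permutes F}"
        have "\<not> (\<forall>i\<in>G-F. p i = i)"
          using p permutes_superset[of p G F] by auto
        then obtain i where "i \<in> G - F" "p i \<noteq> i" by blast
        then have "\<exists>i\<in>G-F. (if i = p i then 1 else 0::real) = 0"
          by (intro bexI[of _ i]) auto
        then have "(\<Prod>i\<in>G-F. if i = p i then 1 else 0::real) = 0"
          using assms by (intro prod_zero) auto
        then show "of_int (sign p) * ((\<Prod>i\<in>F. T i (p i)) * (\<Prod>i\<in>G-F. if i = p i then 1 else 0)) = (0::real)"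
          by simp
      qed
      fix p assume "p \<in> {p. p permutes F}"
      then have "(\<Prod>i\<in>G-F. if i = p i then 1 else 0::real) = 1"
        by (intro prod.neutral) (auto simp: permutes_def)
      then show "of_int (sign p) * ((\<Prod>i\<in>F. T i (p i)) * (\<Prod>i\<in>G-F. if i = p i then 1 else 0)) = of_int (sign p) * (\<Prod>i\<in>F. T i (p i))"
        by simp
    qed
  qed
  finally show ?thesis .
qed

lemma pdet_uminus: "finite F \<Longrightarrow> pdet F (\<lambda>i j. - M i j) = (-1) ^ card F * pdet F M"
  unfolding pdet_def by (simp add: prod.distrib[symmetric] sum_distrib_left prod_uminus mult_ac)

subsection \<open>Positive matrices\<close>

definition qform :: "'a set \<Rightarrow> ('a \<Rightarrow> 'a \<Rightarrow> real) \<Rightarrow> ('a \<Rightarrow> real) \<Rightarrow> real" where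
  "qform F M x = (\<Sum>i\<in>F. \<Sum>j\<in>F. x i * x j * M i j)"

lemma qform_mono_set:
  assumes "finite G" "F \<subseteq> G" "\<And>i. i \<in> G - F \<Longrightarrow> x i = 0"
  shows "qform G M x = qform F M x"
proof -
  have "qform G M x = (\<Sum>i\<in>F. \<Sum>j\<in>G. x i * x j * M i j)"
    unfolding qform_def by (rule sum.mono_neutral_right) (use assms in auto)
  also have "\<dots> = qform F M x"
    unfolding qform_def by (intro sum.cong refl sum.mono_neutral_right) (use assms in auto)
  finally show ?thesis .
qed

lemma qform_insert:
  assumes "finite F" "e \<notin> F" and sym: "\<And>i j. i \<in> insert e F \<Longrightarrow> j \<in> insert e F \<Longrightarrow> M i j = M j i"
  shows "qform (insert e F) M x = x e * x e * M e e + 2 * x e * (\<Sum>i\<in>F. x i * M i e) + qform F M x"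
proof -
  have "(\<Sum>j\<in>F. x e * x j * M e j) = (\<Sum>i\<in>F. x i * x e * M i e)"
    by (rule sum.cong) (use sym in \<open>auto simp: mult_ac\<close>)
  then show ?thesis
    unfolding qform_def using assms(1,2)
    by (simp add: sum.distrib sum_distrib_left algebra_simps)
qed

lemma positive_definite_subset:
  assumes "finite F" "e \<notin> F"
    and pd: "\<And>x. c * (\<Sum>i\<in>insert e F. (x i)\<^sup>2) \<le> qform (insert e F) M x"
  shows "c * (\<Sum>i\<in>F. (x i)\<^sup>2) \<le> qform F M x"
proof -
  define y where "y i = (if i \<in> F then x i else 0)" for i
  have "(\<Sum>i\<in>F. (y i)\<^sup>2) = (\<Sum>i\<in>F. (x i)\<^sup>2)" by (rule sum.cong) (auto simp: y_def)
  then have "(\<Sum>i\<in>insert e F. (y i)\<^sup>2) = (\<Sum>i\<in>F. (x i)\<^sup>2)"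
    using assms by (simp add: y_def)
  moreover have "qform (insert e F) M y = qform F M y"
    using assms by (intro qform_mono_set) (auto simp: y_def)
  moreover have "qform F M y = qform F M x" unfolding qform_def y_def by simp
  ultimately show ?thesis using pd[of y] by simp
qed

text \<open>The Schur complement is the value of the form at the vector with entry 1 at
  \<open>e\<close> and entries \<open>- w\<close> on \<open>F\<close>, whose squared length is at
  least 1.\<close>

lemma Schur_complement_ge:
  assumes F: "finite F" "e \<notin> F"
    and sym: "\<And>i j. i \<in> insert e F \<Longrightarrow> j \<in> insert e F \<Longrightarrow> M i j = M j i"
    and pd: "c > 0" "\<And>x. c * (\<Sum>i\<in>insert e F. (x i)\<^sup>2) \<le> qform (insert e F) M x"
    and w: "\<And>j. j \<in> F \<Longrightarrow> (\<Sum>i\<in>F. w i * M i j) = M e j"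
  shows "qform F M w = (\<Sum>i\<in>F. w i * M i e)" "c \<le> M e e - (\<Sum>i\<in>F. w i * M i e)"
proof -
  have "qform F M w = (\<Sum>j\<in>F. \<Sum>i\<in>F. w i * w j * M i j)" unfolding qform_def by (rule sum.swap)
  also have "\<dots> = (\<Sum>j\<in>F. w j * (\<Sum>i\<in>F. w i * M i j))" by (simp add: sum_distrib_left mult_ac)
  also have "\<dots> = (\<Sum>j\<in>F. w j * M j e)" by (rule sum.cong) (use w sym in auto)
  finally show q: "qform F M w = (\<Sum>j\<in>F. w j * M j e)" .
  define x where "x = (\<lambda>i. - w i)(e := 1)"
  have "qform F M x = qform F M w"
    unfolding qform_def x_def by (intro sum.cong refl) (use F in auto)
  moreover have "(\<Sum>i\<in>F. x i * M i e) = - (\<Sum>i\<in>F. w i * M i e)"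
    unfolding sum_negf[symmetric] by (rule sum.cong) (use F in \<open>auto simp: x_def\<close>)
  moreover have "x e = 1" by (simp add: x_def)
  ultimately have "M e e - (\<Sum>i\<in>F. w i * M i e) = qform (insert e F) M x"
    using qform_insert[OF F, of M x] sym q by simp
  moreover have "c * (\<Sum>i\<in>insert e F. (x i)\<^sup>2) \<le> qform (insert e F) M x" by (rule pd(2))
  moreover have "(\<Sum>i\<in>insert e F. (x i)\<^sup>2) \<ge> 1" using F by (simp add: x_def sum_nonneg)
  then have "c * 1 \<le> c * (\<Sum>i\<in>insert e F. (x i)\<^sup>2)" using pd(1) by (intro mult_left_mono) auto
  ultimately show "c \<le> M e e - (\<Sum>i\<in>F. w i * M i e)" by linarith
qed

text \<open>Bordering: the systems on \<open>F\<close> for the given right side and for row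
  \<open>e\<close> are solved first, and a multiple of the second solution corrects the equation at
  \<open>e\<close>. The pivot is a Schur complement, hence at least \<open>c\<close>.\<close>

lemma positive_definite_solve:
  assumes "finite F" and sym: "\<And>i j. i \<in> F \<Longrightarrow> j \<in> F \<Longrightarrow> M i j = M j i"
    and pd: "c > 0" "\<And>x. c * (\<Sum>i\<in>F. (x i)\<^sup>2) \<le> qform F M x"
  shows "\<exists>w. \<forall>j\<in>F. (\<Sum>i\<in>F. w i * M i j) = v j"
  using assms(1) sym pd(2)
proof (induction F arbitrary: v rule: finite_induct)
  case empty then show ?case by simp
next
  case (insert e F)
  have symF: "M i j = M j i" if "i \<in> F" "j \<in> F" for i j using insert.prems(1) that by auto
  note IH = insert.IH[OF symF positive_definite_subset[OF insert.hyps insert.prems(2)]]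
  obtain u where u: "\<And>j. j \<in> F \<Longrightarrow> (\<Sum>i\<in>F. u i * M i j) = M e j" using IH[of "M e"] by auto
  obtain z where z: "\<And>j. j \<in> F \<Longrightarrow> (\<Sum>i\<in>F. z i * M i j) = v j" using IH[of v] by auto
  define s where "s = M e e - (\<Sum>i\<in>F. u i * M i e)"
  have "c \<le> s"
    unfolding s_def by (rule Schur_complement_ge(2)[OF insert.hyps insert.prems(1) pd(1) insert.prems(2) u])
  then have "s \<noteq> 0" using pd(1) by simp
  define t where "t = (v e - (\<Sum>i\<in>F. z i * M i e)) / s"
  define w where "w = (\<lambda>i. z i - t * u i)(e := t)"
  have wF: "(\<Sum>i\<in>F. w i * M i j) = (\<Sum>i\<in>F. z i * M i j) - t * (\<Sum>i\<in>F. u i * M i j)" for j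
  proof -
    have "(\<Sum>i\<in>F. w i * M i j) = (\<Sum>i\<in>F. z i * M i j - t * (u i * M i j))"
      by (rule sum.cong) (use insert.hyps in \<open>auto simp: w_def algebra_simps\<close>)
    then show ?thesis by (simp add: sum_subtractf sum_distrib_left)
  qed
  have "(\<Sum>i\<in>insert e F. w i * M i j) = v j" if "j \<in> insert e F" for j
  proof (cases "j = e")
    case True
    have "(\<Sum>i\<in>insert e F. w i * M i e) = t * M e e + ((\<Sum>i\<in>F. z i * M i e) - t * (\<Sum>i\<in>F. u i * M i e))"
      using insert.hyps wF[of e] by (simp add: w_def)
    also have "\<dots> = t * s + (\<Sum>i\<in>F. z i * M i e)" by (simp add: s_def algebra_simps)
    also have "\<dots> = v e" using \<open>s \<noteq> 0\<close> by (simp add: t_def)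
    finally show ?thesis using True by simp
  next
    case False
    then have "j \<in> F" using that by simp
    then show ?thesis using insert.hyps wF[of j] u[of j] z[of j] by (simp add: w_def)
  qed
  then show ?case by blast
qed

text \<open>One pivot of the elimination, with the estimates it has to serve:
  \<open>s <= M e e\<close> leads to Hadamard's inequality, and the last bound shows that pivots are
  close to 1 when the matrix is close to the identity, so that their product can be kept away from
  0.\<close>

lemma pdet_insert_positive_definite:
  assumes F: "finite F" "e \<notin> F"
    and sym: "\<And>i j. i \<in> insert e F \<Longrightarrow> j \<in> insert e F \<Longrightarrow> M i j = M j i"
    and pd: "c > 0" "\<And>x. c * (\<Sum>i\<in>insert e F. (x i)\<^sup>2) \<le> qform (insert e F) M x"
  obtains s where "pdet (insert e F) M = s * pdet F M" "c \<le> s" "s \<le> M e e"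
    "M e e - (\<Sum>i\<in>F. (M i e)\<^sup>2) / c \<le> s"
proof -
  note pdF = positive_definite_subset[OF F pd(2)]
  have "\<exists>w. \<forall>j\<in>F. (\<Sum>i\<in>F. w i * M i j) = M e j"
    by (rule positive_definite_solve[OF F(1) _ pd(1) pdF]) (use sym in auto)
  then obtain w where w: "\<And>j. j \<in> F \<Longrightarrow> (\<Sum>i\<in>F. w i * M i j) = M e j" by auto
  define s where "s = M e e - (\<Sum>i\<in>F. w i * M i e)"
  note Schur = Schur_complement_ge[OF F sym pd w]
  have w2: "c * (\<Sum>i\<in>F. (w i)\<^sup>2) \<le> (\<Sum>j\<in>F. w j * M j e)" using pdF[of w] Schur(1) by simp
  moreover have W: "0 \<le> c * (\<Sum>i\<in>F. (w i)\<^sup>2)" using pd(1) by (simp add: sum_nonneg)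
  ultimately have s_le: "s \<le> M e e" by (simp add: s_def)
  \<comment> \<open>The number \<open>?a\<close> is also the value of the form at \<open>w\<close>,
    so c |w|^2 <= a; together with a^2 <= |w|^2 V this gives a <= V / c.\<close>
  have "(\<Sum>i\<in>F. w i * M i e) \<le> (\<Sum>i\<in>F. (M i e)\<^sup>2) / c"
  proof -
    let ?a = "\<Sum>i\<in>F. w i * M i e" and ?W = "\<Sum>i\<in>F. (w i)\<^sup>2" and ?V = "\<Sum>i\<in>F. (M i e)\<^sup>2"
    have "?a\<^sup>2 \<le> ?W * ?V" by (rule Cauchy_Schwarz_ineq_sum)
    also have "?W \<le> ?a / c" using w2 pd(1) by (simp add: field_simps)
    then have "?W * ?V \<le> ?a / c * ?V" by (intro mult_right_mono) (auto intro: sum_nonneg)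
    finally have le: "?a * ?a \<le> ?a * (?V / c)" by (simp add: power2_eq_square)
    have "?a \<ge> 0" using w2 W by linarith
    moreover have "?V / c \<ge> 0" using pd(1) by (simp add: sum_nonneg)
    ultimately show ?thesis
      using mult_left_le_imp_le[OF le] by (cases "?a = 0") linarith+
  qed
  then have "M e e - (\<Sum>i\<in>F. (M i e)\<^sup>2) / c \<le> s" by (simp add: s_def)
  moreover have "pdet (insert e F) M = s * pdet F M"
    unfolding s_def using F w by (rule pdet_Schur)
  moreover have "c \<le> s" unfolding s_def by (rule Schur(2))
  ultimately show thesis using s_le that by blast
qed

text \<open>The determinant is the product of its pivots, each of them positive and at most the
  diagonal entry; the upper bound is Hadamard's inequality.\<close>

lemma pdet_positive_definite_bounds:
  assumes "finite F" and sym: "\<And>i j. i \<in> F \<Longrightarrow> j \<in> F \<Longrightarrow> M i j = M j i"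
    and pd: "c > 0" "\<And>x. c * (\<Sum>i\<in>F. (x i)\<^sup>2) \<le> qform F M x"
  shows "0 < pdet F M \<and> pdet F M \<le> (\<Prod>i\<in>F. M i i)"
  using assms(1) sym pd(2)
proof (induction F rule: finite_induct)
  case empty then show ?case by simp
next
  case (insert e F)
  have "0 < pdet F M \<and> pdet F M \<le> (\<Prod>i\<in>F. M i i)"
    by (rule insert.IH[OF _ positive_definite_subset[OF insert.hyps insert.prems(2)]])
       (use insert.prems(1) in auto)
  moreover obtain s where "pdet (insert e F) M = s * pdet F M" "c \<le> s" "s \<le> M e e"
    using pdet_insert_positive_definite[OF insert.hyps insert.prems(1) pd(1) insert.prems(2)] by metis
  ultimately show ?case using insert.hyps pd(1) by (auto intro!: mult_mono)
qed

text \<open>Adding \<open>c\<close> to the diagonal makes the matrix positive definite, and both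
  bounds pass to the limit as \<open>c\<close> decreases to 0.\<close>

lemma pdet_positive_semidefinite_bounds:
  assumes "finite F" and sym: "\<And>i j. i \<in> F \<Longrightarrow> j \<in> F \<Longrightarrow> M i j = M j i"
    and psd: "\<And>x. 0 \<le> qform F M x"
  shows "0 \<le> pdet F M" "pdet F M \<le> (\<Prod>i\<in>F. M i i)"
proof -
  define N where "N c i j = M i j + (if i = j then c else 0)" for c i j
  have q: "qform F (N c) x = qform F M x + c * (\<Sum>i\<in>F. (x i)\<^sup>2)" for c x
  proof -
    have "qform F (N c) x = qform F M x + (\<Sum>i\<in>F. \<Sum>j\<in>F. if i = j then x i * x j * c else 0)"
      unfolding qform_def N_def sum.distrib[symmetric]
      by (intro sum.cong refl) (auto simp: algebra_simps)
    then show ?thesis using assms(1)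
      by (simp add: sum_distrib_left power2_eq_square mult_ac)
  qed
  have *: "0 < pdet F (N c) \<and> pdet F (N c) \<le> (\<Prod>i\<in>F. N c i i)" if "c > 0" for c
    by (rule pdet_positive_definite_bounds[OF assms(1) _ that])
       (use sym psd in \<open>auto simp: N_def q\<close>)
  have N: "((\<lambda>c. N c i j) \<longlongrightarrow> M i j) (at_right 0)" for i j
    unfolding N_def by (cases "i = j") (auto intro!: tendsto_eq_intros)
  have lim: "((\<lambda>c. pdet F (N c)) \<longlongrightarrow> pdet F M) (at_right 0)"
    unfolding pdet_def by (intro tendsto_intros N)
  have ev: "\<forall>\<^sub>F c in at_right (0::real). 0 < c" by (simp add: eventually_at_right_less)
  show "0 \<le> pdet F M"
    by (rule tendsto_lowerbound[OF lim]) (use ev * in \<open>auto elim!: eventually_mono intro: less_imp_le\<close>)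
  show "pdet F M \<le> (\<Prod>i\<in>F. M i i)"
  proof (rule tendsto_le[OF _ _ lim])
    show "((\<lambda>c. \<Prod>i\<in>F. N c i i) \<longlongrightarrow> (\<Prod>i\<in>F. M i i)) (at_right 0)" by (intro tendsto_intros N)
    show "\<forall>\<^sub>F c in at_right 0. pdet F (N c) \<le> (\<Prod>i\<in>F. N c i i)" using ev * by (auto elim!: eventually_mono)
  qed simp
qed

text \<open>This is the diagonal entry of Q^2 <= Q for 0 <= Q <= I. It follows by evaluating the
  form at the unit vector of \<open>e\<close> minus column \<open>e\<close>.\<close>

lemma psd_row_norm_le:
  assumes F: "finite F" "e \<in> F" and sym: "\<And>i j. i \<in> F \<Longrightarrow> j \<in> F \<Longrightarrow> Q i j = Q j i"
    and psd: "\<And>x. 0 \<le> qform F Q x" and le: "\<And>x. qform F Q x \<le> (\<Sum>i\<in>F. (x i)\<^sup>2)"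
  shows "(\<Sum>i\<in>F. (Q i e)\<^sup>2) \<le> Q e e"
proof -
  define x where "x i = Q i e" for i
  define V where "V = (\<Sum>i\<in>F. (Q i e)\<^sup>2)"
  define d where "d i = (if i = e then 1 else 0 :: real)" for i
  have d: "(\<Sum>i\<in>F. d i * g i) = g e" for g :: "'a \<Rightarrow> real"
  proof -
    have "(\<Sum>i\<in>F. d i * g i) = (\<Sum>i\<in>F. if i = e then g i else 0)" by (rule sum.cong) (auto simp: d_def)
    then show ?thesis using F by simp
  qed
  have "0 \<le> Q e e + 2 * t * V + t\<^sup>2 * V" for t
  proof -
    have "qform F Q (\<lambda>i. d i + t * x i)
      = (\<Sum>i\<in>F. \<Sum>j\<in>F. d i * d j * Q i j + t * (d i * x j * Q i j) + t * (d j * x i * Q i j) + t\<^sup>2 * (x i * x j * Q i j))"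
      unfolding qform_def by (intro sum.cong refl) (simp add: algebra_simps power2_eq_square)
    also have "\<dots> = (\<Sum>i\<in>F. \<Sum>j\<in>F. d i * d j * Q i j) + t * (\<Sum>i\<in>F. \<Sum>j\<in>F. d i * x j * Q i j)
        + t * (\<Sum>i\<in>F. \<Sum>j\<in>F. d j * x i * Q i j) + t\<^sup>2 * qform F Q x"
      unfolding qform_def by (simp add: sum.distrib sum_distrib_left)
    also have "(\<Sum>i\<in>F. \<Sum>j\<in>F. d i * d j * Q i j) = (\<Sum>i\<in>F. d i * (\<Sum>j\<in>F. d j * Q i j))"
      by (simp add: sum_distrib_left mult.assoc)
    also have "\<dots> = Q e e" by (simp add: d)
    also have "(\<Sum>i\<in>F. \<Sum>j\<in>F. d i * x j * Q i j) = (\<Sum>i\<in>F. d i * (\<Sum>j\<in>F. x j * Q i j))"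
      by (simp add: sum_distrib_left mult.assoc)
    also have "\<dots> = (\<Sum>j\<in>F. x j * Q e j)" by (simp add: d)
    also have "(\<Sum>j\<in>F. x j * Q e j) = V"
      unfolding V_def by (rule sum.cong) (use sym F in \<open>auto simp: x_def power2_eq_square\<close>)
    also have "(\<Sum>i\<in>F. \<Sum>j\<in>F. d j * x i * Q i j) = (\<Sum>i\<in>F. \<Sum>j\<in>F. d j * (x i * Q i j))"
      by (simp add: mult.assoc)
    also have "\<dots> = (\<Sum>i\<in>F. x i * Q i e)" by (simp add: d)
    also have "(\<Sum>i\<in>F. x i * Q i e) = V"
      unfolding V_def by (rule sum.cong) (auto simp: x_def power2_eq_square)
    finally have "0 \<le> Q e e + 2 * t * V + t\<^sup>2 * qform F Q x"
      using psd[of "\<lambda>i. d i + t * x i"] by (simp add: mult_ac)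
    also have "t\<^sup>2 * qform F Q x \<le> t\<^sup>2 * V"
      using le[of x] by (intro mult_left_mono) (auto simp: x_def V_def)
    finally show ?thesis by simp
  qed
  from this[of "-1"] show ?thesis by (simp add: V_def)
qed

subsection \<open>Sums over all principal minors\<close>

text \<open>\<open>-Q\<close> will be the matrix of \<open>(I + A) e\<^bsup>-A\<^esup> - I\<close> in an orthonormal basis.\<close>

lemma infsum_pdet_pos:
  fixes Q :: "'a \<Rightarrow> 'a \<Rightarrow> real"
  assumes sym: "\<And>i j. i \<in> B \<Longrightarrow> j \<in> B \<Longrightarrow> Q i j = Q j i"
    and psd: "\<And>F x. finite F \<Longrightarrow> F \<subseteq> B \<Longrightarrow> 0 \<le> qform F Q x"
    and c: "0 < c" "c \<le> 1"
    and le: "\<And>F x. finite F \<Longrightarrow> F \<subseteq> B \<Longrightarrow> qform F Q x \<le> (1 - c) * (\<Sum>i\<in>F. (x i)\<^sup>2)"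
    and tr: "\<And>F. finite F \<Longrightarrow> F \<subseteq> B \<Longrightarrow> (\<Sum>i\<in>F. Q i i) \<le> C"
  shows "0 < (\<Sum>\<^sub>\<infinity>F\<in>{F. finite F \<and> F \<subseteq> B}. pdet F (\<lambda>i j. - Q i j))"
proof -
  define M where "M i j = (if i = j then 1 else 0) + (- Q i j)" for i j
  define f where "f F = pdet F (\<lambda>i j. - Q i j)" for F
  have qM: "qform F M x = (\<Sum>i\<in>F. (x i)\<^sup>2) - qform F Q x" if "finite F" for F x
  proof -
    have "qform F M x = (\<Sum>i\<in>F. \<Sum>j\<in>F. (if i = j then x i * x j else 0) - x i * x j * Q i j)"
      unfolding qform_def M_def by (intro sum.cong refl) (auto simp: algebra_simps)
    then show ?thesis using that by (simp add: sum_subtractf qform_def power2_eq_square)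
  qed
  have pdM: "c * (\<Sum>i\<in>F. (x i)\<^sup>2) \<le> qform F M x" if "finite F" "F \<subseteq> B" for F x
    using le[OF that, of x] qM[OF that(1), of x] by (simp add: algebra_simps)
  have le1: "qform F Q x \<le> (\<Sum>i\<in>F. (x i)\<^sup>2)" if "finite F" "F \<subseteq> B" for F x
  proof -
    have "(1 - c) * (\<Sum>i\<in>F. (x i)\<^sup>2) \<le> 1 * (\<Sum>i\<in>F. (x i)\<^sup>2)"
      using c by (intro mult_right_mono) (auto intro: sum_nonneg)
    with le[OF that, of x] show ?thesis by simp
  qed
  have symM: "M i j = M j i" if "i \<in> B" "j \<in> B" for i j using sym that by (simp add: M_def)
  have Qee: "0 \<le> Q e e" if "e \<in> B" for e
    using psd[of "{e}" "\<lambda>_. 1"] that by (simp add: qform_def)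
  \<comment> \<open>\<open>k\<close> is chosen so that \<open>exp (- k * q)\<close> lies below every
    pivot with diagonal entry \<open>1 - q\<close>. For \<open>y = (1 + 1 / c) * q\<close> at most
    1/2 this uses 1 - y >= exp (- 2 y); for larger \<open>y\<close> one has
    \<open>k * q >= - ln c\<close>, and the pivot is at least \<open>c\<close>.\<close>
  define k where "k = 2 * (1 + 1 / c) * max 1 (- ln c)"
  have k0: "k \<ge> 0" using c by (simp add: k_def)
  have exp_le: "exp (- k * q) \<le> s" if "c \<le> s" "1 - (1 + 1 / c) * q \<le> s" "0 \<le> q" for q s
  proof (cases "(1 + 1 / c) * q \<le> 1 / 2")
    case True
    define y where "y = (1 + 1 / c) * q"
    have "0 \<le> 1 + 1 / c" using c by simp
    then have y: "0 \<le> y" unfolding y_def using that(3) by (rule mult_nonneg_nonneg)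
    have y2: "y \<le> 1 / 2" using True unfolding y_def .
    have "k * q \<ge> 2 * y * 1"
    proof -
      have "k * q = 2 * y * max 1 (- ln c)" by (simp add: k_def y_def)
      moreover have "2 * y * 1 \<le> 2 * y * max 1 (- ln c)" using y by (intro mult_left_mono) auto
      ultimately show ?thesis by linarith
    qed
    then have "exp (- k * q) \<le> exp (- (2 * y))" by simp
    also have "\<dots> \<le> 1 - y"
    proof -
      have "1 + 2 * y \<le> exp (2 * y)" by (rule exp_ge_add_one_self)
      moreover have "1 \<le> (1 - y) * (1 + 2 * y)"
      proof -
        have "0 \<le> y * (1 - 2 * y)" using y y2 by simp
        then show ?thesis by (simp add: algebra_simps)
      qed
      ultimately have "1 \<le> (1 - y) * exp (2 * y)"
        using y y2 mult_left_mono[of "1 + 2 * y" "exp (2 * y)" "1 - y"] by linarith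
      then have "exp (- (2 * y)) * 1 \<le> exp (- (2 * y)) * ((1 - y) * exp (2 * y))"
        by (intro mult_left_mono) auto
      also have "\<dots> = (1 - y) * (exp (- (2 * y)) * exp (2 * y))" by (simp only: mult_ac)
      also have "exp (- (2 * y)) * exp (2 * y) = 1" by (simp add: exp_add[symmetric])
      finally show ?thesis by simp
    qed
    finally show ?thesis using that(2) unfolding y_def by (rule order_trans)
  next
    case False
    define y where "y = (1 + 1 / c) * q"
    have "k * q = 2 * y * max 1 (- ln c)" by (simp add: k_def y_def)
    moreover have "1 / 2 < y" using False unfolding y_def by (simp only: not_le)
    then have "1 * max 1 (- ln c) \<le> 2 * y * max 1 (- ln c)"
      by (intro mult_right_mono) auto
    ultimately have "- ln c \<le> k * q" by linarith
    then have "exp (- k * q) \<le> exp (ln c)" by simp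
    then show ?thesis using c that(1) by simp
  qed
  \<comment> \<open>Multiplying the pivot bounds \<open>exp (- k * Q e e)\<close> gives a lower
    bound for finite sections that depends on the trace alone.\<close>
  have lower: "exp (- k * (\<Sum>i\<in>G. Q i i)) \<le> pdet G M" if "finite G" "G \<subseteq> B" for G
    using that
  proof (induction G rule: finite_induct)
    case empty then show ?case by simp
  next
    case (insert e F)
    then have IH: "exp (- k * (\<Sum>i\<in>F. Q i i)) \<le> pdet F M" by auto
    have fin: "finite (insert e F)" using insert by simp
    have symi: "M i j = M j i" if "i \<in> insert e F" "j \<in> insert e F" for i j
      using symM that insert.prems by blast
    obtain s where s: "pdet (insert e F) M = s * pdet F M" "c \<le> s"
        "M e e - (\<Sum>i\<in>F. (M i e)\<^sup>2) / c \<le> s"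
      using pdet_insert_positive_definite[OF insert.hyps symi c(1) pdM[OF fin insert.prems]] by metis
    have "(\<Sum>i\<in>F. (M i e)\<^sup>2) = (\<Sum>i\<in>F. (Q i e)\<^sup>2)"
      by (rule sum.cong) (use insert.hyps in \<open>auto simp: M_def\<close>)
    also have "\<dots> \<le> (\<Sum>i\<in>insert e F. (Q i e)\<^sup>2)" using insert.hyps by simp
    also have "\<dots> \<le> Q e e"
      by (rule psd_row_norm_le[OF fin insertI1 _ psd[OF fin insert.prems] le1[OF fin insert.prems]])
         (use sym insert.prems in blast)
    finally have "(\<Sum>i\<in>F. (M i e)\<^sup>2) / c \<le> Q e e / c" using c by (simp add: divide_right_mono)
    then have "1 - (1 + 1 / c) * Q e e \<le> s" using s(3) by (simp add: M_def algebra_simps)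
    then have "exp (- k * Q e e) \<le> s" using exp_le s(2) Qee insert.prems by auto
    then have "exp (- k * Q e e) * exp (- k * (\<Sum>i\<in>F. Q i i)) \<le> s * pdet F M"
      using IH by (intro mult_mono) (use c s in auto)
    moreover have "- k * (\<Sum>i\<in>insert e F. Q i i) = - k * Q e e + - k * (\<Sum>i\<in>F. Q i i)"
      using insert.hyps by (simp add: distrib_left)
    ultimately show ?case unfolding s(1) by (simp only: exp_add)
  qed
  have sumPow: "(\<Sum>F\<in>Pow G. f F) = pdet G M" if "finite G" for G
    unfolding f_def M_def using pdet_one_plus[OF that, of "\<lambda>i j. - Q i j"] by simp
  have absf: "norm (f F) \<le> (\<Prod>i\<in>F. Q i i)" if "finite F" "F \<subseteq> B" for F
  proof -
    have "0 \<le> pdet F Q \<and> pdet F Q \<le> (\<Prod>i\<in>F. Q i i)"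
      using pdet_positive_semidefinite_bounds[OF that(1) _ psd[OF that]] sym that by blast
    then show ?thesis using that by (simp add: f_def pdet_uminus abs_mult power_abs)
  qed
  \<comment> \<open>Hadamard bounds each minor by a product of diagonal entries. The sum of these
    products over all subsets of \<open>G\<close> is the product of the numbers
    \<open>1 + Q i i\<close>, which is at most \<open>exp C\<close>.\<close>
  have "f summable_on {F. finite F \<and> F \<subseteq> B}"
  proof (rule abs_summable_summable, rule nonneg_bdd_above_summable_on)
    show "bdd_above (sum (\<lambda>F. norm (f F)) ` {X. X \<subseteq> {F. finite F \<and> F \<subseteq> B} \<and> finite X})"
    proof (rule bdd_aboveI2)
      fix X assume X: "X \<in> {X. X \<subseteq> {F. finite F \<and> F \<subseteq> B} \<and> finite X}"
      define G where "G = \<Union>X"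
      have G: "finite G" "G \<subseteq> B" "X \<subseteq> Pow G" using X by (auto simp: G_def)
      have "sum (\<lambda>F. norm (f F)) X \<le> (\<Sum>F\<in>X. \<Prod>i\<in>F. Q i i)"
        using X absf by (intro sum_mono) auto
      also have "\<dots> \<le> (\<Sum>F\<in>Pow G. \<Prod>i\<in>F. Q i i)"
        using G Qee by (intro sum_mono2) (auto intro!: prod_nonneg)
      also have "\<dots> = (\<Prod>i\<in>G. Q i i + 1)" using prod_add[OF G(1), of "\<lambda>i. Q i i" "\<lambda>i. 1"] by simp
      also have "\<dots> \<le> (\<Prod>i\<in>G. exp (Q i i))"
        using G Qee exp_ge_add_one_self by (intro prod_mono) (auto simp: add.commute)
      also have "\<dots> = exp (\<Sum>i\<in>G. Q i i)" using G by (simp add: exp_sum)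
      also have "\<dots> \<le> exp C" using tr[OF G(1,2)] by simp
      finally show "sum (\<lambda>F. norm (f F)) X \<le> exp C" .
    qed
  qed auto
  then have hs: "(f has_sum (\<Sum>\<^sub>\<infinity>F\<in>{F. finite F \<and> F \<subseteq> B}. f F)) {F. finite F \<and> F \<subseteq> B}"
    by (rule has_sum_infsum)
  have "exp (- k * C) \<le> (\<Sum>\<^sub>\<infinity>F\<in>{F. finite F \<and> F \<subseteq> B}. f F)"
  proof (rule field_le_epsilon)
    fix \<epsilon> :: real assume "\<epsilon> > 0"
    from hs have "\<forall>\<^sub>F Y in finite_subsets_at_top {F. finite F \<and> F \<subseteq> B}.
        dist (sum f Y) (\<Sum>\<^sub>\<infinity>F\<in>{F. finite F \<and> F \<subseteq> B}. f F) < \<epsilon>"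
      using \<open>\<epsilon> > 0\<close> unfolding has_sum_def by (rule tendstoD)
    then obtain X where X: "finite X" "X \<subseteq> {F. finite F \<and> F \<subseteq> B}"
      "\<forall>Y. finite Y \<and> X \<subseteq> Y \<and> Y \<subseteq> {F. finite F \<and> F \<subseteq> B} \<longrightarrow>
        dist (sum f Y) (\<Sum>\<^sub>\<infinity>F\<in>{F. finite F \<and> F \<subseteq> B}. f F) < \<epsilon>"
      unfolding eventually_finite_subsets_at_top by (elim exE conjE)
    \<comment> \<open>Enlarging \<open>X\<close> to all subsets of its union turns the partial sum
      into the determinant of a finite section, which \<open>lower\<close> controls.\<close>
    define G where "G = \<Union>X"
    have G: "finite G" "G \<subseteq> B" "X \<subseteq> Pow G" using X by (auto simp: G_def)
    have "dist (sum f (Pow G)) (\<Sum>\<^sub>\<infinity>F\<in>{F. finite F \<and> F \<subseteq> B}. f F) < \<epsilon>"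
      using G by (intro X(3)[rule_format] conjI) (auto intro: finite_subset)
    moreover have "exp (- k * C) \<le> exp (- k * (\<Sum>i\<in>G. Q i i))"
      using mult_left_mono[OF tr[OF G(1,2)] k0] by simp
    moreover have "exp (- k * (\<Sum>i\<in>G. Q i i)) \<le> sum f (Pow G)"
      using lower[OF G(1,2)] sumPow[OF G(1)] by simp
    ultimately show "exp (- k * C) \<le> (\<Sum>\<^sub>\<infinity>F\<in>{F. finite F \<and> F \<subseteq> B}. f F) + \<epsilon>"
      unfolding dist_real_def by linarith
  qed
  moreover have "0 < exp (- k * C)" by simp
  ultimately show ?thesis unfolding f_def by linarith
qed

section \<open>Exponentials of moment sequences\<close>

text \<open>For \<open>m n = \<langle>f, A\<^sup>n f\<rangle>\<close> the series below is \<open>\<langle>f, e\<^bsup>sA\<^esup> f\<rangle>\<close>; positivity of the Hankel form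
  is the positivity of \<open>\<langle>p(A) f, p(A) f\<rangle>\<close> for polynomials \<open>p\<close>.\<close>

definition expmom :: "(nat \<Rightarrow> real) \<Rightarrow> real \<Rightarrow> real" where
  "expmom m s = (\<Sum>n. m n / fact n * s ^ n)"

definition hankel_nonneg :: "(nat \<Rightarrow> real) \<Rightarrow> bool" where
  "hankel_nonneg m \<longleftrightarrow> (\<forall>N a. 0 \<le> (\<Sum>i<N. \<Sum>j<N. a i * a j * m (i + j)))"

lemma summable_expmom:
  fixes m :: "nat \<Rightarrow> real" and s :: real
  assumes "\<And>n. \<bar>m n\<bar> \<le> C * R ^ n"
  shows "summable (\<lambda>n. m n / fact n * s ^ n)"
proof (rule summable_comparison_test')
  show "summable (\<lambda>n. C * ((R * \<bar>s\<bar>) ^ n /\<^sub>R fact n))"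
    by (intro summable_mult summable_exp_generic)
  show "norm (m n / fact n * s ^ n) \<le> C * ((R * \<bar>s\<bar>) ^ n /\<^sub>R fact n)" for n
  proof -
    have "\<bar>m n\<bar> * (\<bar>s\<bar> ^ n / fact n) \<le> C * R ^ n * (\<bar>s\<bar> ^ n / fact n)"
      using assms by (intro mult_right_mono) auto
    then show ?thesis by (simp add: abs_mult power_abs power_mult_distrib field_simps)
  qed
qed

lemma abs_expmom_le:
  assumes "\<And>n. \<bar>m n\<bar> \<le> C * R ^ n"
  shows "\<bar>expmom m s\<bar> \<le> C * exp (R * \<bar>s\<bar>)"
proof -
  have le: "norm (m n / fact n * s ^ n) \<le> C * ((R * \<bar>s\<bar>) ^ n /\<^sub>R fact n)" for n
  proof -
    have "\<bar>m n\<bar> * (\<bar>s\<bar> ^ n / fact n) \<le> C * R ^ n * (\<bar>s\<bar> ^ n / fact n)"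
      using assms by (intro mult_right_mono) auto
    then show ?thesis by (simp add: abs_mult power_abs power_mult_distrib field_simps)
  qed
  have "norm (expmom m s) \<le> (\<Sum>n. C * ((R * \<bar>s\<bar>) ^ n /\<^sub>R fact n))"
    unfolding expmom_def
    by (rule norm_suminf_le[OF le]) (intro summable_mult summable_exp_generic)
  also have "\<dots> = C * exp (R * \<bar>s\<bar>)"
    unfolding exp_def by (rule suminf_mult) (rule summable_exp_generic)
  finally show ?thesis by simp
qed

text \<open>Division by factorials turns differentiation into the shift of \<open>m\<close>, the
  counterpart of (e^{sA})' = A e^{sA}.\<close>

lemma DERIV_expmom:
  assumes "\<And>n. \<bar>m n\<bar> \<le> C * R ^ n"
  shows "(expmom m has_real_derivative expmom (\<lambda>n. m (Suc n)) s) (at s)"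
proof -
  have "((\<lambda>x. \<Sum>n. m n / fact n * x ^ n) has_real_derivative (\<Sum>n. diffs (\<lambda>n. m n / fact n) n * s ^ n)) (at s)"
    by (rule termdiffs_strong_converges_everywhere) (rule summable_expmom[OF assms])
  moreover have "diffs (\<lambda>n. m n / fact n) = (\<lambda>n. m (Suc n) / fact n)"
  proof
    fix n
    have "real (Suc n) * (m (Suc n) / fact (Suc n)) = m (Suc n) / fact n"
      by (simp add: field_simps del: of_nat_Suc)
    then show "diffs (\<lambda>n. m n / fact n) n = m (Suc n) / fact n" by (simp add: diffs_def)
  qed
  ultimately show ?thesis unfolding expmom_def[abs_def] by simp
qed

lemma expmom_add:
  assumes "\<And>n. \<bar>m n\<bar> \<le> C * R ^ n" "\<And>n. \<bar>m' n\<bar> \<le> C' * R' ^ n"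
  shows "expmom (\<lambda>n. a * m n + b * m' n) s = a * expmom m s + b * expmom m' s"
proof -
  note S = summable_expmom[OF assms(1), of s] summable_expmom[OF assms(2), of s]
  have "expmom (\<lambda>n. a * m n + b * m' n) s = (\<Sum>n. a * (m n / fact n * s ^ n) + b * (m' n / fact n * s ^ n))"
    unfolding expmom_def by (rule suminf_cong) (simp add: add_divide_distrib distrib_right)
  also have "\<dots> = a * expmom m s + b * expmom m' s"
    unfolding expmom_def
    using sums_add[OF sums_mult[OF summable_sums[OF S(1)], of a] sums_mult[OF summable_sums[OF S(2)], of b]]
    by (rule sums_unique[symmetric])
  finally show ?thesis .
qed

lemma expmom_0: "expmom m 0 = m 0"
  unfolding expmom_def using powser_zero[of "\<lambda>n. m n / fact n"] by simp

text \<open>\<open>\<langle>f, e\<^bsup>sA\<^esup> f\<rangle> = \<langle>e\<^bsup>sA/2\<^esup> f, e\<^bsup>sA/2\<^esup> f\<rangle>\<close>, with square partial sums on the right.\<close>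

lemma expmom_nonneg:
  assumes bound: "\<And>n. \<bar>m n\<bar> \<le> C * R ^ n" and pos: "hankel_nonneg m"
  shows "0 \<le> expmom m s"
proof -
  define a where "a i = (s / 2) ^ i /\<^sub>R fact i" for i
  define b where "b i = (R * \<bar>s\<bar> / 2) ^ i /\<^sub>R fact i" for i
  \<comment> \<open>The square and the triangle of index pairs: over the triangle the terms add up
    to a partial sum of the series for \<open>expmom m s\<close>, over the square to the Hankel form
    at the vector \<open>a\<close>.\<close>
  define S1 where "S1 N = {..<N} \<times> {..<N}" for N :: nat
  define S2 where "S2 N = {(i, j). i + j < N}" for N :: nat
  have S: "finite (S1 N)" "S2 N \<subseteq> S1 N" for N by (auto simp: S1_def S2_def)
  have C0: "C \<ge> 0" using bound[of 0] by simp
  have diag: "(\<Sum>i\<le>k. (x / 2) ^ i /\<^sub>R fact i * ((x / 2) ^ (k - i) /\<^sub>R fact (k - i))) = x ^ k /\<^sub>R fact k" for x :: real and k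
    using exp_series_add_commuting[of "x / 2" "x / 2" k] by simp
  define q where "q N = (\<Sum>(i,j)\<in>S1 N. a i * a j * m (i + j))" for N
  define t where "t N = (\<Sum>(i,j)\<in>S2 N. a i * a j * m (i + j))" for N
  define q' where "q' N = (\<Sum>(i,j)\<in>S1 N. b i * b j)" for N
  define t' where "t' N = (\<Sum>(i,j)\<in>S2 N. b i * b j)" for N
  have t: "t N = (\<Sum>k<N. m k / fact k * s ^ k)" for N
  proof -
    have "t N = (\<Sum>k<N. \<Sum>i\<le>k. a i * a (k - i) * m (i + (k - i)))"
      unfolding t_def S2_def by (rule sum.triangle_reindex)
    also have "\<dots> = (\<Sum>k<N. (\<Sum>i\<le>k. a i * a (k - i)) * m k)"
      by (simp add: sum_distrib_right)
    also have "\<dots> = (\<Sum>k<N. m k / fact k * s ^ k)"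
      unfolding a_def diag by (simp add: field_simps)
    finally show ?thesis .
  qed
  have t': "t' N = (\<Sum>k<N. (R * \<bar>s\<bar>) ^ k /\<^sub>R fact k)" for N
  proof -
    have "t' N = (\<Sum>k<N. \<Sum>i\<le>k. b i * b (k - i))"
      unfolding t'_def S2_def by (rule sum.triangle_reindex)
    then show ?thesis unfolding b_def diag .
  qed
  have q': "q' N = (\<Sum>i<N. b i) * (\<Sum>i<N. b i)" for N
    unfolding q'_def S1_def by (simp add: sum_product sum.cartesian_product)
  have q: "0 \<le> q N" for N
    using pos unfolding hankel_nonneg_def q_def S1_def by (simp add: sum.cartesian_product[symmetric])
  have ab: "\<bar>a i * a j * m (i + j)\<bar> \<le> C * (b i * b j)" for i j
  proof -
    have "\<bar>a i * a j\<bar> * \<bar>m (i + j)\<bar> \<le> \<bar>a i * a j\<bar> * (C * R ^ (i + j))"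
      by (intro mult_left_mono bound) auto
    also have "\<dots> = C * (\<bar>a i * a j\<bar> * R ^ (i + j))" by (rule mult.left_commute)
    also have "\<bar>a i * a j\<bar> * R ^ (i + j) = b i * b j"
      by (simp add: a_def b_def abs_mult power_abs power_add power_mult_distrib power_divide)
    finally show ?thesis by (simp add: abs_mult)
  qed
  \<comment> \<open>The terms in the square but outside the triangle are dominated by those of the
    scalar Cauchy product of \<open>exp (R * |s| / 2)\<close> with itself, for which the difference
    tends to 0.\<close>
  have diff: "\<bar>q N - t N\<bar> \<le> C * (q' N - t' N)" for N
  proof -
    have "q N - t N = (\<Sum>(i,j)\<in>S1 N - S2 N. a i * a j * m (i + j))"
      unfolding q_def t_def using S by (simp add: sum_diff)
    then have "\<bar>q N - t N\<bar> \<le> (\<Sum>p\<in>S1 N - S2 N. \<bar>case p of (i,j) \<Rightarrow> a i * a j * m (i + j)\<bar>)"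
      by (simp only: sum_abs)
    also have "\<dots> \<le> (\<Sum>(i,j)\<in>S1 N - S2 N. C * (b i * b j))"
      by (intro sum_mono) (use ab in auto)
    also have "\<dots> = C * (\<Sum>(i,j)\<in>S1 N - S2 N. b i * b j)"
      by (simp add: sum_distrib_left split_def)
    also have "(\<Sum>(i,j)\<in>S1 N - S2 N. b i * b j) = q' N - t' N"
      unfolding q'_def t'_def using S by (simp add: sum_diff)
    finally show ?thesis .
  qed
  have eb: "(\<lambda>N. \<Sum>i<N. x ^ i /\<^sub>R fact i) \<longlonglongrightarrow> exp x" for x :: real
    using exp_converges[of x] by (simp add: sums_def)
  have "(\<lambda>N. q' N - t' N) \<longlonglongrightarrow> exp (R * \<bar>s\<bar> / 2) * exp (R * \<bar>s\<bar> / 2) - exp (R * \<bar>s\<bar>)"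
    unfolding q' t' b_def by (intro tendsto_intros eb)
  then have "(\<lambda>N. C * (q' N - t' N)) \<longlonglongrightarrow> 0"
    using tendsto_mult_left[of _ 0 sequentially C] by (simp add: exp_add[symmetric])
  then have "(\<lambda>N. q N - t N) \<longlonglongrightarrow> 0"
    by (rule Lim_null_comparison[rotated]) (use diff in auto)
  moreover have "t \<longlonglongrightarrow> expmom m s"
    using summable_LIMSEQ[OF summable_expmom[OF bound]] unfolding expmom_def t[abs_def] .
  ultimately have "(\<lambda>N. (q N - t N) + t N) \<longlonglongrightarrow> 0 + expmom m s" by (rule tendsto_add)
  then have "q \<longlonglongrightarrow> expmom m s" by simp
  then show ?thesis by (rule LIMSEQ_le_const) (use q in auto)
qed

text \<open>For \<open>m n = <f, A^n f>\<close> the number \<open>E\<close> is <f, (I + A) e^{-A}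
  f>, and \<open>D\<close> stands for |A f|^2. The bounds correspond to c e^{-R} <= (1 + x) e^{-x}
  <= 1 and 1 - (1 + x) e^{-x} <= x^2 e^R for c - 1 <= x <= R and |x| <= R, derived from Hankel
  positivity instead of a spectral decomposition.\<close>

lemma expmom_bounds:
  assumes bound: "\<And>n. \<bar>m n\<bar> \<le> C * R ^ n" and R: "R \<ge> 0"
    and pos: "hankel_nonneg m" and pos2: "hankel_nonneg (\<lambda>n. m (Suc (Suc n)))"
    and lower: "hankel_nonneg (\<lambda>n. m n + m (Suc n) - c * m n)" and c: "0 \<le> c"
    and upper: "hankel_nonneg (\<lambda>n. R * m n - m (Suc n))"
    and D: "\<And>n. \<bar>m (Suc (Suc n))\<bar> \<le> D * R ^ n"
  defines "E \<equiv> expmom m (-1) + expmom (\<lambda>n. m (Suc n)) (-1)"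
  shows "c * exp (- R) * m 0 \<le> E" "E \<le> m 0" "m 0 - E \<le> D * exp R"
proof -
  have bound1: "\<bar>m (Suc n)\<bar> \<le> (C * R) * R ^ n" for n using bound[of "Suc n"] by (simp add: mult_ac)
  have bound2: "\<bar>m (Suc (Suc n))\<bar> \<le> (C * R * R) * R ^ n" for n using bound[of "Suc (Suc n)"] by (simp add: mult_ac)
  note D0 = DERIV_expmom[OF bound] and D1 = DERIV_expmom[OF bound1]
  have u: "(uminus has_real_derivative -1) (at t)" for t :: real
    by (auto intro!: derivative_eq_intros)
  have chain: "((\<lambda>t. expmom m (- t)) has_real_derivative - expmom (\<lambda>n. m (Suc n)) (- t)) (at t)"
    "((\<lambda>t. expmom (\<lambda>n. m (Suc n)) (- t)) has_real_derivative - expmom (\<lambda>n. m (Suc (Suc n))) (- t)) (at t)" for t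
    using DERIV_chain2[OF D0 u, of t] DERIV_chain2[OF D1 u, of t] by simp_all
  \<comment> \<open>This is <f, (I + tA) e^{-tA} f>. It joins \<open>m 0\<close> to
    \<open>E\<close>, and its derivative - t <A f, e^{-tA} A f> has a sign and is controlled by the
    twice shifted moments.\<close>
  define \<phi> where "\<phi> t = expmom m (- t) + t * expmom (\<lambda>n. m (Suc n)) (- t)" for t
  have d\<phi>: "(\<phi> has_real_derivative - (t * expmom (\<lambda>n. m (Suc (Suc n))) (- t))) (at t)" for t
    unfolding \<phi>_def by (auto intro!: derivative_eq_intros chain)
  obtain t where t: "0 < t" "t < 1" "\<phi> 1 - \<phi> 0 = (1 - 0) * (- (t * expmom (\<lambda>n. m (Suc (Suc n))) (- t)))"
    using MVT2[of 0 1 \<phi> "\<lambda>t. - (t * expmom (\<lambda>n. m (Suc (Suc n))) (- t))"] d\<phi> by auto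
  have \<phi>: "\<phi> 1 = E" "\<phi> 0 = m 0" by (simp_all add: \<phi>_def E_def expmom_0)
  have diff: "m 0 - E = t * expmom (\<lambda>n. m (Suc (Suc n))) (- t)" using t(3) \<phi> by simp
  have nn: "0 \<le> expmom (\<lambda>n. m (Suc (Suc n))) (- t)" by (rule expmom_nonneg[OF bound2 pos2])
  then show "E \<le> m 0" using diff t(1) mult_nonneg_nonneg[of t "expmom (\<lambda>n. m (Suc (Suc n))) (- t)"] by linarith
  have "m 0 - E \<le> 1 * expmom (\<lambda>n. m (Suc (Suc n))) (- t)"
    unfolding diff using t nn by (intro mult_right_mono) auto
  also have "\<dots> \<le> D * exp (R * t)" using abs_expmom_le[OF D, of "- t"] t by simp
  also have "\<dots> \<le> D * exp R"
    using D[of 0] t R by (intro mult_left_mono) (auto simp: mult_left_le)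
  finally show "m 0 - E \<le> D * exp R" .
  \<comment> \<open>Since A <= R, the function e^{Rt} <f, e^{-tA} f> cannot decrease; this bounds
    <f, e^{-A} f> from below by e^{-R} |f|^2.\<close>
  define \<psi> where "\<psi> t = exp (R * t) * expmom m (- t)" for t
  have d\<psi>: "(\<psi> has_real_derivative exp (R * t) * (R * expmom m (- t) - expmom (\<lambda>n. m (Suc n)) (- t))) (at t)" for t
    unfolding \<psi>_def by (auto intro!: derivative_eq_intros chain simp: algebra_simps)
  have bound3: "\<bar>R * m n - m (Suc n)\<bar> \<le> (2 * R * C) * R ^ n" for n
  proof -
    have "\<bar>R * m n - m (Suc n)\<bar> \<le> R * \<bar>m n\<bar> + \<bar>m (Suc n)\<bar>" using R abs_triangle_ineq4[of "R * m n" "m (Suc n)"] by (simp add: abs_mult)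
    also have "\<dots> \<le> R * (C * R ^ n) + (C * R) * R ^ n" by (intro add_mono mult_left_mono bound bound1 R)
    finally show ?thesis by (simp add: algebra_simps)
  qed
  have nn3: "0 \<le> expmom (\<lambda>n. R * m n - m (Suc n)) (- t)" for t by (rule expmom_nonneg[OF bound3 upper])
  have "0 \<le> R * expmom m (- t) - expmom (\<lambda>n. m (Suc n)) (- t)" for t
    using nn3[of t] expmom_add[OF bound bound1, of R "-1" "- t"] by simp
  then have "0 \<le> exp (R * t) * (R * expmom m (- t) - expmom (\<lambda>n. m (Suc n)) (- t))" for t by simp
  then have "\<psi> 0 \<le> \<psi> 1"
    using d\<psi> by (intro DERIV_nonneg_imp_nondecreasing[of 0 1 \<psi>]) auto
  then have "m 0 \<le> exp R * expmom m (-1)" by (simp add: \<psi>_def expmom_0)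
  then have "exp (- R) * m 0 \<le> exp (- R) * (exp R * expmom m (-1))" by (intro mult_left_mono) auto
  also have "\<dots> = expmom m (-1)" by (simp add: exp_minus)
  finally have low: "c * (exp (- R) * m 0) \<le> c * expmom m (-1)" using c by (rule mult_left_mono)
  have bound4: "\<bar>m n + m (Suc n) - c * m n\<bar> \<le> (C + C * R + c * C) * R ^ n" for n
  proof -
    have "\<bar>m n + m (Suc n) - c * m n\<bar> \<le> \<bar>m n\<bar> + \<bar>m (Suc n)\<bar> + c * \<bar>m n\<bar>"
      using c abs_triangle_ineq4[of "m n + m (Suc n)" "c * m n"] abs_triangle_ineq[of "m n" "m (Suc n)"] by (simp add: abs_mult)
    also have "\<dots> \<le> C * R ^ n + (C * R) * R ^ n + c * (C * R ^ n)" by (intro add_mono mult_left_mono bound bound1 c)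
    finally show ?thesis by (simp add: algebra_simps)
  qed
  have bound5: "\<bar>m n + m (Suc n)\<bar> \<le> (C + C * R) * R ^ n" for n
    using bound[of n] bound1[of n] abs_triangle_ineq[of "m n" "m (Suc n)"] by (simp add: algebra_simps)
  \<comment> \<open>The hypothesis \<open>lower\<close> encodes I + A - c >= 0; with the factor
    e^{-A} it gives \<open>c * expmom m (-1) <= E\<close>.\<close>
  have "0 \<le> expmom (\<lambda>n. m n + m (Suc n) - c * m n) (-1)" by (rule expmom_nonneg[OF bound4 lower])
  then have "0 \<le> expmom (\<lambda>n. m n + m (Suc n)) (-1) - c * expmom m (-1)"
    using expmom_add[OF bound5 bound, of 1 "-c" "-1"] by simp
  moreover have "expmom (\<lambda>n. m n + m (Suc n)) (-1) = E"
    using expmom_add[OF bound bound1, of 1 1 "-1"] unfolding E_def mult_1 .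
  ultimately have "c * expmom m (-1) \<le> E" by linarith
  with low show "c * exp (- R) * m 0 \<le> E" unfolding mult.assoc by (rule order_trans)
qed

section \<open>Bounded operators on \<open>L\<^sup>2\<close>\<close>

lemma bounded_operator_L2: "bounded_operator M T \<Longrightarrow> f \<in> L2 M \<Longrightarrow> T f \<in> L2 M"
  by (simp add: bounded_operator_def)

lemma bounded_operator_add:
  "bounded_operator M T \<Longrightarrow> f \<in> L2 M \<Longrightarrow> g \<in> L2 M \<Longrightarrow> AE x in M. T (\<lambda>t. f t + g t) x = T f x + T g x"
  by (simp add: bounded_operator_def)

lemma bounded_operator_scale:
  "bounded_operator M T \<Longrightarrow> f \<in> L2 M \<Longrightarrow> AE x in M. T (\<lambda>t. c * f t) x = c * T f x"
  by (simp add: bounded_operator_def)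

lemma bounded_operator_bound:
  assumes "bounded_operator M T"
  obtains C where "C > 0" "\<And>f. f \<in> L2 M \<Longrightarrow> L2_norm M (T f) \<le> C * L2_norm M f"
proof -
  obtain C where C: "\<And>f. f \<in> L2 M \<Longrightarrow> L2_norm M (T f) \<le> C * L2_norm M f"
    using assms unfolding bounded_operator_def by blast
  have "L2_norm M (T f) \<le> max C 1 * L2_norm M f" if "f \<in> L2 M" for f
    using C[OF that] mult_right_mono[of C "max C 1" "L2_norm M f"] L2_norm_nonneg[of M f] by linarith
  then show thesis using that[of "max C 1"] by simp
qed

lemma bounded_operator_diff:
  assumes "bounded_operator M T" "f \<in> L2 M" "g \<in> L2 M"
  shows "AE x in M. T (\<lambda>t. f t - g t) x = T f x - T g x"
proof -
  have "AE x in M. T (\<lambda>t. (f t - g t) + g t) x = T (\<lambda>t. f t - g t) x + T g x"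
    by (rule bounded_operator_add) (simp_all add: assms L2_closed)
  then show ?thesis by (auto elim!: eventually_mono)
qed

lemma bounded_operator_uminus:
  assumes "bounded_operator M T" "f \<in> L2 M"
  shows "AE x in M. T (\<lambda>t. - f t) x = - T f x"
  using bounded_operator_scale[OF assms, of "-1"] by simp

text \<open>A difference that vanishes almost everywhere has norm 0, and boundedness passes this on
  to its image. This is what makes calculations with representatives legitimate.\<close>

lemma bounded_operator_cong:
  assumes T: "bounded_operator M T" and fg: "f \<in> L2 M" "g \<in> L2 M" and eq: "AE x in M. f x = g x"
  shows "AE x in M. T f x = T g x"
proof -
  obtain C where C: "\<And>f. f \<in> L2 M \<Longrightarrow> L2_norm M (T f) \<le> C * L2_norm M f"
    using bounded_operator_bound[OF T] by metis
  have d: "(\<lambda>x. f x - g x) \<in> L2 M" using fg by (rule L2_diff)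
  have "L2_norm M (\<lambda>x. f x - g x) = 0" using eq by (subst L2_norm_eq_0_iff[OF d]) auto
  then have "L2_norm M (T (\<lambda>x. f x - g x)) = 0"
    using C[OF d] L2_norm_nonneg[of M "T (\<lambda>x. f x - g x)"] by simp
  then have "AE x in M. T (\<lambda>x. f x - g x) x = 0"
    using L2_norm_eq_0_iff bounded_operator_L2[OF T d] by blast
  then show ?thesis using bounded_operator_diff[OF T fg] by eventually_elim simp
qed

lemma bounded_operatorI:
  assumes "\<And>f. f \<in> L2 M \<Longrightarrow> T f \<in> L2 M"
    and "\<And>f g. f \<in> L2 M \<Longrightarrow> g \<in> L2 M \<Longrightarrow> AE x in M. T (\<lambda>t. f t + g t) x = T f x + T g x"
    and "\<And>c f. f \<in> L2 M \<Longrightarrow> AE x in M. T (\<lambda>t. c * f t) x = c * T f x"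
    and "\<And>f. f \<in> L2 M \<Longrightarrow> L2_norm M (T f) \<le> C * L2_norm M f"
  shows "bounded_operator M T"
  unfolding bounded_operator_def using assms by blast

lemma bounded_operator_id: "bounded_operator M id"
  by (rule bounded_operatorI[where C = 1]) auto

lemma bounded_operator_comp:
  assumes T: "bounded_operator M T" and U: "bounded_operator M U"
  shows "bounded_operator M (T \<circ> U)"
proof -
  obtain C where C: "C > 0" "\<And>f. f \<in> L2 M \<Longrightarrow> L2_norm M (T f) \<le> C * L2_norm M f"
    using bounded_operator_bound[OF T] by metis
  obtain D where D: "D > 0" "\<And>f. f \<in> L2 M \<Longrightarrow> L2_norm M (U f) \<le> D * L2_norm M f"
    using bounded_operator_bound[OF U] by metis
  note L = bounded_operator_L2[OF T] bounded_operator_L2[OF U]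
  show ?thesis
  proof (rule bounded_operatorI[where C = "C * D"])
    fix f g assume fg: "f \<in> L2 M" "g \<in> L2 M"
    have "AE x in M. T (U (\<lambda>t. f t + g t)) x = T (\<lambda>x. U f x + U g x) x"
      by (intro bounded_operator_cong[OF T] bounded_operator_add[OF U]) (simp_all add: fg L L2_closed)
    then show "AE x in M. (T \<circ> U) (\<lambda>t. f t + g t) x = (T \<circ> U) f x + (T \<circ> U) g x"
      using bounded_operator_add[OF T L(2)[OF fg(1)] L(2)[OF fg(2)]] by eventually_elim simp
  next
    fix c f assume f: "f \<in> L2 M"
    have "AE x in M. T (U (\<lambda>t. c * f t)) x = T (\<lambda>x. c * U f x) x"
      by (intro bounded_operator_cong[OF T] bounded_operator_scale[OF U]) (simp_all add: f L L2_closed)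
    then show "AE x in M. (T \<circ> U) (\<lambda>t. c * f t) x = c * (T \<circ> U) f x"
      using bounded_operator_scale[OF T L(2)[OF f], of c] by eventually_elim simp
  next
    fix f assume f: "f \<in> L2 M"
    have "L2_norm M (T (U f)) \<le> C * L2_norm M (U f)" using C(2) L f by blast
    also have "\<dots> \<le> C * (D * L2_norm M f)" using C(1) D(2)[OF f] by (intro mult_left_mono) auto
    finally show "L2_norm M ((T \<circ> U) f) \<le> C * D * L2_norm M f" by simp
  qed (simp add: L)
qed

lemma bounded_operator_plus:
  assumes T: "bounded_operator M T" and U: "bounded_operator M U"
  shows "bounded_operator M (T + U)"
proof -
  obtain C where C: "\<And>f. f \<in> L2 M \<Longrightarrow> L2_norm M (T f) \<le> C * L2_norm M f"
    using bounded_operator_bound[OF T] by metis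
  obtain D where D: "\<And>f. f \<in> L2 M \<Longrightarrow> L2_norm M (U f) \<le> D * L2_norm M f"
    using bounded_operator_bound[OF U] by metis
  note L = bounded_operator_L2[OF T] bounded_operator_L2[OF U]
  have e: "(T + U) f = (\<lambda>x. T f x + U f x)" for f by (rule ext) simp
  show ?thesis
  proof (rule bounded_operatorI[where C = "C + D"], unfold e)
    fix f g assume fg: "f \<in> L2 M" "g \<in> L2 M"
    show "AE x in M. T (\<lambda>t. f t + g t) x + U (\<lambda>t. f t + g t) x = T f x + U f x + (T g x + U g x)"
      using bounded_operator_add[OF T fg] bounded_operator_add[OF U fg] by eventually_elim simp
  next
    fix c f assume f: "f \<in> L2 M"
    show "AE x in M. T (\<lambda>t. c * f t) x + U (\<lambda>t. c * f t) x = c * (T f x + U f x)"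
      using bounded_operator_scale[OF T f, of c] bounded_operator_scale[OF U f, of c]
      by eventually_elim (simp add: algebra_simps)
  next
    fix f assume f: "f \<in> L2 M"
    show "L2_norm M (\<lambda>x. T f x + U f x) \<le> (C + D) * L2_norm M f"
      using L2_norm_triangle[OF L(1)[OF f] L(2)[OF f]] C[OF f] D[OF f] by (simp add: distrib_right)
  qed (simp add: L L2_closed)
qed

lemma bounded_operator_uminus_op:
  assumes T: "bounded_operator M T"
  shows "bounded_operator M (- T)"
proof -
  obtain C where C: "\<And>f. f \<in> L2 M \<Longrightarrow> L2_norm M (T f) \<le> C * L2_norm M f"
    using bounded_operator_bound[OF T] by metis
  note L = bounded_operator_L2[OF T]
  have e: "(- T) f = (\<lambda>x. - T f x)" for f by (rule ext) simp
  show ?thesis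
  proof (rule bounded_operatorI[where C = "C"], unfold e)
    fix f g assume fg: "f \<in> L2 M" "g \<in> L2 M"
    show "AE x in M. - T (\<lambda>t. f t + g t) x = - T f x + - T g x"
      using bounded_operator_add[OF T fg] by eventually_elim simp
  next
    fix c f assume f: "f \<in> L2 M"
    show "AE x in M. - T (\<lambda>t. c * f t) x = c * - T f x"
      using bounded_operator_scale[OF T f, of c] by eventually_elim (simp add: algebra_simps)
  qed (simp_all add: L L2_closed C L2_norm_uminus)
qed

lemma bounded_operator_minus:
  assumes "bounded_operator M T" "bounded_operator M U"
  shows "bounded_operator M (T - U)"
  using bounded_operator_plus[OF assms(1) bounded_operator_uminus_op[OF assms(2)]]
  by simp

section \<open>Equality of operators and inverses\<close>

lemma op_eq_refl: "op_eq M T T"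
  by (simp add: op_eq_def)

lemma op_eq_sym: "op_eq M T U \<Longrightarrow> op_eq M U T"
  by (auto simp: op_eq_def eq_commute)

lemma op_eq_trans [trans]:
  assumes "op_eq M T U" "op_eq M U V"
  shows "op_eq M T V"
  unfolding op_eq_def
proof
  fix f assume "f \<in> L2 M"
  then have "AE x in M. T f x = U f x" "AE x in M. U f x = V f x" using assms by (auto simp: op_eq_def)
  then show "AE x in M. T f x = V f x" by eventually_elim simp
qed

lemma op_eq_comp:
  assumes T: "bounded_operator M T" and "op_eq M T T'" "op_eq M U U'"
    and U: "bounded_operator M U" "bounded_operator M U'"
  shows "op_eq M (T \<circ> U) (T' \<circ> U')"
  unfolding op_eq_def
proof
  fix f assume f: "f \<in> L2 M"
  then have "AE x in M. U f x = U' f x" using assms by (simp add: op_eq_def)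
  then have "AE x in M. T (U f) x = T (U' f) x"
    by (rule bounded_operator_cong[OF T bounded_operator_L2[OF U(1) f] bounded_operator_L2[OF U(2) f]])
  moreover have "AE x in M. T (U' f) x = T' (U' f) x"
    using assms(2) bounded_operator_L2[OF U(2) f] by (simp add: op_eq_def)
  ultimately show "AE x in M. (T \<circ> U) f x = (T' \<circ> U') f x" by eventually_elim simp
qed

lemma op_eq_plus:
  assumes "op_eq M T T'" "op_eq M U U'"
  shows "op_eq M (T + U) (T' + U')"
  unfolding op_eq_def
proof
  fix f assume "f \<in> L2 M"
  then have "AE x in M. T f x = T' f x" "AE x in M. U f x = U' f x" using assms by (auto simp: op_eq_def)
  then show "AE x in M. (T + U) f x = (T' + U') f x" by eventually_elim simp
qed

text \<open>As in a monoid: V = V (T W) = (V T) W = W.\<close>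

lemma is_op_inverse_unique:
  assumes T: "bounded_operator M T" and V: "is_op_inverse M T V" and W: "is_op_inverse M T W"
  shows "op_eq M V W"
proof -
  have b: "bounded_operator M V" "bounded_operator M W" using V W by (auto simp: is_op_inverse_def)
  have "op_eq M (V \<circ> id) (V \<circ> (T \<circ> W))"
    by (rule op_eq_comp[OF b(1) op_eq_refl op_eq_sym bounded_operator_id bounded_operator_comp[OF T b(2)]])
       (use W in \<open>simp add: is_op_inverse_def\<close>)
  moreover have "op_eq M ((V \<circ> T) \<circ> W) (id \<circ> W)"
    by (rule op_eq_comp[OF bounded_operator_comp[OF b(1) T] _ op_eq_refl b(2,2)])
       (use V in \<open>simp add: is_op_inverse_def\<close>)
  ultimately show ?thesis using op_eq_trans unfolding comp_assoc comp_id id_comp by blast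
qed

lemma op_inv_is_op_inverse: "is_op_inverse M T V \<Longrightarrow> is_op_inverse M T (op_inv M T)"
  unfolding op_inv_def by (rule someI[of "is_op_inverse M T"])

lemma op_inv_op_eq:
  assumes "bounded_operator M T" "is_op_inverse M T V"
  shows "op_eq M (op_inv M T) V"
  using is_op_inverse_unique[OF assms(1) op_inv_is_op_inverse[OF assms(2)] assms(2)] .

section \<open>Adjoints\<close>

lemma L2_inner_eq_imp_AE_eq:
  assumes "u \<in> L2 M" "v \<in> L2 M" and eq: "\<And>f. f \<in> L2 M \<Longrightarrow> L2_inner M f u = L2_inner M f v"
  shows "AE x in M. u x = v x"
proof -
  have d: "(\<lambda>x. u x - v x) \<in> L2 M" using assms by (intro L2_diff)
  have "L2_inner M (\<lambda>x. u x - v x) (\<lambda>x. u x - v x) = 0"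
    using eq[OF d] by (simp add: L2_inner_diff_right[OF d assms(1,2)])
  then have "AE x in M. u x - v x = 0" by (rule L2_inner_eq_0_AE[OF d])
  then show ?thesis by simp
qed

text \<open>A relation, because \<open>op_adj\<close> is a choice that is known to be an adjoint
  only once a bounded one has been exhibited. For integral operators the transposed kernel supplies
  it.\<close>

definition adjoint_op :: "'a measure \<Rightarrow> 'a operator \<Rightarrow> 'a operator \<Rightarrow> bool" where
  "adjoint_op M T U \<longleftrightarrow> (\<forall>f\<in>L2 M. \<forall>g\<in>L2 M. L2_inner M (T f) g = L2_inner M f (U g))"

lemma adjoint_op_unique:
  assumes "adjoint_op M T U" "adjoint_op M T U'" "bounded_operator M U" "bounded_operator M U'"
  shows "op_eq M U U'"
  unfolding op_eq_def
proof
  fix g assume g: "g \<in> L2 M"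
  show "AE x in M. U g x = U' g x"
    using assms g by (intro L2_inner_eq_imp_AE_eq) (auto simp: adjoint_op_def bounded_operator_L2)
qed

lemma op_adj_adjoint:
  assumes "bounded_operator M U" "adjoint_op M T U"
  shows "bounded_operator M (op_adj M T)" "adjoint_op M T (op_adj M T)" "op_eq M (op_adj M T) U"
proof -
  have *: "bounded_operator M (op_adj M T) \<and>
      (\<forall>f\<in>L2 M. \<forall>g\<in>L2 M. L2_inner M (T f) g = L2_inner M f (op_adj M T g))"
    unfolding op_adj_def by (rule someI[of _ U]) (use assms in \<open>auto simp: adjoint_op_def\<close>)
  then show b: "bounded_operator M (op_adj M T)" and a: "adjoint_op M T (op_adj M T)"
    by (auto simp: adjoint_op_def)
  show "op_eq M (op_adj M T) U" by (rule adjoint_op_unique[OF a assms(2) b assms(1)])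
qed

lemma adjoint_op_id: "adjoint_op M id id"
  by (simp add: adjoint_op_def)

lemma adjoint_op_plus:
  assumes "bounded_operator M T" "bounded_operator M T'" "bounded_operator M U" "bounded_operator M U'"
    "adjoint_op M T T'" "adjoint_op M U U'"
  shows "adjoint_op M (T + U) (T' + U')"
  using assms
  by (auto simp: adjoint_op_def bounded_operator_L2 plus_fun_def L2_inner_add_left L2_inner_add_right)

lemma adjoint_op_cong:
  assumes "adjoint_op M T U" "op_eq M T T'" "op_eq M U U'"
    "bounded_operator M T" "bounded_operator M T'" "bounded_operator M U" "bounded_operator M U'"
  shows "adjoint_op M T' U'"
  unfolding adjoint_op_def
proof (intro ballI)
  fix f g assume fg: "f \<in> L2 M" "g \<in> L2 M"
  have "L2_inner M (T' f) g = L2_inner M (T f) g"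
    by (rule L2_inner_cong_AE) (use assms fg in \<open>auto simp: bounded_operator_L2 op_eq_def eq_commute\<close>)
  also have "\<dots> = L2_inner M f (U g)" using assms(1) fg by (simp add: adjoint_op_def)
  also have "\<dots> = L2_inner M f (U' g)"
    by (rule L2_inner_cong_AE) (use assms fg in \<open>auto simp: bounded_operator_L2 op_eq_def\<close>)
  finally show "L2_inner M (T' f) g = L2_inner M f (U' g)" .
qed

subsection \<open>The Lax-Milgram theorem\<close>

text \<open>The solution is the limit of the iteration f -> f - t (T f - g), since coercivity and
  boundedness make I - t T a contraction for a suitable \<open>t\<close>.\<close>

lemma coercive_surjective:
  assumes T: "bounded_operator M T" and c: "c > 0"
    and coercive: "\<And>f. f \<in> L2 M \<Longrightarrow> c * L2_inner M f f \<le> L2_inner M f (T f)"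
    and g: "g \<in> L2 M"
  shows "\<exists>f\<in>L2 M. AE x in M. T f x = g x"
proof -
  obtain C0 where C0: "C0 > 0" "\<And>f. f \<in> L2 M \<Longrightarrow> L2_norm M (T f) \<le> C0 * L2_norm M f"
    using bounded_operator_bound[OF T] by metis
  \<comment> \<open>The maximum ensures \<open>c <= C\<close>, so that the square root in
    \<open>r\<close> is taken of a nonnegative number.\<close>
  define C where "C = max C0 c"
  have C: "C > 0" "c \<le> C" using C0(1) by (auto simp: C_def)
  have CT: "L2_norm M (T f) \<le> C * L2_norm M f" if "f \<in> L2 M" for f
    using C0(2)[OF that] mult_right_mono[of C0 C "L2_norm M f"] L2_norm_nonneg[of M f] by (simp add: C_def)
  note TL = bounded_operator_L2[OF T]
  \<comment> \<open>This \<open>t\<close> minimises 1 - 2 t c + t^2 C^2, the minimum being 1 - c^2 /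
    C^2.\<close>
  define t where "t = c / C\<^sup>2"
  define r where "r = sqrt (1 - c\<^sup>2 / C\<^sup>2)"
  have t: "t > 0" using c C by (simp add: t_def)
  have "c\<^sup>2 \<le> C\<^sup>2" using c C by (intro power_mono) auto
  then have q: "0 \<le> 1 - c\<^sup>2 / C\<^sup>2" "1 - c\<^sup>2 / C\<^sup>2 < 1" using c C by (simp_all add: field_simps)
  then have r: "0 \<le> r" "r < 1" "r\<^sup>2 = 1 - c\<^sup>2 / C\<^sup>2" by (auto simp: r_def)
  have contr: "L2_norm M (\<lambda>x. h x - t * T h x) \<le> r * L2_norm M h" if h: "h \<in> L2 M" for h
  proof (rule power2_le_imp_le)
    have "(L2_norm M (\<lambda>x. h x - t * T h x))\<^sup>2 = L2_inner M h h - 2 * t * L2_inner M h (T h) + t\<^sup>2 * L2_inner M (T h) (T h)"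
      using L2_inner_line[OF h TL[OF h], of "- t"] by (simp add: L2_norm_power2)
    also have "\<dots> \<le> L2_inner M h h - 2 * t * (c * L2_inner M h h) + t\<^sup>2 * (C\<^sup>2 * L2_inner M h h)"
    proof -
      have "t * (c * L2_inner M h h) \<le> t * L2_inner M h (T h)" using t coercive[OF h] by (intro mult_left_mono) auto
      moreover have "(L2_norm M (T h))\<^sup>2 \<le> (C * L2_norm M h)\<^sup>2" using CT[OF h] by (intro power_mono L2_norm_nonneg)
      then have "t\<^sup>2 * L2_inner M (T h) (T h) \<le> t\<^sup>2 * (C\<^sup>2 * L2_inner M h h)"
        by (intro mult_left_mono) (auto simp: L2_norm_power2 power_mult_distrib)
      ultimately show ?thesis by simp
    qed
    also have "\<dots> = (1 - 2 * t * c + t\<^sup>2 * C\<^sup>2) * L2_inner M h h" by (simp add: algebra_simps)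
    also have "1 - 2 * t * c + t\<^sup>2 * C\<^sup>2 = r\<^sup>2"
      unfolding r(3) t_def using C(1) by (simp add: power2_eq_square)
    finally show "(L2_norm M (\<lambda>x. h x - t * T h x))\<^sup>2 \<le> (r * L2_norm M h)\<^sup>2"
      by (simp add: power_mult_distrib L2_norm_power2)
    show "0 \<le> r * L2_norm M h" by (intro mult_nonneg_nonneg r L2_norm_nonneg)
  qed
  define F where "F n = ((\<lambda>f x. f x - t * (T f x - g x)) ^^ n) (\<lambda>x. 0)" for n
  have FS: "F (Suc n) = (\<lambda>x. F n x - t * (T (F n) x - g x))" for n by (simp add: F_def)
  have FL: "F n \<in> L2 M" for n
  proof (induction n)
    case 0 show ?case by (simp add: F_def L2_zero)
  next
    case (Suc n) then show ?case unfolding FS by (intro L2_diff L2_scale TL g)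
  qed
  define D where "D n = (\<lambda>x. F (Suc n) x - F n x)" for n
  have DL: "D n \<in> L2 M" for n unfolding D_def by (intro L2_diff FL)
  have step: "L2_norm M (D (Suc n)) \<le> r * L2_norm M (D n)" for n
  proof -
    have "AE x in M. D (Suc n) x = D n x - t * T (D n) x"
      using bounded_operator_diff[OF T FL FL, of "Suc n" n]
    proof eventually_elim
      case (elim x)
      have "F (Suc (Suc n)) x = F (Suc n) x - t * (T (F (Suc n)) x - g x)" by (simp only: FS[of "Suc n"])
      moreover have "F (Suc n) x = F n x - t * (T (F n) x - g x)" by (simp only: FS[of n])
      ultimately show ?case unfolding D_def elim right_diff_distrib by linarith
    qed
    then have "L2_norm M (D (Suc n)) = L2_norm M (\<lambda>x. D n x - t * T (D n) x)"
      by (intro L2_norm_cong_AE DL L2_diff L2_scale TL)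
    with contr[OF DL] show ?thesis by simp
  qed
  have "L2_norm M (D n) \<le> L2_norm M (D 0) * r ^ n" for n
  proof (induction n)
    case (Suc n)
    have "r * L2_norm M (D n) \<le> r * (L2_norm M (D 0) * r ^ n)" using Suc r by (intro mult_left_mono) auto
    with step[of n] show ?case by (simp add: mult_ac)
  qed simp
  then have bnd: "L2_norm M (\<lambda>x. F (Suc n) x - F n x) \<le> L2_norm M (D 0) * r ^ n" for n
    by (simp add: D_def)
  have sm: "summable (\<lambda>n. L2_norm M (D 0) * r ^ n)" using r by (intro summable_mult summable_geometric) auto
  obtain f where f: "f \<in> L2 M" "(\<lambda>n. L2_norm M (\<lambda>x. f x - F n x)) \<longlonglongrightarrow> 0"
    using L2_complete_telescope[where f = F and c = "\<lambda>n. L2_norm M (D 0) * r ^ n", OF FL bnd sm] .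
  have "(\<lambda>n. C * L2_norm M (\<lambda>x. f x - F n x) + L2_norm M (D n) / t) \<longlonglongrightarrow> C * 0 + 0 / t"
  proof (intro tendsto_intros f)
    show "(\<lambda>n. L2_norm M (D n)) \<longlonglongrightarrow> 0"
      by (rule Lim_null_comparison[OF _ summable_LIMSEQ_zero[OF sm]])
         (use bnd in \<open>auto simp: D_def L2_norm_nonneg\<close>)
  qed (use t in auto)
  moreover have "L2_norm M (\<lambda>x. T f x - g x) \<le> C * L2_norm M (\<lambda>x. f x - F n x) + L2_norm M (D n) / t" for n
  proof -
    have "L2_norm M (\<lambda>x. T f x - g x) \<le> L2_norm M (\<lambda>x. T f x - T (F n) x) + L2_norm M (\<lambda>x. T (F n) x - g x)"
      by (intro L2_norm_triangle_diff TL f FL g)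
    moreover have "L2_norm M (\<lambda>x. T f x - T (F n) x) = L2_norm M (T (\<lambda>x. f x - F n x))"
      by (intro L2_norm_cong_AE L2_diff TL f FL AE_symmetric[OF bounded_operator_diff] T)
    moreover have "\<dots> \<le> C * L2_norm M (\<lambda>x. f x - F n x)" by (intro CT L2_diff f FL)
    \<comment> \<open>By construction of the iteration the residual is the next increment divided by
      \<open>- t\<close>.\<close>
    moreover have e: "(\<lambda>x. T (F n) x - g x) = (\<lambda>x. (- 1 / t) * D n x)"
      using t by (auto simp: D_def FS)
    have "L2_norm M (\<lambda>x. T (F n) x - g x) = L2_norm M (D n) / t"
      unfolding e L2_norm_scale using t by simp
    ultimately show ?thesis by linarith
  qed
  ultimately have "L2_norm M (\<lambda>x. T f x - g x) \<le> 0"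
    by (intro LIMSEQ_le_const[of _ 0]) auto
  then have "L2_norm M (\<lambda>x. T f x - g x) = 0" using L2_norm_nonneg[of M "\<lambda>x. T f x - g x"] by simp
  then have "AE x in M. T f x - g x = 0"
    using L2_norm_eq_0_iff[OF L2_diff[OF TL[OF f(1)] g]] by simp
  then show ?thesis using f(1) by auto
qed

text \<open>Coercivity also gives injectivity and the bound \<open>1 / c\<close> for the inverse.
  The inverse is assembled from chosen solutions, so its linearity holds only almost everywhere and
  is derived from injectivity.\<close>

lemma coercive_op_invertible:
  assumes T: "bounded_operator M T" and c: "c > 0"
    and coercive: "\<And>f. f \<in> L2 M \<Longrightarrow> c * L2_inner M f f \<le> L2_inner M f (T f)"
  shows "op_invertible M T"
proof -
  note TL = bounded_operator_L2[OF T]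
  have inj: "AE x in M. f x = h x" if fh: "f \<in> L2 M" "h \<in> L2 M" and eq: "AE x in M. T f x = T h x" for f h
  proof -
    let ?d = "\<lambda>x. f x - h x"
    have d: "?d \<in> L2 M" using fh by (rule L2_diff)
    have "AE x in M. T ?d x = 0" using bounded_operator_diff[OF T fh] eq by eventually_elim simp
    then have "L2_inner M ?d (T ?d) = L2_inner M ?d (\<lambda>x. 0)"
      by (intro L2_inner_cong_AE d TL L2_zero) auto
    then have "c * L2_inner M ?d ?d \<le> 0" using coercive[OF d] by (simp add: L2_inner_zero_right)
    then have "L2_inner M ?d ?d = 0" using c L2_inner_self_nonneg[of M ?d] by (simp add: mult_le_0_iff)
    then have "AE x in M. ?d x = 0" by (rule L2_inner_eq_0_AE[OF d])
    then show ?thesis by simp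
  qed
  define V where "V g = (SOME f. f \<in> L2 M \<and> (AE x in M. T f x = g x))" for g
  have V: "V g \<in> L2 M" "AE x in M. T (V g) x = g x" if "g \<in> L2 M" for g
    using someI_ex[of "\<lambda>f. f \<in> L2 M \<and> (AE x in M. T f x = g x)"] coercive_surjective[OF T c coercive that]
    unfolding V_def by blast+
  have bV: "bounded_operator M V"
  proof (rule bounded_operatorI[where C = "1 / c"])
    fix f g assume fg: "f \<in> L2 M" "g \<in> L2 M"
    note L = V(1)[OF fg(1)] V(1)[OF fg(2)]
    have "AE x in M. T (V (\<lambda>t. f t + g t)) x = T (\<lambda>x. V f x + V g x) x"
      using V(2)[OF L2_add[OF fg]] V(2)[OF fg(1)] V(2)[OF fg(2)] bounded_operator_add[OF T L]
      by eventually_elim simp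
    then show "AE x in M. V (\<lambda>t. f t + g t) x = V f x + V g x"
      by (intro inj[of "V (\<lambda>t. f t + g t)" "\<lambda>x. V f x + V g x"] V L2_add fg)
  next
    fix k f assume f: "f \<in> L2 M"
    have "AE x in M. T (V (\<lambda>t. k * f t)) x = T (\<lambda>x. k * V f x) x"
      using V(2)[OF L2_scale[OF f], of k] V(2)[OF f] bounded_operator_scale[OF T V(1)[OF f], of k]
      by eventually_elim simp
    then show "AE x in M. V (\<lambda>t. k * f t) x = k * V f x"
      by (intro inj[of "V (\<lambda>t. k * f t)" "\<lambda>x. k * V f x"] V L2_scale f)
  next
    fix f assume f: "f \<in> L2 M"
    have "c * (L2_norm M (V f) * L2_norm M (V f)) \<le> L2_inner M (V f) (T (V f))"
      using coercive[OF V(1)[OF f]] by (simp add: L2_norm_power2[symmetric] power2_eq_square)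
    also have "\<dots> = L2_inner M (V f) f" by (intro L2_inner_cong_AE V TL f) auto
    also have "\<dots> \<le> L2_norm M (V f) * L2_norm M f" using L2_Cauchy_Schwarz[OF V(1)[OF f] f] by simp
    finally have *: "L2_norm M (V f) * (c * L2_norm M (V f)) \<le> L2_norm M (V f) * L2_norm M f"
      by (simp add: mult_ac)
    have "c * L2_norm M (V f) \<le> L2_norm M f"
    proof (cases "L2_norm M (V f) = 0")
      case True then show ?thesis by (simp add: L2_norm_nonneg)
    next
      case False
      then show ?thesis using mult_left_le_imp_le[OF *] L2_norm_nonneg[of M "V f"] by simp
    qed
    then show "L2_norm M (V f) \<le> 1 / c * L2_norm M f" using c by (simp add: field_simps)
  qed (rule V)
  have "op_eq M (T \<circ> V) id" using V(2) by (simp add: op_eq_def)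
  moreover have "op_eq M (V \<circ> T) id"
    unfolding op_eq_def using V TL inj by (auto intro!: inj[of "V (T _)"])
  ultimately show ?thesis using T bV by (auto simp: op_invertible_def is_op_inverse_def)
qed

subsection \<open>Orthonormal bases\<close>

text \<open>Zorn's lemma: a nonzero \<open>g\<close> orthogonal to a maximal orthonormal set could
  be normalised and added. Two representatives of one element never occur together in such a set, as
  their inner product would be 1.\<close>

lemma orthonormal_basis_exists: "\<exists>B. orthonormal_basis M B"
proof -
  define on where "on B \<longleftrightarrow> B \<subseteq> L2 M \<and> (\<forall>e\<in>B. \<forall>f\<in>B. L2_inner M e f = (if e = f then 1 else 0))" for B
  have "\<exists>B\<in>{B. on B}. \<forall>X\<in>{B. on B}. B \<subseteq> X \<longrightarrow> X = B"
  proof (rule subset_Zorn_nonempty)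
    show "{B. on B} \<noteq> {}" by (auto simp: on_def)
    fix \<C> assume "\<C> \<noteq> {}" and ch: "subset.chain {B. on B} \<C>"
    have "on (\<Union>\<C>)"
      unfolding on_def
    proof (intro conjI ballI)
      show "\<Union>\<C> \<subseteq> L2 M" using ch by (auto simp: subset.chain_def on_def)
      fix e f assume "e \<in> \<Union>\<C>" "f \<in> \<Union>\<C>"
      then obtain X Y where XY: "e \<in> X" "X \<in> \<C>" "f \<in> Y" "Y \<in> \<C>" by auto
      then have "X \<subseteq> Y \<or> Y \<subseteq> X" "on X" "on Y" using ch unfolding subset.chain_def by blast+
      then show "L2_inner M e f = (if e = f then 1 else 0)"
        using XY unfolding on_def by (meson subsetD)
    qed
    then show "\<Union>\<C> \<in> {B. on B}" by simp
  qed
  then obtain B where B: "on B" "\<And>X. on X \<Longrightarrow> B \<subseteq> X \<Longrightarrow> X = B" by auto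
  have "AE x in M. g x = 0" if g: "g \<in> L2 M" and orth: "\<forall>e\<in>B. L2_inner M e g = 0" for g
  proof (rule ccontr)
    assume "\<not> (AE x in M. g x = 0)"
    then have n: "L2_norm M g \<noteq> 0" using L2_norm_eq_0_iff[OF g] by simp
    define e where "e = (\<lambda>x. (1 / L2_norm M g) * g x)"
    have ee: "L2_inner M e e = 1"
      unfolding e_def L2_inner_scale_left L2_inner_scale_right L2_norm_power2[symmetric]
      using n by (simp add: power2_eq_square)
    have eB: "L2_inner M f e = 0" if "f \<in> B" for f using orth that unfolding e_def L2_inner_scale_right by simp
    have "e \<notin> B" using ee eB[of e] by auto
    moreover have "e \<in> L2 M" unfolding e_def using g by (rule L2_scale)
    have "on (insert e B)"
      unfolding on_def
    proof (intro conjI ballI)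
      show "insert e B \<subseteq> L2 M" using B(1) \<open>e \<in> L2 M\<close> unfolding on_def by blast
      have be: "L2_inner M e f = 0" if "f \<in> B" for f
        using eB[OF that] L2_inner_commute[of M e f] by simp
      fix u v assume uv: "u \<in> insert e B" "v \<in> insert e B"
      show "L2_inner M u v = (if u = v then 1 else 0)"
      proof (cases "u \<in> B \<and> v \<in> B")
        case True
        then show ?thesis using B(1) unfolding on_def by blast
      next
        case False
        then show ?thesis using uv eB be ee \<open>e \<notin> B\<close> by auto
      qed
    qed
    ultimately show False using B(2)[of "insert e B"] by auto
  qed
  with B(1) show ?thesis unfolding orthonormal_basis_def on_def by blast
qed

subsection \<open>The exponential of a bounded operator\<close>

text \<open>The terms are majorised by the scalar exponential series, so a limit exists and the
  choice in \<open>op_exp\<close> succeeds. Apart from its membership in \<open>L2\<close>, the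
  limit enters later only through inner products, which are scalar series.\<close>

lemma op_exp_properties:
  assumes T: "bounded_operator M T" and f: "f \<in> L2 M"
  shows "op_exp M T f \<in> L2 M"
    and "h \<in> L2 M \<Longrightarrow> (\<lambda>n. L2_inner M h ((T ^^ n) f) / fact n) sums L2_inner M h (op_exp M T f)"
proof -
  obtain C where C: "C > 0" "\<And>f. f \<in> L2 M \<Longrightarrow> L2_norm M (T f) \<le> C * L2_norm M f"
    using bounded_operator_bound[OF T] by metis
  have TL: "(T ^^ n) f \<in> L2 M" for n by (induction n) (auto intro: f bounded_operator_L2[OF T])
  have Tn: "L2_norm M ((T ^^ n) f) \<le> C ^ n * L2_norm M f" for n
  proof (induction n)
    case (Suc n)
    have "L2_norm M ((T ^^ Suc n) f) \<le> C * L2_norm M ((T ^^ n) f)" using C(2)[OF TL[of n]] by simp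
    also have "\<dots> \<le> C * (C ^ n * L2_norm M f)" using Suc C(1) by (intro mult_left_mono) auto
    finally show ?case by simp
  qed simp
  define P where "P N = (\<lambda>x. \<Sum>n<N. (T ^^ n) f x / fact n)" for N
  have TL': "(\<lambda>x. (T ^^ n) f x / fact n) \<in> L2 M" for n
    using L2_scale[OF TL[of n], of "1 / fact n"] by simp
  have PL: "P N \<in> L2 M" for N unfolding P_def by (intro L2_sum TL')
  have bnd: "L2_norm M (\<lambda>x. P (Suc n) x - P n x) \<le> L2_norm M f * (C ^ n /\<^sub>R fact n)" for n
  proof -
    have "(\<lambda>x. P (Suc n) x - P n x) = (\<lambda>x. (1 / fact n) * (T ^^ n) f x)" by (auto simp: P_def)
    then have "L2_norm M (\<lambda>x. P (Suc n) x - P n x) = L2_norm M ((T ^^ n) f) / fact n"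
      using L2_norm_scale[of M "1 / fact n" "(T ^^ n) f"] by simp
    also have "\<dots> \<le> (C ^ n * L2_norm M f) / fact n" by (intro divide_right_mono Tn) auto
    finally show ?thesis by (simp add: divide_inverse mult_ac)
  qed
  have "summable (\<lambda>n. L2_norm M f * (C ^ n /\<^sub>R fact n))" by (intro summable_mult summable_exp_generic)
  from L2_complete_telescope[where f = P and c = "\<lambda>n. L2_norm M f * (C ^ n /\<^sub>R fact n)", OF PL bnd this]
  obtain g where "g \<in> L2 M" "(\<lambda>n. L2_norm M (\<lambda>x. g x - P n x)) \<longlonglongrightarrow> 0" .
  then have "op_exp M T f \<in> L2 M \<and> (\<lambda>N. L2_norm M (\<lambda>x. op_exp M T f x - P N x)) \<longlonglongrightarrow> 0"
    unfolding op_exp_def P_def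
    using someI[of "\<lambda>g. g \<in> L2 M \<and> (\<lambda>N. L2_norm M (\<lambda>x. g x - (\<Sum>n<N. (T ^^ n) f x / fact n))) \<longlonglongrightarrow> 0" g]
    by simp
  then have E: "op_exp M T f \<in> L2 M" "(\<lambda>N. L2_norm M (\<lambda>x. op_exp M T f x - P N x)) \<longlonglongrightarrow> 0" by auto
  show "op_exp M T f \<in> L2 M" by (rule E)
  assume h: "h \<in> L2 M"
  have "(\<lambda>N. L2_inner M h (P N)) \<longlonglongrightarrow> L2_inner M h (op_exp M T f)"
    by (rule L2_inner_tendsto[OF PL E(1) h E(2)])
  moreover have "L2_inner M h (P N) = (\<Sum>n<N. L2_inner M h ((T ^^ n) f) / fact n)" for N
  proof -
    have "L2_inner M h (P N) = (\<Sum>n<N. L2_inner M h (\<lambda>x. (T ^^ n) f x / fact n))"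
      unfolding P_def by (intro L2_inner_sum_right h TL')
    also have "\<dots> = (\<Sum>n<N. L2_inner M h ((T ^^ n) f) / fact n)"
    proof (rule sum.cong[OF refl])
      fix n
      show "L2_inner M h (\<lambda>x. (T ^^ n) f x / fact n) = L2_inner M h ((T ^^ n) f) / fact n"
        using L2_inner_scale_right[of M h "1 / fact n" "(T ^^ n) f"] by simp
    qed
    finally show ?thesis .
  qed
  ultimately show "(\<lambda>n. L2_inner M h ((T ^^ n) f) / fact n) sums L2_inner M h (op_exp M T f)"
    by (simp add: sums_def)
qed

section \<open>The regularized determinant of a symmetric operator\<close>

lemma bounded_operator_sum:
  assumes T: "bounded_operator M T" and f: "\<And>i. i \<in> I \<Longrightarrow> f i \<in> L2 M"
  shows "AE x in M. T (\<lambda>t. \<Sum>i\<in>I. a i * f i t) x = (\<Sum>i\<in>I. a i * T (f i) x)"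
  using f
proof (induction I rule: infinite_finite_induct)
  case (infinite I)
  then show ?case using bounded_operator_scale[OF T L2_zero, of 0] by simp
next
  case empty
  then show ?case using bounded_operator_scale[OF T L2_zero, of 0] by simp
next
  case (insert i I)
  have L: "(\<lambda>t. a i * f i t) \<in> L2 M" "(\<lambda>t. \<Sum>i\<in>I. a i * f i t) \<in> L2 M" "f i \<in> L2 M"
    using insert.prems by (auto intro!: L2_scale L2_sum)
  have "AE x in M. T (\<lambda>t. \<Sum>i\<in>I. a i * f i t) x = (\<Sum>i\<in>I. a i * T (f i) x)"
    using insert by simp
  with bounded_operator_add[OF T L(1,2)] bounded_operator_scale[OF T L(3), of "a i"]
  show ?case by eventually_elim (simp add: insert.hyps)
qed

lemma bounded_operator_power: "bounded_operator M T \<Longrightarrow> bounded_operator M (T ^^ n)"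
  by (induction n) (simp_all add: bounded_operator_id[unfolded id_def] bounded_operator_id bounded_operator_comp)

lemma uminus_operator_power_AE:
  assumes A: "bounded_operator M A" and f: "f \<in> L2 M"
  shows "AE x in M. ((- A) ^^ n) f x = (-1) ^ n * (A ^^ n) f x"
proof (induction n)
  case (Suc n)
  have L: "((- A) ^^ n) f \<in> L2 M" "(A ^^ n) f \<in> L2 M"
    using bounded_operator_power[OF bounded_operator_uminus_op[OF A]] bounded_operator_power[OF A] f
    by (auto intro: bounded_operator_L2)
  have "AE x in M. A (((- A) ^^ n) f) x = A (\<lambda>x. (-1) ^ n * (A ^^ n) f x) x"
    by (rule bounded_operator_cong[OF A L(1) L2_scale[OF L(2)] Suc.IH])
  with bounded_operator_scale[OF A L(2), of "(-1) ^ n"] show ?case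
  proof eventually_elim
    case (elim x)
    have "((- A) ^^ Suc n) f x = - A (((- A) ^^ n) f) x"
      by (simp only: funpow.simps comp_apply uminus_apply)
    also have "\<dots> = - ((-1) ^ n * A ((A ^^ n) f) x)" by (simp only: elim)
    also have "\<dots> = (-1) ^ Suc n * (A ^^ Suc n) f x" by simp
    finally show ?case .
  qed
qed simp

text \<open>\<open>R\<close> bounds the norm of the symmetric operator \<open>A\<close> and
  \<open>c\<close> bounds I + A from below; together they confine the spectrum to the interval from
  \<open>c - 1\<close> to \<open>R\<close>.\<close>

locale symmetric_operator =
  fixes M :: "'a measure" and A :: "'a operator" and R c :: real
  assumes bounded: "bounded_operator M A"
    and sym: "adjoint_op M A A"
    and R: "0 \<le> R" "\<And>f. f \<in> L2 M \<Longrightarrow> L2_norm M (A f) \<le> R * L2_norm M f"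
    and c: "0 < c" "c \<le> 1"
    and coercive: "\<And>f. f \<in> L2 M \<Longrightarrow> c * L2_inner M f f \<le> L2_inner M f f + L2_inner M f (A f)"
begin

lemma power_L2: "f \<in> L2 M \<Longrightarrow> (A ^^ n) f \<in> L2 M"
  using bounded_operator_power[OF bounded] by (rule bounded_operator_L2)

lemma A_L2: "f \<in> L2 M \<Longrightarrow> A f \<in> L2 M"
  using bounded by (rule bounded_operator_L2)

lemma A_inner: "f \<in> L2 M \<Longrightarrow> g \<in> L2 M \<Longrightarrow> L2_inner M (A f) g = L2_inner M f (A g)"
  using sym by (simp add: adjoint_op_def)

lemma power_inner:
  assumes "f \<in> L2 M" "g \<in> L2 M"
  shows "L2_inner M ((A ^^ i) f) ((A ^^ j) g) = L2_inner M f ((A ^^ (i + j)) g)"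
proof (induction i arbitrary: j)
  case (Suc i)
  have "L2_inner M ((A ^^ Suc i) f) ((A ^^ j) g) = L2_inner M ((A ^^ i) f) ((A ^^ Suc j) g)"
    using A_inner[OF power_L2[OF assms(1)] power_L2[OF assms(2)]] by simp
  with Suc.IH[of "Suc j"] show ?case by simp
qed simp

lemma power_norm_le: "f \<in> L2 M \<Longrightarrow> L2_norm M ((A ^^ n) f) \<le> R ^ n * L2_norm M f"
proof (induction n)
  case (Suc n)
  have "L2_norm M ((A ^^ Suc n) f) \<le> R * L2_norm M ((A ^^ n) f)"
    using R(2)[OF power_L2[OF Suc.prems]] by simp
  also have "\<dots> \<le> R * (R ^ n * L2_norm M f)" using Suc R(1) by (intro mult_left_mono) auto
  finally show ?case by simp
qed simp

section \<open>Moments and the form of (I + A) e^{-A}\<close>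

definition moment :: "('a \<Rightarrow> real) \<Rightarrow> ('a \<Rightarrow> real) \<Rightarrow> nat \<Rightarrow> real" where
  "moment f g n = L2_inner M f ((A ^^ n) g)"

lemma moment_commute: "f \<in> L2 M \<Longrightarrow> g \<in> L2 M \<Longrightarrow> moment f g n = moment g f n"
  unfolding moment_def using power_inner[of f g n 0] by (simp add: L2_inner_commute[of M _ g])

lemma moment_bound:
  assumes "f \<in> L2 M"
  shows "\<bar>moment f f n\<bar> \<le> L2_inner M f f * R ^ n"
proof -
  have "\<bar>moment f f n\<bar> \<le> L2_norm M f * L2_norm M ((A ^^ n) f)"
    unfolding moment_def by (rule L2_Cauchy_Schwarz[OF assms power_L2[OF assms]])
  also have "\<dots> \<le> L2_norm M f * (R ^ n * L2_norm M f)"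
    by (intro mult_left_mono power_norm_le assms L2_norm_nonneg)
  also have "\<dots> = (L2_norm M f)\<^sup>2 * R ^ n" by (simp add: power2_eq_square)
  finally show ?thesis by (simp add: L2_norm_power2)
qed

text \<open>The Hankel form at \<open>a\<close> is the squared norm of p(A) g for the polynomial
  with coefficients \<open>a\<close>; shifting the moments by one inserts one factor
  \<open>A\<close>.\<close>

lemma moment_polynomial:
  fixes a :: "nat \<Rightarrow> real" and N :: nat
  assumes g: "g \<in> L2 M"
  defines "p \<equiv> \<lambda>x. \<Sum>i<N. a i * (A ^^ i) g x"
  shows "p \<in> L2 M"
    and "L2_inner M p p = (\<Sum>i<N. \<Sum>j<N. a i * a j * moment g g (i + j))"
    and "L2_inner M p (A p) = (\<Sum>i<N. \<Sum>j<N. a i * a j * moment g g (Suc (i + j)))"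
proof -
  have L: "(\<lambda>x. a i * (A ^^ i) g x) \<in> L2 M" "(\<lambda>x. a i * A ((A ^^ i) g) x) \<in> L2 M" for i
    by (intro L2_scale A_L2 power_L2 g)+
  show p: "p \<in> L2 M" unfolding p_def by (intro L2_sum L)
  have "L2_inner M p p = (\<Sum>i<N. L2_inner M (\<lambda>x. a i * (A ^^ i) g x) p)"
    unfolding p_def by (intro L2_inner_sum_left p[unfolded p_def] L)
  also have "\<dots> = (\<Sum>i<N. \<Sum>j<N. L2_inner M (\<lambda>x. a i * (A ^^ i) g x) (\<lambda>x. a j * (A ^^ j) g x))"
    unfolding p_def by (intro sum.cong refl L2_inner_sum_right L)
  also have "\<dots> = (\<Sum>i<N. \<Sum>j<N. a i * a j * moment g g (i + j))"
    unfolding L2_inner_scale_left L2_inner_scale_right power_inner[OF g g] moment_def by (simp add: mult.assoc)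
  finally show "L2_inner M p p = (\<Sum>i<N. \<Sum>j<N. a i * a j * moment g g (i + j))" .
  have Ap: "AE x in M. A p x = (\<Sum>i<N. a i * A ((A ^^ i) g) x)"
    unfolding p_def by (rule bounded_operator_sum[OF bounded power_L2[OF g]])
  have "L2_inner M p (A p) = L2_inner M p (\<lambda>x. \<Sum>j<N. a j * A ((A ^^ j) g) x)"
    by (rule L2_inner_cong_AE[OF p A_L2[OF p] p L2_sum[OF L(2)] AE_I2[OF refl] Ap])
  also have "\<dots> = (\<Sum>i<N. L2_inner M (\<lambda>x. a i * (A ^^ i) g x) (\<lambda>x. \<Sum>j<N. a j * A ((A ^^ j) g) x))"
    unfolding p_def by (intro L2_inner_sum_left L2_sum L)
  also have "\<dots> = (\<Sum>i<N. \<Sum>j<N. L2_inner M (\<lambda>x. a i * (A ^^ i) g x) (\<lambda>x. a j * A ((A ^^ j) g) x))"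
    by (intro sum.cong refl L2_inner_sum_right L)
  also have "\<dots> = (\<Sum>i<N. \<Sum>j<N. a i * a j * moment g g (Suc (i + j)))"
  proof (intro sum.cong refl)
    fix i j
    show "L2_inner M (\<lambda>x. a i * (A ^^ i) g x) (\<lambda>x. a j * A ((A ^^ j) g) x) = a i * a j * moment g g (Suc (i + j))"
      using power_inner[OF g g, of i "Suc j"]
      unfolding L2_inner_scale_left L2_inner_scale_right moment_def by simp
  qed
  finally show "L2_inner M p (A p) = (\<Sum>i<N. \<Sum>j<N. a i * a j * moment g g (Suc (i + j)))" .
qed

text \<open>Nonnegativity of squared norms, I + A >= c and A <= R, each applied to the vectors p(A)
  g, become the Hankel conditions of \<open>expmom_bounds\<close>.\<close>

lemma hankel_moment:
  assumes g: "g \<in> L2 M"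
  shows "hankel_nonneg (moment g g)"
    and "hankel_nonneg (\<lambda>n. moment g g n + moment g g (Suc n) - c * moment g g n)"
    and "hankel_nonneg (\<lambda>n. R * moment g g n - moment g g (Suc n))"
proof -
  show "hankel_nonneg (moment g g)"
    unfolding hankel_nonneg_def by (simp add: moment_polynomial(2)[OF g, symmetric] L2_inner_self_nonneg)
  show "hankel_nonneg (\<lambda>n. moment g g n + moment g g (Suc n) - c * moment g g n)"
    unfolding hankel_nonneg_def
  proof (intro allI)
    fix N a
    define p where "p = (\<lambda>x. \<Sum>i<N. a i * (A ^^ i) g x)"
    note P = moment_polynomial[OF g, where N = N and a = a, folded p_def]
    have "(\<Sum>i<N. \<Sum>j<N. a i * a j * (moment g g (i + j) + moment g g (Suc (i + j)) - c * moment g g (i + j)))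
      = L2_inner M p p + L2_inner M p (A p) - c * L2_inner M p p"
      unfolding P by (simp add: algebra_simps sum.distrib sum_subtractf sum_distrib_left)
    then show "0 \<le> (\<Sum>i<N. \<Sum>j<N. a i * a j * (moment g g (i + j) + moment g g (Suc (i + j)) - c * moment g g (i + j)))"
      using coercive[OF P(1)] by simp
  qed
  show "hankel_nonneg (\<lambda>n. R * moment g g n - moment g g (Suc n))"
    unfolding hankel_nonneg_def
  proof (intro allI)
    fix N a
    define p where "p = (\<lambda>x. \<Sum>i<N. a i * (A ^^ i) g x)"
    note P = moment_polynomial[OF g, where N = N and a = a, folded p_def]
    have "(\<Sum>i<N. \<Sum>j<N. a i * a j * (R * moment g g (i + j) - moment g g (Suc (i + j))))
      = R * L2_inner M p p - L2_inner M p (A p)"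
      unfolding P by (simp add: algebra_simps sum_subtractf sum_distrib_left)
    moreover have "L2_inner M p (A p) \<le> R * L2_inner M p p"
    proof -
      have "L2_inner M p (A p) \<le> L2_norm M p * L2_norm M (A p)"
        using L2_Cauchy_Schwarz[OF P(1) A_L2[OF P(1)]] by linarith
      also have "\<dots> \<le> L2_norm M p * (R * L2_norm M p)" by (intro mult_left_mono R(2) P(1) L2_norm_nonneg)
      also have "\<dots> = R * (L2_norm M p)\<^sup>2" by (simp add: power2_eq_square)
      finally show ?thesis by (simp add: L2_norm_power2)
    qed
    ultimately show "0 \<le> (\<Sum>i<N. \<Sum>j<N. a i * a j * (R * moment g g (i + j) - moment g g (Suc (i + j))))"
      by simp
  qed
qed

text \<open>The form of the operator whose Fredholm determinant is \<open>det2 M A\<close>.\<close>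

definition W :: "('a \<Rightarrow> real) \<Rightarrow> ('a \<Rightarrow> real) \<Rightarrow> real" where
  "W f g = L2_inner M f (((id + A) \<circ> op_exp M (- A)) g)"

lemma exp_L2: "g \<in> L2 M \<Longrightarrow> op_exp M (- A) g \<in> L2 M"
  by (rule op_exp_properties(1)[OF bounded_operator_uminus_op[OF bounded]])

lemma exp_inner_sums:
  assumes f: "f \<in> L2 M" and g: "g \<in> L2 M"
  shows "(\<lambda>n. moment f g n / fact n * (-1) ^ n) sums L2_inner M f (op_exp M (- A) g)"
proof -
  have "(\<lambda>n. L2_inner M f (((- A) ^^ n) g) / fact n) sums L2_inner M f (op_exp M (- A) g)"
    by (rule op_exp_properties(2)[OF bounded_operator_uminus_op[OF bounded] g f])
  moreover have "L2_inner M f (((- A) ^^ n) g) = (-1) ^ n * moment f g n" for n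
  proof -
    have "L2_inner M f (((- A) ^^ n) g) = L2_inner M f (\<lambda>x. (-1) ^ n * (A ^^ n) g x)"
      by (rule L2_inner_cong_AE[OF f
            bounded_operator_L2[OF bounded_operator_power[OF bounded_operator_uminus_op[OF bounded]] g]
            f L2_scale[OF power_L2[OF g]] AE_I2[OF refl] uminus_operator_power_AE[OF bounded g]])
    then show ?thesis by (simp only: L2_inner_scale_right moment_def)
  qed
  ultimately show ?thesis by (simp add: mult.commute)
qed

lemma W_eq:
  assumes f: "f \<in> L2 M" and g: "g \<in> L2 M"
  shows "W f g = L2_inner M f (op_exp M (- A) g) + L2_inner M (A f) (op_exp M (- A) g)"
  unfolding W_def using A_inner[OF f exp_L2[OF g]] L2_inner_add_right[OF f exp_L2[OF g] A_L2[OF exp_L2[OF g]]]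
  by (simp add: plus_fun_def)

lemma W_sums:
  assumes f: "f \<in> L2 M" and g: "g \<in> L2 M"
  shows "(\<lambda>n. (moment f g n + moment f g (Suc n)) / fact n * (-1) ^ n) sums W f g"
proof -
  have "moment (A f) g n = moment f g (Suc n)" for n
    unfolding moment_def using A_inner[OF f power_L2[OF g]] by simp
  then have "(\<lambda>n. moment f g (Suc n) / fact n * (-1) ^ n) sums L2_inner M (A f) (op_exp M (- A) g)"
    using exp_inner_sums[OF A_L2[OF f] g] by simp
  from sums_add[OF exp_inner_sums[OF f g] this] show ?thesis
    unfolding W_eq[OF f g] by (simp add: add_divide_distrib distrib_right)
qed

lemma W_commute: "f \<in> L2 M \<Longrightarrow> g \<in> L2 M \<Longrightarrow> W f g = W g f"
  using sums_unique2[OF W_sums[of f g]] W_sums[of g f] by (simp add: moment_commute[of f g])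

text \<open>The moments of \<open>g\<close> are fed into \<open>expmom_bounds\<close>. Shifted twice
  they are the moments of \<open>A g\<close>, which is the origin of the term |A g|^2.\<close>

lemma W_bounds:
  assumes g: "g \<in> L2 M"
  shows "c * exp (- R) * L2_inner M g g \<le> W g g" "W g g \<le> L2_inner M g g"
    "L2_inner M g g - W g g \<le> L2_inner M (A g) (A g) * exp R"
proof -
  have W: "W g g = expmom (moment g g) (-1) + expmom (\<lambda>n. moment g g (Suc n)) (-1)"
  proof -
    have b: "\<bar>moment g g (Suc n)\<bar> \<le> (L2_inner M g g * R) * R ^ n" for n
      using moment_bound[OF g, of "Suc n"] by (simp add: mult_ac)
    have "(\<lambda>n. moment g g n / fact n * (-1) ^ n + moment g g (Suc n) / fact n * (-1) ^ n) sums
        (expmom (moment g g) (-1) + expmom (\<lambda>n. moment g g (Suc n)) (-1))"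
      unfolding expmom_def
      by (intro sums_add summable_sums summable_expmom[OF moment_bound[OF g]] summable_expmom[OF b])
    moreover have "(\<lambda>n. moment g g n / fact n * (-1) ^ n + moment g g (Suc n) / fact n * (-1) ^ n) sums W g g"
      using W_sums[OF g g] by (simp only: add_divide_distrib distrib_right)
    ultimately show ?thesis by (rule sums_unique2[rotated])
  qed
  have m0: "moment g g 0 = L2_inner M g g" by (simp add: moment_def)
  have m2: "moment g g (Suc (Suc n)) = moment (A g) (A g) n" for n
  proof -
    have "moment (A g) (A g) n = L2_inner M ((A ^^ 1) g) ((A ^^ (Suc n)) g)"
      unfolding moment_def by (simp add: funpow_swap1)
    then show ?thesis unfolding power_inner[OF g g] by (simp add: moment_def)
  qed
  have h2: "hankel_nonneg (\<lambda>n. moment g g (Suc (Suc n)))"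
    unfolding m2 by (rule hankel_moment(1)[OF A_L2[OF g]])
  have d2: "\<bar>moment g g (Suc (Suc n))\<bar> \<le> L2_inner M (A g) (A g) * R ^ n" for n
    unfolding m2 by (rule moment_bound[OF A_L2[OF g]])
  note * = expmom_bounds[OF moment_bound[OF g] R(1) hankel_moment(1)[OF g] h2 hankel_moment(2)[OF g]
      less_imp_le[OF c(1)] hankel_moment(3)[OF g] d2, folded W, unfolded m0]
  show "c * exp (- R) * L2_inner M g g \<le> W g g" "W g g \<le> L2_inner M g g"
    "L2_inner M g g - W g g \<le> L2_inner M (A g) (A g) * exp R"
    by (rule *)+
qed

text \<open>\<open>op_exp\<close> is chosen separately for each function, so bilinearity of
  \<open>W\<close> is read off from its moment series, where the powers of \<open>A\<close> are
  linear almost everywhere.\<close>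

lemma W_sum:
  fixes x :: "('a \<Rightarrow> real) \<Rightarrow> real"
  assumes F: "\<And>i. i \<in> F \<Longrightarrow> i \<in> L2 M"
  defines "g \<equiv> \<lambda>t. \<Sum>i\<in>F. x i * i t"
  shows "g \<in> L2 M" "(\<Sum>i\<in>F. \<Sum>j\<in>F. x i * x j * W i j) = W g g"
    "(\<Sum>i\<in>F. \<Sum>j\<in>F. x i * x j * L2_inner M i j) = L2_inner M g g"
proof -
  have L: "(\<lambda>t. x i * i t) \<in> L2 M" if "i \<in> F" for i using F[OF that] by (rule L2_scale)
  show g: "g \<in> L2 M" unfolding g_def by (rule L2_sum) (rule L)
  have m: "(\<Sum>i\<in>F. \<Sum>j\<in>F. x i * x j * moment i j n) = moment g g n" for n
  proof -
    have AL: "(A ^^ n) i \<in> L2 M" if "i \<in> F" for i by (rule power_L2[OF F[OF that]])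
    have AL': "(\<lambda>t. x i * (A ^^ n) i t) \<in> L2 M" if "i \<in> F" for i by (rule L2_scale[OF AL[OF that]])
    have "moment g g n = L2_inner M g (\<lambda>t. \<Sum>j\<in>F. x j * (A ^^ n) j t)"
      unfolding moment_def
      by (rule L2_inner_cong_AE[OF g power_L2[OF g] g L2_sum[OF AL'] AE_I2[OF refl]])
         (auto simp: g_def intro: bounded_operator_sum[OF bounded_operator_power[OF bounded] F])
    also have "\<dots> = (\<Sum>i\<in>F. L2_inner M (\<lambda>t. x i * i t) (\<lambda>t. \<Sum>j\<in>F. x j * (A ^^ n) j t))"
      unfolding g_def by (rule L2_inner_sum_left[OF L2_sum[OF AL'] L])
    also have "\<dots> = (\<Sum>i\<in>F. \<Sum>j\<in>F. L2_inner M (\<lambda>t. x i * i t) (\<lambda>t. x j * (A ^^ n) j t))"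
      by (intro sum.cong refl L2_inner_sum_right L AL')
    finally show ?thesis
      unfolding L2_inner_scale_left L2_inner_scale_right moment_def by (simp add: mult.assoc)
  qed
  have "(\<lambda>n. \<Sum>i\<in>F. \<Sum>j\<in>F. x i * x j * ((moment i j n + moment i j (Suc n)) / fact n * (-1) ^ n)) sums
      (\<Sum>i\<in>F. \<Sum>j\<in>F. x i * x j * W i j)"
    by (intro sums_sum sums_mult W_sums F)
  also have "(\<lambda>n. \<Sum>i\<in>F. \<Sum>j\<in>F. x i * x j * ((moment i j n + moment i j (Suc n)) / fact n * (-1) ^ n))
    = (\<lambda>n. (moment g g n + moment g g (Suc n)) / fact n * (-1) ^ n)"
  proof
    fix n
    have "(moment g g n + moment g g (Suc n)) / fact n * (-1) ^ n
      = (\<Sum>i\<in>F. \<Sum>j\<in>F. (x i * x j * moment i j n + x i * x j * moment i j (Suc n)) * ((-1) ^ n / fact n))"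
      unfolding m[symmetric] sum_distrib_right[symmetric] sum.distrib by simp
    also have "\<dots> = (\<Sum>i\<in>F. \<Sum>j\<in>F. x i * x j * ((moment i j n + moment i j (Suc n)) / fact n * (-1) ^ n))"
      by (intro sum.cong refl) (simp add: distrib_left distrib_right)
    finally show "(\<Sum>i\<in>F. \<Sum>j\<in>F. x i * x j * ((moment i j n + moment i j (Suc n)) / fact n * (-1) ^ n))
      = (moment g g n + moment g g (Suc n)) / fact n * (-1) ^ n" ..
  qed
  finally show "(\<Sum>i\<in>F. \<Sum>j\<in>F. x i * x j * W i j) = W g g" using W_sums[OF g g] by (rule sums_unique2)
  show "(\<Sum>i\<in>F. \<Sum>j\<in>F. x i * x j * L2_inner M i j) = L2_inner M g g"
    using m[of 0] by (simp add: moment_def)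
qed

text \<open>In an orthonormal basis, the identity minus the operator in \<open>det2\<close> has a
  matrix \<open>Q\<close> with 0 <= Q <= 1 - c e^{-R} and diagonal entries at most |A e|^2 e^R, so
  the Hilbert-Schmidt bound on \<open>A\<close> bounds the trace of \<open>Q\<close>. It is assumed
  for every basis because \<open>fredholm_det\<close> picks an unspecified one.\<close>

lemma det2_pos:
  assumes HS: "\<And>B F. orthonormal_basis M B \<Longrightarrow> finite F \<Longrightarrow> F \<subseteq> B \<Longrightarrow> (\<Sum>e\<in>F. L2_inner M (A e) (A e)) \<le> C"
  shows "0 < det2 M A"
proof -
  define B where "B = (SOME B. orthonormal_basis M B)"
  have B: "orthonormal_basis M B" unfolding B_def using orthonormal_basis_exists by (rule someI_ex)
  then have BL: "\<And>e. e \<in> B \<Longrightarrow> e \<in> L2 M"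
    and on: "\<And>e f. e \<in> B \<Longrightarrow> f \<in> B \<Longrightarrow> L2_inner M e f = (if e = f then 1 else 0)"
    by (auto simp: orthonormal_basis_def)
  define Q where "Q e f = L2_inner M e f - W e f" for e f
  have qQ: "qform F Q x = L2_inner M (\<lambda>t. \<Sum>i\<in>F. x i * i t) (\<lambda>t. \<Sum>i\<in>F. x i * i t) - W (\<lambda>t. \<Sum>i\<in>F. x i * i t) (\<lambda>t. \<Sum>i\<in>F. x i * i t)"
    if "F \<subseteq> B" for F x
  proof -
    have "qform F Q x = (\<Sum>i\<in>F. \<Sum>j\<in>F. x i * x j * L2_inner M i j) - (\<Sum>i\<in>F. \<Sum>j\<in>F. x i * x j * W i j)"
      unfolding qform_def Q_def by (simp add: right_diff_distrib sum_subtractf)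
    moreover have "\<And>i. i \<in> F \<Longrightarrow> i \<in> L2 M" using BL that by blast
    ultimately show ?thesis using W_sum(2,3)[of F x] by simp
  qed
  have norm: "L2_inner M (\<lambda>t. \<Sum>i\<in>F. x i * i t) (\<lambda>t. \<Sum>i\<in>F. x i * i t) = (\<Sum>i\<in>F. (x i)\<^sup>2)"
    if "finite F" "F \<subseteq> B" for F x
  proof -
    have "(\<Sum>i\<in>F. \<Sum>j\<in>F. x i * x j * L2_inner M i j) = (\<Sum>i\<in>F. \<Sum>j\<in>F. if i = j then x i * x j else 0)"
    proof (intro sum.cong refl)
      fix i j assume "i \<in> F" "j \<in> F"
      then have "i \<in> B" "j \<in> B" using that by auto
      then show "x i * x j * L2_inner M i j = (if i = j then x i * x j else 0)"
        using on[of i j] by auto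
    qed
    also have "\<dots> = (\<Sum>i\<in>F. (x i)\<^sup>2)" using that by (simp add: power2_eq_square)
    finally have "(\<Sum>i\<in>F. \<Sum>j\<in>F. x i * x j * L2_inner M i j) = (\<Sum>i\<in>F. (x i)\<^sup>2)" .
    moreover have "\<And>i. i \<in> F \<Longrightarrow> i \<in> L2 M" using BL that by blast
    ultimately show ?thesis using W_sum(3)[of F x] by simp
  qed
  have GL: "(\<lambda>t. \<Sum>i\<in>F. x i * i t) \<in> L2 M" if "F \<subseteq> B" for F x
    using W_sum(1)[of F x] BL that by auto
  have "0 < (\<Sum>\<^sub>\<infinity>F\<in>{F. finite F \<and> F \<subseteq> B}. pdet F (\<lambda>i j. - Q i j))"
  proof (rule infsum_pdet_pos[where c = "c * exp (- R)" and C = "C * exp R"])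
    show "Q i j = Q j i" if "i \<in> B" "j \<in> B" for i j
      using W_commute[OF BL[OF that(1)] BL[OF that(2)]] L2_inner_commute[of M i j] by (simp add: Q_def)
    show "0 < c * exp (- R)" using c by simp
    have "c * exp (- R) \<le> 1 * 1" using c R(1) by (intro mult_mono) auto
    then show "c * exp (- R) \<le> 1" by simp
    fix F assume F: "finite F" "F \<subseteq> B"
    show "0 \<le> qform F Q x" for x
      using W_bounds(2)[OF GL[OF F(2), of x]] qQ[OF F(2), of x] by simp
    show "qform F Q x \<le> (1 - c * exp (- R)) * (\<Sum>i\<in>F. (x i)\<^sup>2)" for x
      using W_bounds(1)[OF GL[OF F(2), of x]] unfolding qQ[OF F(2)] norm[OF F] by (simp add: left_diff_distrib)
    have "(\<Sum>i\<in>F. Q i i) \<le> (\<Sum>i\<in>F. L2_inner M (A i) (A i) * exp R)"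
      unfolding Q_def using W_bounds(3) BL F by (intro sum_mono) auto
    also have "\<dots> = (\<Sum>i\<in>F. L2_inner M (A i) (A i)) * exp R" by (rule sum_distrib_right[symmetric])
    also have "\<dots> \<le> C * exp R" using HS[OF B F] by (intro mult_right_mono) auto
    finally show "(\<Sum>i\<in>F. Q i i) \<le> C * exp R" .
  qed
  also have "(\<Sum>\<^sub>\<infinity>F\<in>{F. finite F \<and> F \<subseteq> B}. pdet F (\<lambda>i j. - Q i j)) = det2 M A"
  proof -
    have "pdet F (\<lambda>i j. - Q i j) = principal_minor M (((id + A) \<circ> op_exp M (- A)) - id) F" if "F \<subseteq> B" for F
    proof -
      have "- Q i j = L2_inner M i ((((id + A) \<circ> op_exp M (- A)) - id) j)" if "i \<in> F" "j \<in> F" for i j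
      proof -
        have ij: "i \<in> L2 M" "j \<in> L2 M" using that \<open>F \<subseteq> B\<close> BL by auto
        have "((id + A) \<circ> op_exp M (- A)) j \<in> L2 M"
          using bounded_operator_L2[OF bounded_operator_plus[OF bounded_operator_id bounded] exp_L2[OF ij(2)]] by simp
        from L2_inner_diff_right[OF ij(1) this ij(2)]
        have "- Q i j = L2_inner M i (\<lambda>x. ((id + A) \<circ> op_exp M (- A)) j x - j x)"
          unfolding Q_def W_def by simp
        also have "(\<lambda>x. ((id + A) \<circ> op_exp M (- A)) j x - j x) = (((id + A) \<circ> op_exp M (- A)) - id) j"
          by (rule ext) (simp only: minus_apply id_apply)
        finally show ?thesis .
      qed
      then have "pdet F (\<lambda>i j. - Q i j) = pdet F (\<lambda>i j. L2_inner M i ((((id + A) \<circ> op_exp M (- A)) - id) j))"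
        by (rule pdet_cong)
      then show ?thesis unfolding principal_minor_def pdet_def .
    qed
    then show ?thesis
      unfolding det2_def fredholm_det_def Let_def B_def[symmetric] by (intro infsum_cong) auto
  qed
  finally show ?thesis .
qed

end

section \<open>Integral operators with square integrable kernels\<close>

definition transpose_kernel :: "('a \<times> 'a \<Rightarrow> real) \<Rightarrow> 'a \<times> 'a \<Rightarrow> real" where
  "transpose_kernel A = (\<lambda>(x, y). A (y, x))"

definition comp_kernel :: "'a measure \<Rightarrow> ('a \<times> 'a \<Rightarrow> real) \<Rightarrow> ('a \<times> 'a \<Rightarrow> real) \<Rightarrow> 'a \<times> 'a \<Rightarrow> real" where
  "comp_kernel M A B = (\<lambda>(x, y). \<integral>z. A (x, z) * B (z, y) \<partial>M)"

definition tensor :: "('a \<Rightarrow> real) \<Rightarrow> ('a \<Rightarrow> real) \<Rightarrow> 'a \<times> 'a \<Rightarrow> real" where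
  "tensor f g = (\<lambda>(x, y). f x * g y)"

lemma transpose_kernel_apply [simp]: "transpose_kernel A (x, y) = A (y, x)"
  by (simp add: transpose_kernel_def)

lemma transpose_kernel_transpose [simp]: "transpose_kernel (transpose_kernel A) = A"
  by (simp add: transpose_kernel_def)

lemma tensor_apply [simp]: "tensor f g (x, y) = f x * g y"
  by (simp add: tensor_def)

lemma integral_op_eq_inner: "integral_op M A f x = L2_inner M (\<lambda>y. A (x, y)) f"
  by (simp add: integral_op_def L2_inner_def)

text \<open>The two readings of a product kernel: its columns are \<open>A\<close> applied to
  columns of \<open>B\<close>, its rows are the transposed \<open>B\<close> applied to rows of
  \<open>A\<close>. Columns carry the equation for C, rows give the norm bound and the composition
  law.\<close>

lemma comp_kernel_column: "comp_kernel M A B (x, y) = integral_op M A (\<lambda>z. B (z, y)) x"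
  by (simp add: comp_kernel_def integral_op_def)

lemma comp_kernel_row: "comp_kernel M A B (x, y) = integral_op M (transpose_kernel B) (\<lambda>z. A (x, z)) y"
  by (simp add: comp_kernel_def integral_op_def mult.commute)

context sigma_finite_measure
begin

interpretation pair: pair_sigma_finite M M ..

lemma kernel_section_L2:
  assumes A: "A \<in> L2 (M \<Otimes>\<^sub>M M)"
  shows "AE x in M. (\<lambda>y. A (x, y)) \<in> L2 M"
proof -
  have "AE x in M. integrable M (\<lambda>y. (A (x, y))\<^sup>2)"
    using pair.AE_integrable_fst'[OF L2_integrable_square[OF A]] .
  moreover have "AE x in M. (\<lambda>y. A (x, y)) \<in> borel_measurable M"
    using measurable_Pair2[OF L2_measurable[OF A]] by simp
  ultimately show ?thesis by eventually_elim (simp add: L2_def)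
qed

lemma transpose_kernel_L2:
  assumes A: "A \<in> L2 (M \<Otimes>\<^sub>M M)"
  shows "transpose_kernel A \<in> L2 (M \<Otimes>\<^sub>M M)"
proof -
  have "integrable (M \<Otimes>\<^sub>M M) (\<lambda>(x, y). (A (y, x))\<^sup>2)"
    using pair.integrable_product_swap[OF L2_integrable_square[OF A]] .
  moreover have "(\<lambda>(x, y). A (y, x)) \<in> borel_measurable (M \<Otimes>\<^sub>M M)"
    using measurable_compose[OF measurable_pair_swap' L2_measurable[OF A]] by (simp add: split_def)
  ultimately show ?thesis unfolding transpose_kernel_def by (simp add: L2_def split_def)
qed

lemma kernel_column_L2:
  assumes "A \<in> L2 (M \<Otimes>\<^sub>M M)"
  shows "AE y in M. (\<lambda>x. A (x, y)) \<in> L2 M"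
  using kernel_section_L2[OF transpose_kernel_L2[OF assms]] by simp

lemma kernel_norm_rows:
  assumes A: "A \<in> L2 (M \<Otimes>\<^sub>M M)"
  shows "integrable M (\<lambda>x. L2_inner M (\<lambda>y. A (x, y)) (\<lambda>y. A (x, y)))"
    and "(\<integral>x. L2_inner M (\<lambda>y. A (x, y)) (\<lambda>y. A (x, y)) \<partial>M) = L2_inner (M \<Otimes>\<^sub>M M) A A"
  using pair.integrable_fst'[OF L2_integrable_mult[OF A A]] pair.integral_fst'[OF L2_integrable_mult[OF A A]]
  by (simp_all add: L2_inner_def)

lemma transpose_kernel_norm:
  assumes A: "A \<in> L2 (M \<Otimes>\<^sub>M M)"
  shows "L2_norm (M \<Otimes>\<^sub>M M) (transpose_kernel A) = L2_norm (M \<Otimes>\<^sub>M M) A"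
proof -
  have "(\<lambda>p. A p * A p) \<in> borel_measurable (M \<Otimes>\<^sub>M M)" using L2_measurable[OF A] by measurable
  from pair.integral_product_swap[OF this] show ?thesis
    by (simp add: L2_norm_def L2_inner_def transpose_kernel_def split_def)
qed

lemma integral_op_measurable:
  assumes A: "A \<in> L2 (M \<Otimes>\<^sub>M M)" and f: "f \<in> L2 M"
  shows "integral_op M A f \<in> borel_measurable M"
proof -
  have [measurable]: "A \<in> borel_measurable (M \<Otimes>\<^sub>M M)" "f \<in> borel_measurable M"
    using A f by (auto dest: L2_measurable)
  show ?thesis unfolding integral_op_def by measurable
qed

text \<open>Cauchy-Schwarz in almost every row, followed by integration over the rows.\<close>

lemma integral_op_L2:
  assumes A: "A \<in> L2 (M \<Otimes>\<^sub>M M)" and f: "f \<in> L2 M"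
  shows "integral_op M A f \<in> L2 M"
    and "L2_norm M (integral_op M A f) \<le> L2_norm (M \<Otimes>\<^sub>M M) A * L2_norm M f"
proof -
  let ?a = "\<lambda>x. L2_inner M (\<lambda>y. A (x, y)) (\<lambda>y. A (x, y))"
  have le: "AE x in M. (integral_op M A f x)\<^sup>2 \<le> ?a x * L2_inner M f f"
    using kernel_section_L2[OF A]
  proof eventually_elim
    case (elim x)
    have "\<bar>integral_op M A f x\<bar> \<le> L2_norm M (\<lambda>y. A (x, y)) * L2_norm M f"
      unfolding integral_op_eq_inner by (rule L2_Cauchy_Schwarz[OF elim f])
    then have "\<bar>integral_op M A f x\<bar>\<^sup>2 \<le> (L2_norm M (\<lambda>y. A (x, y)) * L2_norm M f)\<^sup>2"
      by (intro power_mono) auto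
    then show ?case by (simp add: power_mult_distrib L2_norm_power2)
  qed
  have int: "integrable M (\<lambda>x. ?a x * L2_inner M f f)" using kernel_norm_rows(1)[OF A] by simp
  have "(\<integral>\<^sup>+x. ennreal ((integral_op M A f x)\<^sup>2) \<partial>M) \<le> (\<integral>\<^sup>+x. ennreal (?a x * L2_inner M f f) \<partial>M)"
    using le by (intro nn_integral_mono_AE) (auto elim!: eventually_mono intro!: ennreal_leI)
  also have "\<dots> = ennreal (\<integral>x. ?a x * L2_inner M f f \<partial>M)"
    by (rule nn_integral_eq_integral[OF int]) (simp add: L2_inner_self_nonneg)
  also have "(\<integral>x. ?a x * L2_inner M f f \<partial>M) = L2_inner (M \<Otimes>\<^sub>M M) A A * L2_inner M f f"
    using kernel_norm_rows(2)[OF A] by simp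
  finally have *: "(\<integral>\<^sup>+x. ennreal ((integral_op M A f x)\<^sup>2) \<partial>M) \<le> ennreal (L2_inner (M \<Otimes>\<^sub>M M) A A * L2_inner M f f)" .
  note ** = L2I_nn_integral[OF integral_op_measurable[OF A f] * mult_nonneg_nonneg[OF L2_inner_self_nonneg L2_inner_self_nonneg]]
  show "integral_op M A f \<in> L2 M" by (rule **(1))
  have "(L2_norm M (integral_op M A f))\<^sup>2 \<le> (L2_norm (M \<Otimes>\<^sub>M M) A * L2_norm M f)\<^sup>2"
    using **(2) by (simp add: power_mult_distrib L2_norm_power2)
  then show "L2_norm M (integral_op M A f) \<le> L2_norm (M \<Otimes>\<^sub>M M) A * L2_norm M f"
    by (rule power2_le_imp_le) (simp add: L2_norm_nonneg)
qed

lemma bounded_integral_op: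
  assumes A: "A \<in> L2 (M \<Otimes>\<^sub>M M)"
  shows "bounded_operator M (integral_op M A)"
proof (rule bounded_operatorI[where C = "L2_norm (M \<Otimes>\<^sub>M M) A"])
  fix f g assume fg: "f \<in> L2 M" "g \<in> L2 M"
  show "AE x in M. integral_op M A (\<lambda>t. f t + g t) x = integral_op M A f x + integral_op M A g x"
    using kernel_section_L2[OF A]
    by eventually_elim (simp add: integral_op_eq_inner L2_inner_add_right fg)
next
  fix c f
  show "AE x in M. integral_op M A (\<lambda>t. c * f t) x = c * integral_op M A f x"
    by (simp add: integral_op_eq_inner L2_inner_scale_right)
qed (use integral_op_L2[OF A] in auto)

section \<open>Elementary tensors, adjoints and composition\<close>

lemma tensor_L2:
  assumes f: "f \<in> L2 M" and g: "g \<in> L2 M"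
  shows "tensor f g \<in> L2 (M \<Otimes>\<^sub>M M)"
    and "L2_inner (M \<Otimes>\<^sub>M M) (tensor f g) (tensor f g) = L2_inner M f f * L2_inner M g g"
proof -
  have [measurable]: "f \<in> borel_measurable M" "g \<in> borel_measurable M"
    using f g by (auto dest: L2_measurable)
  have m: "tensor f g \<in> borel_measurable (M \<Otimes>\<^sub>M M)" unfolding tensor_def by measurable
  have int: "integrable (M \<Otimes>\<^sub>M M) (\<lambda>p. (tensor f g p)\<^sup>2)"
  proof (rule pair.Fubini_integrable)
    show "(\<lambda>p. (tensor f g p)\<^sup>2) \<in> borel_measurable (M \<Otimes>\<^sub>M M)" using m by measurable
    show "integrable M (\<lambda>x. \<integral>y. norm ((tensor f g (x, y))\<^sup>2) \<partial>M)"
      using L2_integrable_square[OF f] by (simp add: power_mult_distrib)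
    show "AE x in M. integrable M (\<lambda>y. (tensor f g (x, y))\<^sup>2)"
      using L2_integrable_square[OF g] by (simp add: power_mult_distrib)
  qed
  show T: "tensor f g \<in> L2 (M \<Otimes>\<^sub>M M)" using m int by (simp add: L2_def)
  have "L2_inner (M \<Otimes>\<^sub>M M) (tensor f g) (tensor f g) = (\<integral>x. \<integral>y. tensor f g (x, y) * tensor f g (x, y) \<partial>M \<partial>M)"
    unfolding L2_inner_def by (rule pair.integral_fst'[symmetric, OF L2_integrable_mult[OF T T]])
  also have "\<dots> = (\<integral>x. (f x * f x) * L2_inner M g g \<partial>M)"
    unfolding L2_inner_def by (intro Bochner_Integration.integral_cong refl) (simp add: mult_ac flip: integral_mult_right_zero)
  finally show "L2_inner (M \<Otimes>\<^sub>M M) (tensor f g) (tensor f g) = L2_inner M f f * L2_inner M g g"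
    by (simp add: L2_inner_def)
qed

text \<open>One double integral, evaluated by Fubini in both orders; comparing the results
  identifies the adjoint of an integral operator.\<close>

lemma tensor_inner_kernel:
  assumes A: "A \<in> L2 (M \<Otimes>\<^sub>M M)" and f: "f \<in> L2 M" and g: "g \<in> L2 M"
  shows "L2_inner (M \<Otimes>\<^sub>M M) (tensor g f) A = L2_inner M g (integral_op M A f)"
    and "L2_inner (M \<Otimes>\<^sub>M M) (tensor g f) A = L2_inner M (integral_op M (transpose_kernel A) g) f"
proof -
  have int: "integrable (M \<Otimes>\<^sub>M M) (\<lambda>p. tensor g f p * A p)"
    by (rule L2_integrable_mult[OF tensor_L2(1)[OF g f] A])
  have "L2_inner (M \<Otimes>\<^sub>M M) (tensor g f) A = (\<integral>x. \<integral>y. tensor g f (x, y) * A (x, y) \<partial>M \<partial>M)"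
    unfolding L2_inner_def by (rule pair.integral_fst'[symmetric, OF int])
  also have "\<dots> = (\<integral>x. \<integral>y. g x * (A (x, y) * f y) \<partial>M \<partial>M)" by (simp add: mult_ac)
  also have "\<dots> = L2_inner M g (integral_op M A f)"
    unfolding integral_op_def L2_inner_def by simp
  finally show "L2_inner (M \<Otimes>\<^sub>M M) (tensor g f) A = L2_inner M g (integral_op M A f)" .
  have e: "(\<lambda>p. tensor g f p * A p) = case_prod (\<lambda>x y. tensor g f (x, y) * A (x, y))"
    by (rule ext) (simp only: case_prod_beta prod.collapse)
  have int': "integrable (M \<Otimes>\<^sub>M M) (case_prod (\<lambda>x y. tensor g f (x, y) * A (x, y)))"
    using int unfolding e .
  have "L2_inner (M \<Otimes>\<^sub>M M) (tensor g f) A = (\<integral>p. case_prod (\<lambda>x y. tensor g f (x, y) * A (x, y)) p \<partial>(M \<Otimes>\<^sub>M M))"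
    unfolding L2_inner_def e ..
  also have "\<dots> = (\<integral>y. \<integral>x. tensor g f (x, y) * A (x, y) \<partial>M \<partial>M)"
    by (rule pair.integral_snd[symmetric, OF int'])
  also have "\<dots> = (\<integral>y. \<integral>x. (A (x, y) * g x) * f y \<partial>M \<partial>M)" by (simp add: mult_ac)
  also have "\<dots> = L2_inner M (integral_op M (transpose_kernel A) g) f"
    unfolding integral_op_def L2_inner_def by simp
  finally show "L2_inner (M \<Otimes>\<^sub>M M) (tensor g f) A = L2_inner M (integral_op M (transpose_kernel A) g) f" .
qed

lemma adjoint_integral_op:
  assumes A: "A \<in> L2 (M \<Otimes>\<^sub>M M)"
  shows "adjoint_op M (integral_op M A) (integral_op M (transpose_kernel A))"
  unfolding adjoint_op_def
proof (intro ballI)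
  fix f g assume fg: "f \<in> L2 M" "g \<in> L2 M"
  show "L2_inner M (integral_op M A f) g = L2_inner M f (integral_op M (transpose_kernel A) g)"
    using tensor_inner_kernel[OF A fg] by (simp add: L2_inner_commute)
qed

text \<open>By \<open>comp_kernel_row\<close> the operator bound for the transposed \<open>B\<close>
  applies to each row of \<open>A\<close>; the squares are then integrated over the rows.\<close>

lemma comp_kernel_L2:
  assumes A: "A \<in> L2 (M \<Otimes>\<^sub>M M)" and B: "B \<in> L2 (M \<Otimes>\<^sub>M M)"
  shows "comp_kernel M A B \<in> L2 (M \<Otimes>\<^sub>M M)"
    and "L2_norm (M \<Otimes>\<^sub>M M) (comp_kernel M A B) \<le> L2_norm (M \<Otimes>\<^sub>M M) A * L2_norm (M \<Otimes>\<^sub>M M) B"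
proof -
  have [measurable]: "A \<in> borel_measurable (M \<Otimes>\<^sub>M M)" "B \<in> borel_measurable (M \<Otimes>\<^sub>M M)"
    using A B by (auto dest: L2_measurable)
  have m: "comp_kernel M A B \<in> borel_measurable (M \<Otimes>\<^sub>M M)"
    unfolding comp_kernel_def by measurable
  have m2: "(\<lambda>p. ennreal ((comp_kernel M A B p)\<^sup>2)) \<in> borel_measurable (M \<Otimes>\<^sub>M M)"
    using m by measurable
  let ?a = "\<lambda>x. L2_inner M (\<lambda>y. A (x, y)) (\<lambda>y. A (x, y))"
  define b where "b = L2_inner (M \<Otimes>\<^sub>M M) B B"
  have b: "0 \<le> b" by (simp add: b_def L2_inner_self_nonneg)
  have "(\<integral>\<^sup>+p. ennreal ((comp_kernel M A B p)\<^sup>2) \<partial>(M \<Otimes>\<^sub>M M))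
      = (\<integral>\<^sup>+x. \<integral>\<^sup>+y. ennreal ((comp_kernel M A B (x, y))\<^sup>2) \<partial>M \<partial>M)"
    by (rule nn_integral_fst[OF m2, symmetric])
  also have "\<dots> \<le> (\<integral>\<^sup>+x. ennreal (b * ?a x) \<partial>M)"
  proof (rule nn_integral_mono_AE)
    show "AE x in M. (\<integral>\<^sup>+y. ennreal ((comp_kernel M A B (x, y))\<^sup>2) \<partial>M) \<le> ennreal (b * ?a x)"
      using kernel_section_L2[OF A]
    proof eventually_elim
      case (elim x)
      note L = integral_op_L2[OF transpose_kernel_L2[OF B] elim]
      have "(\<integral>\<^sup>+y. ennreal ((comp_kernel M A B (x, y))\<^sup>2) \<partial>M)
          = ennreal ((L2_norm M (integral_op M (transpose_kernel B) (\<lambda>z. A (x, z))))\<^sup>2)"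
        unfolding comp_kernel_row by (rule nn_integral_L2_norm[OF L(1)])
      also have "\<dots> \<le> ennreal ((L2_norm (M \<Otimes>\<^sub>M M) B * L2_norm M (\<lambda>z. A (x, z)))\<^sup>2)"
        using L(2) by (intro ennreal_leI power_mono) (auto simp: transpose_kernel_norm[OF B] L2_norm_nonneg)
      finally show ?case by (simp add: b_def power_mult_distrib L2_norm_power2)
    qed
  qed
  also have "\<dots> = ennreal (\<integral>x. b * ?a x \<partial>M)"
    by (rule nn_integral_eq_integral) (use kernel_norm_rows(1)[OF A] b in \<open>auto simp: L2_inner_self_nonneg\<close>)
  also have "(\<integral>x. b * ?a x \<partial>M) = b * L2_inner (M \<Otimes>\<^sub>M M) A A"
    using kernel_norm_rows(2)[OF A] by simp
  finally have le: "(\<integral>\<^sup>+p. ennreal ((comp_kernel M A B p)\<^sup>2) \<partial>(M \<Otimes>\<^sub>M M)) \<le> ennreal (b * L2_inner (M \<Otimes>\<^sub>M M) A A)" .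
  note L = L2I_nn_integral[OF m le mult_nonneg_nonneg[OF b L2_inner_self_nonneg]]
  show "comp_kernel M A B \<in> L2 (M \<Otimes>\<^sub>M M)" by (rule L(1))
  have "(L2_norm (M \<Otimes>\<^sub>M M) (comp_kernel M A B))\<^sup>2 \<le> (L2_norm (M \<Otimes>\<^sub>M M) A * L2_norm (M \<Otimes>\<^sub>M M) B)\<^sup>2"
    using L(2) by (simp add: b_def power_mult_distrib L2_norm_power2 mult.commute)
  then show "L2_norm (M \<Otimes>\<^sub>M M) (comp_kernel M A B) \<le> L2_norm (M \<Otimes>\<^sub>M M) A * L2_norm (M \<Otimes>\<^sub>M M) B"
    by (rule power2_le_imp_le) (simp add: L2_norm_nonneg)
qed

text \<open>For fixed x the operator of \<open>B\<close> is moved from \<open>f\<close> to the row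
  of \<open>A\<close> by adjointness, which replaces an explicit exchange of integrals.\<close>

lemma integral_op_comp:
  assumes A: "A \<in> L2 (M \<Otimes>\<^sub>M M)" and B: "B \<in> L2 (M \<Otimes>\<^sub>M M)"
  shows "op_eq M (integral_op M A \<circ> integral_op M B) (integral_op M (comp_kernel M A B))"
  unfolding op_eq_def
proof
  fix f assume f: "f \<in> L2 M"
  show "AE x in M. (integral_op M A \<circ> integral_op M B) f x = integral_op M (comp_kernel M A B) f x"
    using kernel_section_L2[OF A]
  proof eventually_elim
    case (elim x)
    have "(integral_op M A \<circ> integral_op M B) f x = L2_inner M (\<lambda>y. A (x, y)) (integral_op M B f)"
      by (simp add: integral_op_eq_inner)
    also have "\<dots> = L2_inner M (integral_op M (transpose_kernel B) (\<lambda>y. A (x, y))) f"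
      using adjoint_integral_op[OF B] elim f unfolding adjoint_op_def by (metis L2_inner_commute)
    also have "\<dots> = integral_op M (comp_kernel M A B) f x"
      by (simp add: integral_op_eq_inner[of M "comp_kernel M A B"] comp_kernel_row)
    finally show ?case .
  qed
qed

lemma integral_op_add:
  assumes A: "A \<in> L2 (M \<Otimes>\<^sub>M M)" and B: "B \<in> L2 (M \<Otimes>\<^sub>M M)"
  shows "op_eq M (integral_op M A + integral_op M B) (integral_op M (\<lambda>p. A p + B p))"
  unfolding op_eq_def
proof
  fix f assume f: "f \<in> L2 M"
  show "AE x in M. (integral_op M A + integral_op M B) f x = integral_op M (\<lambda>p. A p + B p) f x"
    using kernel_section_L2[OF A] kernel_section_L2[OF B]
    by eventually_elim (simp add: integral_op_eq_inner L2_inner_add_left[OF f])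
qed

lemma integral_op_cong_AE:
  assumes A: "A \<in> L2 (M \<Otimes>\<^sub>M M)" and B: "B \<in> L2 (M \<Otimes>\<^sub>M M)" and eq: "AE p in M \<Otimes>\<^sub>M M. A p = B p"
  shows "op_eq M (integral_op M A) (integral_op M B)"
  unfolding op_eq_def
proof
  fix f assume f: "f \<in> L2 M"
  show "AE x in M. integral_op M A f x = integral_op M B f x"
    using kernel_section_L2[OF A] kernel_section_L2[OF B] pair.AE_pair[OF eq]
  proof eventually_elim
    case (elim x)
    then show ?case
      unfolding integral_op_eq_inner by (intro L2_inner_cong_AE f) auto
  qed
qed

end

subsection \<open>Orthogonal series\<close>

text \<open>By Pythagoras the squared norm of a block of the series is the sum of the squared norms,
  so the Cauchy criterion carries over from the scalar series.\<close>

lemma orthogonal_series: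
  assumes u: "\<And>n. u n \<in> L2 M" and orth: "\<And>m n. m \<noteq> n \<Longrightarrow> L2_inner M (u m) (u n) = 0"
    and sm: "summable (\<lambda>n. L2_inner M (u n) (u n))"
  obtains g where "g \<in> L2 M" "(\<lambda>N. L2_norm M (\<lambda>x. g x - (\<Sum>n<N. u n x))) \<longlonglongrightarrow> 0"
proof -
  define P where "P N = (\<lambda>x. \<Sum>n<N. u n x)" for N
  have PL: "P N \<in> L2 M" for N unfolding P_def by (intro L2_sum u)
  have pyth: "L2_inner M (\<lambda>x. \<Sum>n\<in>I. u n x) (\<lambda>x. \<Sum>n\<in>I. u n x) = (\<Sum>n\<in>I. L2_inner M (u n) (u n))" if "finite I" for I
  proof -
    have "L2_inner M (\<lambda>x. \<Sum>n\<in>I. u n x) (\<lambda>x. \<Sum>n\<in>I. u n x) = (\<Sum>m\<in>I. L2_inner M (u m) (\<lambda>x. \<Sum>n\<in>I. u n x))"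
      by (intro L2_inner_sum_left L2_sum u)
    also have "\<dots> = (\<Sum>m\<in>I. \<Sum>n\<in>I. L2_inner M (u m) (u n))"
      by (intro sum.cong refl L2_inner_sum_right u)
    also have "\<dots> = (\<Sum>m\<in>I. \<Sum>n\<in>I. if m = n then L2_inner M (u m) (u n) else 0)"
      by (intro sum.cong refl) (use orth in auto)
    finally show ?thesis using that by simp
  qed
  have diff: "(L2_norm M (\<lambda>x. P n x - P m x))\<^sup>2 = (\<Sum>k=m..<n. L2_inner M (u k) (u k))" if "m \<le> n" for m n
  proof -
    have "P n x - P m x = (\<Sum>k=m..<n. u k x)" for x
      unfolding P_def lessThan_atLeast0 using sum_diff_nat_ivl[of 0 m n "\<lambda>k. u k x"] that by simp
    then show ?thesis unfolding L2_norm_power2 using pyth[of "{m..<n}"] by simp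
  qed
  have "\<exists>N. \<forall>m\<ge>N. \<forall>n\<ge>N. L2_norm M (\<lambda>x. P m x - P n x) < e" if e: "e > 0" for e
  proof -
    obtain N where N: "\<And>m n. m \<ge> N \<Longrightarrow> norm (\<Sum>k=m..<n. L2_inner M (u k) (u k)) < e\<^sup>2"
      using sm e unfolding summable_Cauchy by (metis zero_less_power)
    have *: "L2_norm M (\<lambda>x. P n x - P m x) < e" if "m \<ge> N" "m \<le> n" for m n
    proof -
      have "(L2_norm M (\<lambda>x. P n x - P m x))\<^sup>2 < e\<^sup>2"
        using N[OF that(1), of n] unfolding diff[OF that(2)] by simp
      then show ?thesis by (rule power2_less_imp_less) (use e in simp)
    qed
    have "L2_norm M (\<lambda>x. P m x - P n x) < e" if "m \<ge> N" "n \<ge> N" for m n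
      using *[of m n] *[of n m] that L2_norm_minus_commute[of M "P m" "P n"] by (cases "m \<le> n") auto
    then show ?thesis by (intro exI[of _ N] allI impI)
  qed
  from L2_complete[where f = P, OF PL this] obtain g where
    "g \<in> L2 M" "(\<lambda>N. L2_norm M (\<lambda>x. g x - P N x)) \<longlonglongrightarrow> 0" .
  then show thesis unfolding P_def by (rule that)
qed

lemma Bessel:
  assumes f: "f \<in> L2 M" and I: "finite I"
    and u: "\<And>i. i \<in> I \<Longrightarrow> u i \<in> L2 M"
    and on: "\<And>i j. i \<in> I \<Longrightarrow> j \<in> I \<Longrightarrow> L2_inner M (u i) (u j) = (if i = j then 1 else 0)"
  shows "(\<Sum>i\<in>I. (L2_inner M (u i) f)\<^sup>2) \<le> L2_inner M f f"
proof -
  define p where "p = (\<lambda>x. \<Sum>i\<in>I. L2_inner M (u i) f * u i x)"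
  have L: "(\<lambda>x. L2_inner M (u i) f * u i x) \<in> L2 M" if "i \<in> I" for i by (intro L2_scale u that)
  have p: "p \<in> L2 M" unfolding p_def by (rule L2_sum[OF L])
  have fp: "L2_inner M f p = (\<Sum>i\<in>I. (L2_inner M (u i) f)\<^sup>2)"
  proof -
    have "L2_inner M f p = (\<Sum>i\<in>I. L2_inner M f (\<lambda>x. L2_inner M (u i) f * u i x))"
      unfolding p_def by (rule L2_inner_sum_right[OF f L])
    then show ?thesis
      by (simp add: L2_inner_scale_right power2_eq_square L2_inner_commute[of M f])
  qed
  have up: "L2_inner M (u i) p = L2_inner M (u i) f" if "i \<in> I" for i
  proof -
    have "L2_inner M (u i) p = (\<Sum>j\<in>I. L2_inner M (u i) (\<lambda>x. L2_inner M (u j) f * u j x))"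
      unfolding p_def by (rule L2_inner_sum_right[OF u[OF that] L])
    also have "\<dots> = (\<Sum>j\<in>I. if i = j then L2_inner M (u j) f else 0)"
      by (intro sum.cong refl) (use on that in \<open>auto simp: L2_inner_scale_right\<close>)
    finally show ?thesis using I that by simp
  qed
  have pp: "L2_inner M p p = (\<Sum>i\<in>I. (L2_inner M (u i) f)\<^sup>2)"
  proof -
    have "L2_inner M p p = (\<Sum>i\<in>I. L2_inner M (\<lambda>x. L2_inner M (u i) f * u i x) p)"
      by (subst (1) p_def, rule L2_inner_sum_left[OF p L])
    also have "\<dots> = (\<Sum>i\<in>I. (L2_inner M (u i) f)\<^sup>2)"
      by (intro sum.cong refl) (simp add: L2_inner_scale_left up power2_eq_square)
    finally show ?thesis .
  qed
  have "0 \<le> L2_inner M (\<lambda>x. f x + (-1) * p x) (\<lambda>x. f x + (-1) * p x)" by (rule L2_inner_self_nonneg)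
  also have "\<dots> = L2_inner M f f + 2 * (-1) * L2_inner M f p + (-1)\<^sup>2 * L2_inner M p p"
    by (rule L2_inner_line[OF f p])
  finally show ?thesis using fp pp by simp
qed

text \<open>Bessel's inequality for each row of the kernel, integrated over the rows. The bound is
  the same for all orthonormal families.\<close>

lemma (in sigma_finite_measure) kernel_Bessel:
  assumes A: "A \<in> L2 (M \<Otimes>\<^sub>M M)" and I: "finite I"
    and u: "\<And>i. i \<in> I \<Longrightarrow> u i \<in> L2 M"
    and on: "\<And>i j. i \<in> I \<Longrightarrow> j \<in> I \<Longrightarrow> L2_inner M (u i) (u j) = (if i = j then 1 else 0)"
  shows "(\<Sum>i\<in>I. L2_inner M (integral_op M A (u i)) (integral_op M A (u i))) \<le> L2_inner (M \<Otimes>\<^sub>M M) A A"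
proof -
  note L = integral_op_L2(1)[OF A u]
  have "(\<Sum>i\<in>I. L2_inner M (integral_op M A (u i)) (integral_op M A (u i)))
      = (\<integral>x. (\<Sum>i\<in>I. integral_op M A (u i) x * integral_op M A (u i) x) \<partial>M)"
    unfolding L2_inner_def
    by (rule Bochner_Integration.integral_sum[symmetric]) (rule L2_integrable_mult[OF L L])
  also have "\<dots> \<le> (\<integral>x. L2_inner M (\<lambda>y. A (x, y)) (\<lambda>y. A (x, y)) \<partial>M)"
  proof (rule integral_mono_AE)
    show "integrable M (\<lambda>x. \<Sum>i\<in>I. integral_op M A (u i) x * integral_op M A (u i) x)"
      by (intro Bochner_Integration.integrable_sum L2_integrable_mult L)
    show "integrable M (\<lambda>x. L2_inner M (\<lambda>y. A (x, y)) (\<lambda>y. A (x, y)))"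
      by (rule kernel_norm_rows(1)[OF A])
    show "AE x in M. (\<Sum>i\<in>I. integral_op M A (u i) x * integral_op M A (u i) x) \<le> L2_inner M (\<lambda>y. A (x, y)) (\<lambda>y. A (x, y))"
      using kernel_section_L2[OF A]
    proof eventually_elim
      case (elim x)
      then show ?case
        using Bessel[OF elim I u on] by (simp add: integral_op_eq_inner power2_eq_square L2_inner_commute)
    qed
  qed
  also have "\<dots> = L2_inner (M \<Otimes>\<^sub>M M) A A" by (rule kernel_norm_rows(2)[OF A])
  finally show ?thesis .
qed

text \<open>Sums over a countable orthonormal set become series over the natural numbers. Mutual
  orthogonality of the terms encodes that no element is listed twice.\<close>

lemma countable_orthonormal_enumeration:
  assumes D: "countable D" and on: "\<And>e f. e \<in> D \<Longrightarrow> f \<in> D \<Longrightarrow> L2_inner M e f = (if e = f then 1 else 0)"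
  shows "\<exists>u :: nat \<Rightarrow> 'a \<Rightarrow> real. (\<forall>n. u n \<in> D \<or> u n = (\<lambda>_. 0)) \<and> (\<forall>d\<in>D. \<exists>n. u n = d) \<and>
    (\<forall>m n. m \<noteq> n \<longrightarrow> L2_inner M (u m) (u n) = 0)"
proof -
  define u where "u n = (if n \<in> to_nat_on D ` D then from_nat_into D n else (\<lambda>_. 0))" for n
  have u: "u (to_nat_on D d) = d" if "d \<in> D" for d using D that by (simp add: u_def)
  have uD: "u n \<in> D \<or> u n = (\<lambda>_. 0)" for n
    using u unfolding u_def by (metis (no_types, lifting) imageE)
  have "L2_inner M (u m) (u n) = 0" if "m \<noteq> n" for m n
  proof (cases "m \<in> to_nat_on D ` D \<and> n \<in> to_nat_on D ` D")
    case True
    then obtain d e where de: "d \<in> D" "m = to_nat_on D d" "e \<in> D" "n = to_nat_on D e" by blast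
    then have "d \<noteq> e" using that by auto
    then show ?thesis using on[OF de(1,3)] u de by simp
  next
    case False
    then show ?thesis by (auto simp: u_def L2_inner_zero_left L2_inner_zero_right)
  qed
  with uD u show ?thesis by (intro exI[of _ u] conjI ballI allI impI) auto
qed

text \<open>Allowing \<open>u n = 0\<close> covers finite orthonormal systems.\<close>

lemma Fourier_series:
  assumes u: "\<And>n. u n \<in> L2 M" and "\<forall>m n. m \<noteq> n \<longrightarrow> L2_inner M (u m) (u n) = 0"
    and nrm: "\<And>n. u n = (\<lambda>_. 0) \<or> L2_inner M (u n) (u n) = 1" and f: "f \<in> L2 M"
  shows "\<exists>g\<in>L2 M. (\<lambda>N. L2_norm M (\<lambda>x. g x - (\<Sum>n<N. L2_inner M (u n) f * u n x))) \<longlonglongrightarrow> 0 \<and>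
    (\<forall>n. L2_inner M (u n) g = L2_inner M (u n) f) \<and>
    (\<forall>w\<in>L2 M. (\<forall>n. L2_inner M w (u n) = 0) \<longrightarrow> L2_inner M w g = 0)"
proof -
  note orth = assms(2)[rule_format]
  define v where "v n = (\<lambda>x. L2_inner M (u n) f * u n x)" for n
  have v: "v n \<in> L2 M" for n unfolding v_def by (rule L2_scale[OF u])
  have vv: "L2_inner M (v n) (v n) \<le> (L2_inner M (u n) f)\<^sup>2" for n
    using nrm[of n] unfolding v_def L2_inner_scale_left L2_inner_scale_right
    by (auto simp: power2_eq_square L2_inner_zero_left)
  have bnd: "(\<Sum>n<N. (L2_inner M (u n) f)\<^sup>2) \<le> L2_inner M f f" for N
  proof -
    let ?I = "{n\<in>{..<N}. u n \<noteq> (\<lambda>_. 0)}"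
    have "(\<Sum>n<N. (L2_inner M (u n) f)\<^sup>2) = (\<Sum>n\<in>?I. (L2_inner M (u n) f)\<^sup>2)"
      by (rule sum.mono_neutral_right) (auto simp: L2_inner_zero_left)
    also have "\<dots> \<le> L2_inner M f f"
      by (rule Bessel[OF f]) (use u orth nrm in auto)
    finally show ?thesis .
  qed
  have sm: "summable (\<lambda>n. (L2_inner M (u n) f)\<^sup>2)"
    by (rule summableI_nonneg_bounded[where x = "L2_inner M f f"]) (use bnd in auto)
  have smv: "summable (\<lambda>n. L2_inner M (v n) (v n))"
    by (rule summable_comparison_test'[OF sm, of 0]) (use vv in \<open>simp add: L2_inner_self_nonneg\<close>)
  have ov: "L2_inner M (v m) (v n) = 0" if "m \<noteq> n" for m n
    unfolding v_def L2_inner_scale_left L2_inner_scale_right using orth[OF that] by simp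
  obtain g where g: "g \<in> L2 M" "(\<lambda>N. L2_norm M (\<lambda>x. g x - (\<Sum>n<N. v n x))) \<longlonglongrightarrow> 0"
    using orthogonal_series[where u = v, OF v ov smv] .
  have lim: "(\<lambda>N. \<Sum>n<N. L2_inner M (u n) f * L2_inner M w (u n)) \<longlonglongrightarrow> L2_inner M w g" if w: "w \<in> L2 M" for w
  proof -
    have "(\<lambda>N. L2_inner M w (\<lambda>x. \<Sum>n<N. v n x)) \<longlonglongrightarrow> L2_inner M w g"
      by (rule L2_inner_tendsto[OF L2_sum[OF v] g(1) w g(2)])
    then show ?thesis
      unfolding L2_inner_sum_right[OF w v] by (simp add: v_def L2_inner_scale_right)
  qed
  show ?thesis
  proof (intro bexI[OF _ g(1)] conjI allI ballI impI)
    show "(\<lambda>N. L2_norm M (\<lambda>x. g x - (\<Sum>n<N. L2_inner M (u n) f * u n x))) \<longlonglongrightarrow> 0"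
      using g(2) unfolding v_def .
    fix k
    have "\<forall>\<^sub>F N in sequentially. (\<Sum>n<N. L2_inner M (u n) f * L2_inner M (u k) (u n)) = L2_inner M (u k) f"
      using eventually_gt_at_top[of k]
    proof eventually_elim
      case (elim N)
      have "(\<Sum>n<N. L2_inner M (u n) f * L2_inner M (u k) (u n)) = (\<Sum>n<N. if n = k then L2_inner M (u k) f else 0)"
      proof (rule sum.cong[OF refl])
        fix n
        show "L2_inner M (u n) f * L2_inner M (u k) (u n) = (if n = k then L2_inner M (u k) f else 0)"
          using orth[of k n] nrm[of k] by (auto simp: L2_inner_zero_left)
      qed
      then show ?case using elim by simp
    qed
    then have "(\<lambda>N. \<Sum>n<N. L2_inner M (u n) f * L2_inner M (u k) (u n)) \<longlonglongrightarrow> L2_inner M (u k) f"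
      by (rule tendsto_eventually)
    then show "L2_inner M (u k) g = L2_inner M (u k) f" using lim[OF u] LIMSEQ_unique by blast
  next
    fix w assume w: "w \<in> L2 M" "\<forall>n. L2_inner M w (u n) = 0"
    show "L2_inner M w g = 0" using lim[OF w(1)] by (simp add: w(2) LIMSEQ_const_iff)
  qed
qed

lemma bounded_operator_inner_tendsto:
  assumes T: "bounded_operator M T" and u: "\<And>n. u n \<in> L2 M" and f: "f \<in> L2 M" and g: "g \<in> L2 M"
    and lim: "(\<lambda>N. L2_norm M (\<lambda>x. f x - (\<Sum>n<N. a n * u n x))) \<longlonglongrightarrow> 0"
  shows "(\<lambda>N. \<Sum>n<N. a n * L2_inner M g (T (u n))) \<longlonglongrightarrow> L2_inner M g (T f)"
proof -
  obtain C where C: "\<And>f. f \<in> L2 M \<Longrightarrow> L2_norm M (T f) \<le> C * L2_norm M f"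
    using bounded_operator_bound[OF T] by metis
  note TL = bounded_operator_L2[OF T]
  define P where "P N = (\<lambda>x. \<Sum>n<N. a n * u n x)" for N
  have P: "P N \<in> L2 M" for N unfolding P_def by (intro L2_sum L2_scale u)
  have "(\<lambda>N. L2_norm M (\<lambda>x. T f x - T (P N) x)) \<longlonglongrightarrow> 0"
  proof (rule Lim_null_comparison)
    show "(\<lambda>N. C * L2_norm M (\<lambda>x. f x - P N x)) \<longlonglongrightarrow> 0"
      using tendsto_mult_left[OF lim, of C] by (simp add: P_def)
    have "L2_norm M (\<lambda>x. T f x - T (P N) x) \<le> C * L2_norm M (\<lambda>x. f x - P N x)" for N
    proof -
      have "L2_norm M (\<lambda>x. T f x - T (P N) x) = L2_norm M (T (\<lambda>x. f x - P N x))"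
        by (intro L2_norm_cong_AE L2_diff TL f P AE_symmetric[OF bounded_operator_diff] T)
      then show ?thesis using C[OF L2_diff[OF f P]] by simp
    qed
    then show "\<forall>\<^sub>F N in sequentially. norm (L2_norm M (\<lambda>x. T f x - T (P N) x)) \<le> C * L2_norm M (\<lambda>x. f x - P N x)"
      by (simp add: L2_norm_nonneg)
  qed
  then have "(\<lambda>N. L2_inner M g (T (P N))) \<longlonglongrightarrow> L2_inner M g (T f)"
    by (rule L2_inner_tendsto[OF TL[OF P] TL[OF f] g])
  moreover have "L2_inner M g (T (P N)) = (\<Sum>n<N. a n * L2_inner M g (T (u n)))" for N
  proof -
    have "L2_inner M g (T (P N)) = L2_inner M g (\<lambda>x. \<Sum>n<N. a n * T (u n) x)"
      unfolding P_def
      by (rule L2_inner_cong_AE[OF g TL[OF P[unfolded P_def]] g L2_sum[OF L2_scale[OF TL[OF u]]] AE_I2[OF refl]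
            bounded_operator_sum[OF T u]])
    also have "\<dots> = (\<Sum>n<N. a n * L2_inner M g (T (u n)))"
      using L2_inner_sum_right[OF g L2_scale[OF TL[OF u]]] by (simp add: L2_inner_scale_right)
    finally show ?thesis .
  qed
  ultimately show ?thesis by simp
qed

subsection \<open>Hilbert-Schmidt operators have square integrable kernels\<close>

context sigma_finite_measure
begin

lemma tensor_inner_tensor:
  assumes "f \<in> L2 M" "g \<in> L2 M" "f' \<in> L2 M" "g' \<in> L2 M"
  shows "L2_inner (M \<Otimes>\<^sub>M M) (tensor f g) (tensor f' g') = L2_inner M f f' * L2_inner M g g'"
proof -
  have "integral_op M (tensor f' g') g x = f' x * L2_inner M g' g" for x
    by (simp add: integral_op_def L2_inner_def mult.assoc)
  then have "integral_op M (tensor f' g') g = (\<lambda>x. L2_inner M g g' * f' x)"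
    by (simp add: fun_eq_iff L2_inner_commute[of M g'] mult.commute)
  then show ?thesis
    using tensor_inner_kernel(1)[OF tensor_L2(1)[OF assms(3,4)] assms(2,1)]
    by (simp add: L2_inner_scale_right)
qed

text \<open>Only countably many basis vectors have a nonzero image. Over an enumeration
  \<open>u\<close> of them, the tensors of \<open>T (u n)\<close> and \<open>u n\<close> are
  orthogonal with summable squared norms, and their sum is the kernel. The identity is tested
  against inner products, after splitting \<open>f\<close> into its projection onto these vectors
  and a rest on which \<open>T\<close> vanishes.\<close>

lemma hilbert_schmidt_imp_has_kernel:
  assumes "hilbert_schmidt M T"
  shows "\<exists>A. has_kernel M T A"
proof -
  obtain B where T: "bounded_operator M T" and B: "orthonormal_basis M B"
    and sm: "(\<lambda>e. (L2_norm M (T e))\<^sup>2) summable_on B"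
    using assms by (auto simp: hilbert_schmidt_def)
  note TL = bounded_operator_L2[OF T]
  have BL: "\<And>e. e \<in> B \<Longrightarrow> e \<in> L2 M"
    and on: "\<And>e f. e \<in> B \<Longrightarrow> f \<in> B \<Longrightarrow> L2_inner M e f = (if e = f then 1 else 0)"
    and compl: "\<And>g. g \<in> L2 M \<Longrightarrow> \<forall>e\<in>B. L2_inner M e g = 0 \<Longrightarrow> AE x in M. g x = 0"
    using B by (auto simp: orthonormal_basis_def)
  obtain C where C: "\<And>f. f \<in> L2 M \<Longrightarrow> L2_norm M (T f) \<le> C * L2_norm M f"
    using bounded_operator_bound[OF T] by metis
  define D0 where "D0 = {e\<in>B. (L2_norm M (T e))\<^sup>2 \<noteq> 0}"
  have c0: "countable D0" unfolding D0_def by (rule summable_countable_real[OF sm])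
  have on0: "L2_inner M e f = (if e = f then 1 else 0)" if "e \<in> D0" "f \<in> D0" for e f
    using on that by (simp add: D0_def)
  have "\<exists>u :: nat \<Rightarrow> 'a \<Rightarrow> real. (\<forall>n. u n \<in> D0 \<or> u n = (\<lambda>_. 0)) \<and> (\<forall>d\<in>D0. \<exists>n. u n = d) \<and>
      (\<forall>m n. m \<noteq> n \<longrightarrow> L2_inner M (u m) (u n) = 0)"
    by (rule countable_orthonormal_enumeration[OF c0 on0])
  then obtain u :: "nat \<Rightarrow> 'a \<Rightarrow> real" where u': "\<forall>n. u n \<in> D0 \<or> u n = (\<lambda>_. 0)" "\<forall>d\<in>D0. \<exists>n. u n = d"
      "\<forall>m n. m \<noteq> n \<longrightarrow> L2_inner M (u m) (u n) = 0"
    by (elim exE conjE)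
  note u = u'[rule_format]
  have uL: "u n \<in> L2 M" for n using u(1)[of n] BL L2_zero by (auto simp: D0_def)
  have un: "u n = (\<lambda>_. 0) \<or> L2_inner M (u n) (u n) = 1" for n using u(1)[of n] on0 by auto
  define k where "k n = tensor (T (u n)) (u n)" for n
  have kL: "k n \<in> L2 (M \<Otimes>\<^sub>M M)" for n unfolding k_def by (intro tensor_L2 TL uL)
  have kk: "L2_inner (M \<Otimes>\<^sub>M M) (k m) (k n) = L2_inner M (T (u m)) (T (u n)) * L2_inner M (u m) (u n)" for m n
    unfolding k_def by (intro tensor_inner_tensor TL uL)
  have z: "L2_inner M (u n) (u n) = 0" if "u n \<notin> D0" for n
    using u(1)[of n] that by (auto simp: L2_inner_zero_left)
  have z1: "L2_inner M (u n) (u n) = 1" if "u n \<in> D0" for n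
    using on0[OF that that] by simp
  have "(\<Sum>n<N. L2_inner (M \<Otimes>\<^sub>M M) (k n) (k n)) \<le> (\<Sum>\<^sub>\<infinity>e\<in>B. (L2_norm M (T e))\<^sup>2)" for N
  proof -
    let ?Z = "{n\<in>{..<N}. u n \<in> D0}"
    have "(\<Sum>n<N. L2_inner (M \<Otimes>\<^sub>M M) (k n) (k n)) = (\<Sum>n\<in>?Z. L2_inner (M \<Otimes>\<^sub>M M) (k n) (k n))"
      by (rule sum.mono_neutral_right) (auto simp: kk z)
    also have "\<dots> = (\<Sum>n\<in>?Z. (L2_norm M (T (u n)))\<^sup>2)"
      by (rule sum.cong) (auto simp: kk L2_norm_power2 z1)
    also have "\<dots> = (\<Sum>e\<in>u ` ?Z. (L2_norm M (T e))\<^sup>2)"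
    proof -
      have "inj_on u ?Z"
      proof (rule inj_onI)
        fix m n assume "m \<in> ?Z" "n \<in> ?Z" "u m = u n"
        then show "m = n" using u(3)[of m n] z1[of n] by (cases "m = n") auto
      qed
      then show ?thesis by (simp add: sum.reindex)
    qed
    also have "\<dots> \<le> (\<Sum>\<^sub>\<infinity>e\<in>B. (L2_norm M (T e))\<^sup>2)"
      by (rule finite_sum_le_infsum[OF sm]) (auto simp: D0_def)
    finally show ?thesis .
  qed
  then have ks: "summable (\<lambda>n. L2_inner (M \<Otimes>\<^sub>M M) (k n) (k n))"
    by (intro summableI_nonneg_bounded[where x = "\<Sum>\<^sub>\<infinity>e\<in>B. (L2_norm M (T e))\<^sup>2"]) (auto simp: L2_inner_self_nonneg)
  have ko: "L2_inner (M \<Otimes>\<^sub>M M) (k m) (k n) = 0" if "m \<noteq> n" for m n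
    using u(3)[OF that] by (simp add: kk)
  obtain A where A: "A \<in> L2 (M \<Otimes>\<^sub>M M)" "(\<lambda>N. L2_norm (M \<Otimes>\<^sub>M M) (\<lambda>x. A x - (\<Sum>n<N. k n x))) \<longlonglongrightarrow> 0"
    using orthogonal_series[where u = k, OF kL ko ks] .
  have main: "L2_inner M g (T f) = L2_inner M g (integral_op M A f)" if f: "f \<in> L2 M" and g: "g \<in> L2 M" for f g
  proof -
    have "(\<lambda>N. L2_inner (M \<Otimes>\<^sub>M M) (tensor g f) (\<lambda>x. \<Sum>n<N. k n x)) \<longlonglongrightarrow> L2_inner (M \<Otimes>\<^sub>M M) (tensor g f) A"
      by (rule L2_inner_tendsto[OF L2_sum[OF kL] A(1) tensor_L2(1)[OF g f] A(2)])
    moreover have "L2_inner (M \<Otimes>\<^sub>M M) (tensor g f) (\<lambda>x. \<Sum>n<N. k n x) = (\<Sum>n<N. L2_inner M (u n) f * L2_inner M g (T (u n)))" for N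
    proof -
      have "L2_inner (M \<Otimes>\<^sub>M M) (tensor g f) (\<lambda>x. \<Sum>n<N. k n x) = (\<Sum>n<N. L2_inner (M \<Otimes>\<^sub>M M) (tensor g f) (k n))"
        by (rule L2_inner_sum_right[OF tensor_L2(1)[OF g f] kL])
      then show ?thesis
        by (simp add: k_def tensor_inner_tensor[OF g f TL[OF uL] uL] L2_inner_commute[of M f] mult.commute)
    qed
    ultimately have lim1: "(\<lambda>N. \<Sum>n<N. L2_inner M (u n) f * L2_inner M g (T (u n))) \<longlonglongrightarrow> L2_inner M g (integral_op M A f)"
      using tensor_inner_kernel(1)[OF A(1) f g] by simp
    \<comment> \<open>\<open>f'\<close> is the projection of \<open>f\<close> onto the closed span
      of \<open>D0\<close>; both operators agree weakly on this part by termwise comparison.\<close>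
    obtain f' where f': "f' \<in> L2 M"
      "(\<lambda>N. L2_norm M (\<lambda>x. f' x - (\<Sum>n<N. L2_inner M (u n) f * u n x))) \<longlonglongrightarrow> 0"
      "\<forall>n. L2_inner M (u n) f' = L2_inner M (u n) f"
      using Fourier_series[where u = u, OF uL u'(3) un f] by (elim bexE conjE)
    have lim2: "(\<lambda>N. \<Sum>n<N. L2_inner M (u n) f * L2_inner M g (T (u n))) \<longlonglongrightarrow> L2_inner M g (T f')"
      by (rule bounded_operator_inner_tendsto[OF T uL f'(1) g f'(2)])
    have e1: "L2_inner M g (T f') = L2_inner M g (integral_op M A f)" by (rule LIMSEQ_unique[OF lim2 lim1])
    define h where "h = (\<lambda>x. f x - f' x)"
    have h: "h \<in> L2 M" unfolding h_def by (rule L2_diff[OF f f'(1)])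
    have h0: "L2_inner M d h = 0" if d: "d \<in> D0" for d
    proof -
      obtain n where "u n = d" using u(2)[OF d] by blast
      then show ?thesis unfolding h_def using L2_inner_diff_right[OF uL f f'(1), of n] f'(3)[rule_format, of n] by simp
    qed
    \<comment> \<open>By Bessel only countably many basis vectors have a nonzero coefficient in
      \<open>h\<close>. None of them lies in \<open>D0\<close>, so \<open>T\<close> maps each of
      them to 0, and \<open>T h = 0\<close> can be derived from a series even if the basis is
      uncountable.\<close>
    define D1 where "D1 = {e\<in>B. (L2_inner M e h)\<^sup>2 \<noteq> 0}"
    have "(\<lambda>e. (L2_inner M e h)\<^sup>2) summable_on B"
    proof (rule nonneg_bdd_above_summable_on)
      show "bdd_above (sum (\<lambda>e. (L2_inner M e h)\<^sup>2) ` {F. F \<subseteq> B \<and> finite F})"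
      proof (rule bdd_aboveI2)
        fix F assume "F \<in> {F. F \<subseteq> B \<and> finite F}"
        then have F: "finite F" "F \<subseteq> B" by auto
        show "sum (\<lambda>e. (L2_inner M e h)\<^sup>2) F \<le> L2_inner M h h"
          by (rule Bessel[OF h F(1), where u = "\<lambda>e. e"]) (rule BL[OF subsetD[OF F(2)]] on[OF subsetD[OF F(2)] subsetD[OF F(2)]], assumption+)+
      qed
    qed auto
    then have c1: "countable D1" unfolding D1_def by (rule summable_countable_real)
    have on1: "L2_inner M e f = (if e = f then 1 else 0)" if "e \<in> D1" "f \<in> D1" for e f
      using on that by (simp add: D1_def)
    have "\<exists>u :: nat \<Rightarrow> 'a \<Rightarrow> real. (\<forall>n. u n \<in> D1 \<or> u n = (\<lambda>_. 0)) \<and> (\<forall>d\<in>D1. \<exists>n. u n = d) \<and>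
        (\<forall>m n. m \<noteq> n \<longrightarrow> L2_inner M (u m) (u n) = 0)"
      by (rule countable_orthonormal_enumeration[OF c1 on1])
    then obtain w :: "nat \<Rightarrow> 'a \<Rightarrow> real" where w': "\<forall>n. w n \<in> D1 \<or> w n = (\<lambda>_. 0)" "\<forall>d\<in>D1. \<exists>n. w n = d"
        "\<forall>m n. m \<noteq> n \<longrightarrow> L2_inner M (w m) (w n) = 0"
      by (elim exE conjE)
    note w = w'[rule_format]
    have wL: "w n \<in> L2 M" for n using w(1)[of n] BL L2_zero by (auto simp: D1_def)
    have wn: "w n = (\<lambda>_. 0) \<or> L2_inner M (w n) (w n) = 1" for n using w(1)[of n] on1 by auto
    obtain h' where h': "h' \<in> L2 M"
      "(\<lambda>N. L2_norm M (\<lambda>x. h' x - (\<Sum>n<N. L2_inner M (w n) h * w n x))) \<longlonglongrightarrow> 0"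
      "\<forall>n. L2_inner M (w n) h' = L2_inner M (w n) h"
      "\<forall>v\<in>L2 M. (\<forall>n. L2_inner M v (w n) = 0) \<longrightarrow> L2_inner M v h' = 0"
      using Fourier_series[where u = w, OF wL w'(3) wn h] by (elim bexE conjE)
    have "L2_norm M (T (w n)) = 0" for n
    proof (cases "w n \<in> D1")
      case True
      then have "L2_inner M (w n) h \<noteq> 0" "w n \<in> B" by (simp_all add: D1_def)
      moreover from this have "w n \<notin> D0" using h0[of "w n"] by blast
      ultimately show ?thesis by (simp add: D0_def)
    next
      case False
      then have "w n = (\<lambda>_. 0)" using w(1) by blast
      then show ?thesis using C[OF wL[of n]] L2_norm_nonneg[of M "T (w n)"] by (simp add: L2_norm_zero)
    qed
    then have "L2_inner M g (T (w n)) = 0" for n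
      using L2_Cauchy_Schwarz[OF g TL[OF wL[of n]]] by simp
    then have Th': "L2_inner M g (T h') = 0"
      using bounded_operator_inner_tendsto[OF T wL h'(1) g h'(2)] by (simp add: LIMSEQ_const_iff)
    \<comment> \<open>\<open>h\<close> and its expansion \<open>h'\<close> have the same
      coefficients against the whole basis, so they agree by completeness.\<close>
    have "AE x in M. h x - h' x = 0"
    proof (rule compl[OF L2_diff[OF h h'(1)]], rule ballI)
      fix e assume e: "e \<in> B"
      have "L2_inner M e h' = L2_inner M e h"
      proof (cases "e \<in> D1")
        case True
        then obtain n where "w n = e" using w(2) by blast
        then show ?thesis using h'(3)[rule_format, of n] by simp
      next
        case False
        then have "L2_inner M e h = 0" using e by (simp add: D1_def)
        moreover have "L2_inner M e (w n) = 0" for n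
        proof (cases "w n \<in> D1")
          case True
          then have "w n \<in> B" "e \<noteq> w n" using False by (auto simp: D1_def)
          then show ?thesis using on[OF e, of "w n"] by simp
        next
          case False
          then show ?thesis using w(1)[of n] by (simp add: L2_inner_zero_right)
        qed
        then have "\<forall>n. L2_inner M e (w n) = 0" by blast
        then have "L2_inner M e h' = 0" using h'(4) BL[OF e] by blast
        ultimately show ?thesis by simp
      qed
      then show "L2_inner M e (\<lambda>x. h x - h' x) = 0"
        using L2_inner_diff_right[OF BL[OF e] h h'(1)] by simp
    qed
    then have "AE x in M. h x = h' x" by simp
    then have "AE x in M. T h x = T h' x" by (rule bounded_operator_cong[OF T h h'(1)])
    then have "L2_inner M g (T h) = L2_inner M g (T h')"
      by (rule L2_inner_cong_AE[OF g TL[OF h] g TL[OF h'(1)] AE_I2[OF refl]])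
    moreover have "L2_inner M g (T h) = L2_inner M g (\<lambda>x. T f x - T f' x)"
      unfolding h_def
      by (rule L2_inner_cong_AE[OF g TL[OF L2_diff[OF f f'(1)]] g L2_diff[OF TL[OF f] TL[OF f'(1)]] AE_I2[OF refl]
            bounded_operator_diff[OF T f f'(1)]])
    ultimately show ?thesis
      using L2_inner_diff_right[OF g TL[OF f] TL[OF f'(1)]] e1 Th' by simp
  qed
  have "op_eq M T (integral_op M A)"
    unfolding op_eq_def
  proof
    fix f assume f: "f \<in> L2 M"
    show "AE x in M. T f x = integral_op M A f x"
      by (rule L2_inner_eq_imp_AE_eq[OF TL[OF f] integral_op_L2(1)[OF A(1) f] main[OF f]])
  qed
  with A(1) show ?thesis by (auto simp: has_kernel_def)
qed

lemma has_kernel_imp_hilbert_schmidt: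
  assumes T: "bounded_operator M T" and k: "has_kernel M T A"
  shows "hilbert_schmidt M T"
proof -
  have A: "A \<in> L2 (M \<Otimes>\<^sub>M M)" and eq: "op_eq M T (integral_op M A)" using k by (auto simp: has_kernel_def)
  obtain B where B: "orthonormal_basis M B" using orthonormal_basis_exists by blast
  then have BL: "\<And>e. e \<in> B \<Longrightarrow> e \<in> L2 M"
    and on: "\<And>e f. e \<in> B \<Longrightarrow> f \<in> B \<Longrightarrow> L2_inner M e f = (if e = f then 1 else 0)"
    by (auto simp: orthonormal_basis_def)
  have n: "(L2_norm M (T e))\<^sup>2 = L2_inner M (integral_op M A e) (integral_op M A e)" if "e \<in> B" for e
  proof -
    have "L2_norm M (T e) = L2_norm M (integral_op M A e)"
      using eq BL[OF that] by (intro L2_norm_cong_AE bounded_operator_L2[OF T] integral_op_L2(1)[OF A]) (auto simp: op_eq_def)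
    then show ?thesis by (simp add: L2_norm_power2)
  qed
  have "(\<lambda>e. (L2_norm M (T e))\<^sup>2) summable_on B"
  proof (rule nonneg_bdd_above_summable_on)
    show "bdd_above (sum (\<lambda>e. (L2_norm M (T e))\<^sup>2) ` {F. F \<subseteq> B \<and> finite F})"
    proof (rule bdd_aboveI2)
      fix F assume "F \<in> {F. F \<subseteq> B \<and> finite F}"
      then have F: "finite F" "F \<subseteq> B" by auto
      have "sum (\<lambda>e. (L2_norm M (T e))\<^sup>2) F = (\<Sum>e\<in>F. L2_inner M (integral_op M A e) (integral_op M A e))"
        by (rule sum.cong) (use n F in auto)
      also have "\<dots> \<le> L2_inner (M \<Otimes>\<^sub>M M) A A"
        by (rule kernel_Bessel[OF A F(1), where u = "\<lambda>e. e"]) (rule BL[OF subsetD[OF F(2)]] on[OF subsetD[OF F(2)] subsetD[OF F(2)]], assumption+)+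
      finally show "sum (\<lambda>e. (L2_norm M (T e))\<^sup>2) F \<le> L2_inner (M \<Otimes>\<^sub>M M) A A" .
    qed
  qed auto
  with T B show ?thesis by (auto simp: hilbert_schmidt_def)
qed

end

subsection \<open>Uniqueness of kernels\<close>

lemma indicator_L2:
  assumes "X \<in> sets M" "emeasure M X < \<infinity>"
  shows "(indicator X :: _ \<Rightarrow> real) \<in> L2 M"
proof -
  have "integrable M (indicator X :: _ \<Rightarrow> real)" using assms by (rule integrable_real_indicator)
  moreover have "(\<lambda>x. (indicator X x :: real)\<^sup>2) = indicator X" by (auto simp: indicator_def)
  ultimately show ?thesis using assms(1) by (simp add: L2_def)
qed

text \<open>Tensors of indicators show that the integral over every bounded rectangle is 0.
  Rectangles are stable under intersection and generate the product sigma-algebra, so the integral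
  over every measurable set is 0 and the density vanishes.\<close>

lemma kernel_eq_0_AE:
  fixes A :: "real \<times> real \<Rightarrow> real"
  assumes A: "A \<in> L2 (lborel \<Otimes>\<^sub>M lborel)"
    and orth: "\<And>f g. f \<in> L2 lborel \<Longrightarrow> g \<in> L2 lborel \<Longrightarrow> L2_inner (lborel \<Otimes>\<^sub>M lborel) (tensor f g) A = 0"
  shows "AE p in lborel \<Otimes>\<^sub>M lborel. A p = 0"
proof -
  let ?N = "lborel \<Otimes>\<^sub>M lborel :: (real \<times> real) measure"
  define I where "I n = {- real n..real n}" for n :: nat
  have IL: "(indicator (I n \<inter> X) :: real \<Rightarrow> real) \<in> L2 lborel" if "X \<in> sets lborel" for n X
  proof (rule indicator_L2)
    show "I n \<inter> X \<in> sets lborel" using that by (simp add: I_def)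
    have "emeasure lborel (I n \<inter> X) \<le> emeasure lborel (I n)" by (rule emeasure_mono) (auto simp: I_def)
    also have "\<dots> < \<infinity>" by (simp add: I_def)
    finally show "emeasure lborel (I n \<inter> X) < \<infinity>" .
  qed
  \<comment> \<open>A square integrable kernel need not be integrable over the plane; cut off to a
    bounded square it is.\<close>
  define h where "h n p = tensor (indicator (I n)) (indicator (I n)) p * A p" for n p
  have hint: "integrable ?N (h n)" for n
    unfolding h_def using IL[of UNIV n] lborel.tensor_L2(1)[of "indicator (I n)" "indicator (I n)"]
    by (intro L2_integrable_mult A) simp
  have "AE p in ?N. h n p = 0" for n
  proof (rule sigma_finite_measure.density_zero[OF sigma_finite_pair_measure[OF
          lborel.sigma_finite_measure_axioms lborel.sigma_finite_measure_axioms] hint])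
    fix D assume "D \<in> sets ?N"
    then have "D \<in> sigma_sets (space lborel \<times> space lborel) {a \<times> b |a b. a \<in> sets lborel \<and> b \<in> sets lborel}"
      by (simp add: sets_pair_measure)
    with Int_stable_pair_measure_generator[of lborel lborel] pair_measure_closed[of lborel lborel]
    show "set_lebesgue_integral ?N D (h n) = 0"
    proof (induction D rule: sigma_sets_induct_disjoint)
      case (basic D)
      then obtain a b where ab: "D = a \<times> b" "a \<in> sets lborel" "b \<in> sets lborel" by blast
      have "set_lebesgue_integral ?N D (h n) = L2_inner ?N (tensor (indicator (I n \<inter> a)) (indicator (I n \<inter> b))) A"
        unfolding set_lebesgue_integral_def L2_inner_def
        by (rule Bochner_Integration.integral_cong) (auto simp: h_def ab indicator_def)
      also have "\<dots> = 0" by (rule orth[OF IL[OF ab(2)] IL[OF ab(3)]])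
      finally show ?case .
    next
      case empty
      show ?case unfolding set_lebesgue_integral_def by simp
    next
      case (compl D)
      then have D: "D \<in> sets ?N" by (simp add: sets_pair_measure)
      have "integral\<^sup>L ?N (h n) = L2_inner ?N (tensor (indicator (I n \<inter> UNIV)) (indicator (I n \<inter> UNIV))) A"
        unfolding L2_inner_def by (rule Bochner_Integration.integral_cong) (auto simp: h_def)
      also have "\<dots> = 0" by (rule orth[OF IL IL]) auto
      finally have t: "integral\<^sup>L ?N (h n) = 0" .
      have "set_lebesgue_integral ?N (space lborel \<times> space lborel - D) (h n) = (\<integral>p. h n p - indicator D p * h n p \<partial>?N)"
        unfolding set_lebesgue_integral_def by (rule Bochner_Integration.integral_cong) (auto simp: indicator_def)
      also have "\<dots> = (\<integral>p. h n p \<partial>?N) - (\<integral>p. indicator D p * h n p \<partial>?N)"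
        using hint[of n] integrable_mult_indicator[OF D hint[of n]] by (intro Bochner_Integration.integral_diff) auto
      finally show ?case using t compl(2) by (simp add: set_lebesgue_integral_def)
    next
      case (union D)
      then have D: "D i \<in> sets ?N" for i using union(2) by (auto simp: sets_pair_measure)
      have "set_lebesgue_integral ?N (\<Union>i. D i) (h n) = (\<Sum>i. set_lebesgue_integral ?N (D i) (h n))"
      proof (rule lebesgue_integral_countable_add[OF D])
        show "D i \<inter> D j = {}" if "i \<noteq> j" for i j using union(1) that by (auto simp: disjoint_family_on_def)
        show "set_integrable ?N (\<Union>i. D i) (h n)"
          unfolding set_integrable_def by (rule integrable_mult_indicator[OF _ hint]) (use D in blast)
      qed
      then show ?case by (simp add: union(3))
    qed
  qed
  then have "AE p in ?N. \<forall>n. h n p = 0" by (simp add: AE_all_countable)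
  then show ?thesis
  proof eventually_elim
    case (elim p)
    obtain n :: nat where n: "\<bar>fst p\<bar> + \<bar>snd p\<bar> \<le> real n" using real_arch_simple by blast
    then have "fst p \<in> I n" "snd p \<in> I n" by (auto simp: I_def)
    then have "h n p = A p" by (simp add: h_def tensor_def split_def)
    then show ?case using elim by simp
  qed
qed

lemma integral_op_eq_imp_kernel_eq:
  fixes A B :: "real \<times> real \<Rightarrow> real"
  assumes A: "A \<in> L2 (lborel \<Otimes>\<^sub>M lborel)" and B: "B \<in> L2 (lborel \<Otimes>\<^sub>M lborel)"
    and eq: "op_eq lborel (integral_op lborel A) (integral_op lborel B)"
  shows "AE p in lborel \<Otimes>\<^sub>M lborel. A p = B p"
proof -
  have "AE p in lborel \<Otimes>\<^sub>M lborel. A p - B p = 0"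
  proof (rule kernel_eq_0_AE[OF L2_diff[OF A B]])
    fix f g :: "real \<Rightarrow> real" assume fg: "f \<in> L2 lborel" "g \<in> L2 lborel"
    have "L2_inner lborel f (integral_op lborel A g) = L2_inner lborel f (integral_op lborel B g)"
      using eq fg by (intro L2_inner_cong_AE lborel.integral_op_L2 A B) (auto simp: op_eq_def)
    then show "L2_inner (lborel \<Otimes>\<^sub>M lborel) (tensor f g) (\<lambda>p. A p - B p) = 0"
      using L2_inner_diff_right[OF lborel.tensor_L2(1)[OF fg] A B]
      by (simp add: lborel.tensor_inner_kernel(1)[OF A fg(2,1)] lborel.tensor_inner_kernel(1)[OF B fg(2,1)])
  qed
  then show ?thesis by simp
qed

section \<open>Volterra kernels\<close>

definition lower_kernel :: "(real \<times> real \<Rightarrow> real) \<Rightarrow> bool" where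
  "lower_kernel A \<longleftrightarrow> A \<in> L2 (lborel \<Otimes>\<^sub>M lborel) \<and>
     (AE (x, y) in lborel \<Otimes>\<^sub>M lborel. x < y \<longrightarrow> A (x, y) = 0)"

lemma AE_lborel_swap:
  fixes P :: "real \<times> real \<Rightarrow> bool"
  assumes "AE p in lborel \<Otimes>\<^sub>M lborel. P p"
  shows "AE p in lborel \<Otimes>\<^sub>M lborel. P (snd p, fst p)"
proof -
  have "AE p in distr (lborel \<Otimes>\<^sub>M lborel) (lborel \<Otimes>\<^sub>M lborel) (\<lambda>(x, y). (y, x)). P p"
    by (rule subst[where P = "\<lambda>N. AE p in N. P p", OF lborel_pair.distr_pair_swap assms])
  then have "AE p in lborel \<Otimes>\<^sub>M lborel. P (case p of (x, y) \<Rightarrow> (y, x))"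
    by (rule AE_distrD[OF measurable_pair_swap'])
  then show ?thesis by (simp add: split_def)
qed

lemma AE_lborel_pair:
  fixes P :: "real \<times> real \<Rightarrow> bool"
  assumes "AE p in lborel \<Otimes>\<^sub>M lborel. P p"
  shows "AE x in lborel. AE y in lborel. P (x, y)" "AE y in lborel. AE x in lborel. P (x, y)"
proof -
  show "AE x in lborel. AE y in lborel. P (x, y)" by (rule lborel_pair.AE_pair[OF assms])
  have "AE y in lborel. AE x in lborel. P (snd (y, x), fst (y, x))"
    by (rule lborel_pair.AE_pair[OF AE_lborel_swap[OF assms]])
  then show "AE y in lborel. AE x in lborel. P (x, y)" by simp
qed

text \<open>Each row meets the diagonal in one point. The triangularity conditions leave the
  diagonal open, so this null set has to be discarded separately.\<close>

lemma AE_lborel_pair_offdiag: "AE p in lborel \<Otimes>\<^sub>M (lborel :: real measure). fst p \<noteq> (snd p :: real)"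
proof -
  have "{p \<in> space (lborel \<Otimes>\<^sub>M (lborel :: real measure)). fst p \<noteq> (snd p :: real)} \<in> sets (lborel \<Otimes>\<^sub>M lborel)"
    by measurable
  moreover have "AE y in lborel. fst (x, y) \<noteq> snd (x, y)" for x :: real
    using AE_lborel_singleton[of x] by eventually_elim simp
  then have "AE x in lborel. AE y in lborel. fst (x, y) \<noteq> snd (x, y :: real)" by simp
  ultimately show ?thesis by (rule lborel_pair.AE_pair_measure)
qed

text \<open>A Gronwall argument: with \<open>F x = \<integral>\<^bsub>(-\<infinity>,x)\<^esub> f\<^sup>2\<close> and \<open>a x\<close> the squared norm of the row \<open>A(x, \<cdot>)\<close>,
  Cauchy-Schwarz gives \<open>F x \<le> \<integral>\<^bsub>(-\<infinity>,x)\<^esub> a F\<close>. So \<open>F x \<le> F x \<integral>\<^bsub>(s,x)\<^esub> a\<close> whenever \<open>F\<close> vanishes up to \<open>s\<close>.\<close>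

lemma volterra_injective_below:
  assumes A: "lower_kernel A" and f: "f \<in> L2 lborel"
    and eq: "AE x in lborel. x < y \<longrightarrow> f x + integral_op lborel A f x = 0"
  shows "AE x in lborel. x < y \<longrightarrow> f x = 0"
proof -
  have AL: "A \<in> L2 (lborel \<Otimes>\<^sub>M lborel)" and A0: "AE p in lborel \<Otimes>\<^sub>M lborel. fst p < snd p \<longrightarrow> A p = 0"
    using A by (auto simp: lower_kernel_def split_def)
  define a where "a x = L2_inner lborel (\<lambda>z. A (x, z)) (\<lambda>z. A (x, z))" for x
  have ai: "integrable lborel a" unfolding a_def by (rule lborel.kernel_norm_rows(1)[OF AL])
  have a0: "0 \<le> a x" for x by (simp add: a_def L2_inner_self_nonneg)
  define F where "F x = (\<integral>z. indicator {..<x} z * (f z)\<^sup>2 \<partial>lborel)" for x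
  have f2: "integrable lborel (\<lambda>z. indicator {..<x} z * (f z)\<^sup>2)" for x
    using integrable_mult_indicator[OF _ L2_integrable_square[OF f], of "{..<x}"] by simp
  have F0: "0 \<le> F x" for x by (simp add: F_def)
  have Fmono: "F x \<le> F x'" if "x \<le> x'" for x x'
    unfolding F_def by (rule integral_mono[OF f2 f2]) (use that in \<open>auto simp: indicator_def\<close>)
  have cut: "(\<lambda>z. indicator {..<x} z * f z) \<in> L2 lborel" for x
  proof -
    have [measurable]: "f \<in> borel_measurable lborel" by (rule L2_measurable[OF f])
    have "(\<lambda>z. (indicator {..<x} z * f z)\<^sup>2) = (\<lambda>z. indicator {..<x} z * (f z)\<^sup>2)"
      by (auto simp: indicator_def)
    then show ?thesis using f2[of x] unfolding L2_def mem_Collect_eq by (intro conjI) simp_all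
  qed
  have F_norm: "L2_inner lborel (\<lambda>z. indicator {..<x} z * f z) (\<lambda>z. indicator {..<x} z * f z) = F x" for x
    unfolding F_def L2_inner_def
    by (rule Bochner_Integration.integral_cong) (auto simp: indicator_def power2_eq_square)
  \<comment> \<open>The row of \<open>A\<close> at x vanishes beyond x, so \<open>f\<close> may be
    cut off at x before Cauchy-Schwarz is applied.\<close>
  have le: "AE x in lborel. x < y \<longrightarrow> (f x)\<^sup>2 \<le> a x * F x"
    using eq lborel.kernel_section_L2[OF AL] AE_lborel_pair(1)[OF A0]
  proof eventually_elim
    case (elim x)
    show ?case
    proof
      assume "x < y"
      then have "f x = - L2_inner lborel (\<lambda>z. A (x, z)) f"
        using elim(1) by (simp add: integral_op_eq_inner)
      also have "L2_inner lborel (\<lambda>z. A (x, z)) f = L2_inner lborel (\<lambda>z. A (x, z)) (\<lambda>z. indicator {..<x} z * f z)"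
        unfolding L2_inner_def
      proof (rule integral_cong_AE)
        show "AE z in lborel. A (x, z) * f z = A (x, z) * (indicator {..<x} z * f z)"
          using elim(3) AE_lborel_singleton[of x]
          by eventually_elim (auto simp: indicator_def)
      qed (use elim(2) f cut[of x] in \<open>auto dest!: L2_measurable\<close>)
      finally have "\<bar>f x\<bar> \<le> L2_norm lborel (\<lambda>z. A (x, z)) * L2_norm lborel (\<lambda>z. indicator {..<x} z * f z)"
        using L2_Cauchy_Schwarz[OF elim(2) cut[of x]] by simp
      then have "\<bar>f x\<bar>\<^sup>2 \<le> (L2_norm lborel (\<lambda>z. A (x, z)) * L2_norm lborel (\<lambda>z. indicator {..<x} z * f z))\<^sup>2"
        by (intro power_mono) auto
      then show "(f x)\<^sup>2 \<le> a x * F x"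
        by (simp add: power_mult_distrib L2_norm_power2 F_norm a_def)
    qed
  qed
  have F_zero: "AE z in lborel. z < s \<longrightarrow> f z = 0" if "F s = 0" for s
  proof -
    have "AE z in lborel. 0 \<le> indicator {..<s} z * (f z)\<^sup>2" by simp
    from integral_nonneg_eq_0_iff_AE[OF f2 this] that
    have "AE z in lborel. indicator {..<s} z * (f z)\<^sup>2 = 0" unfolding F_def by blast
    then show ?thesis
    proof eventually_elim
      case (elim z)
      show ?case
      proof
        assume "z < s"
        then have "(f z)\<^sup>2 = 0" using elim by (simp add: indicator_def)
        then show "f z = 0" by simp
      qed
    qed
  qed
  define \<alpha> where "\<alpha> s x = (\<integral>z. indicator {s<..<x} z * a z \<partial>lborel)" for s x :: real
  have ia: "integrable lborel (\<lambda>z. indicator X z * a z)" if "X \<in> sets lborel" for X :: "real set"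
    using integrable_mult_indicator[OF that ai] by simp
  have step: "F x \<le> F x * \<alpha> s x" if s: "s \<le> x" "x \<le> y" "F s = 0" for s x
  proof -
    have z: "AE z in lborel. z < s \<longrightarrow> f z = 0" by (rule F_zero[OF s(3)])
    have "F x \<le> (\<integral>z. F x * (indicator {s<..<x} z * a z) \<partial>lborel)"
      unfolding F_def
    proof (rule integral_mono_AE[OF f2])
      show "integrable lborel (\<lambda>z. (\<integral>z. indicator {..<x} z * (f z)\<^sup>2 \<partial>lborel) * (indicator {s<..<x} z * a z))"
        by (intro integrable_mult_right ia) simp
      show "AE z in lborel. indicator {..<x} z * (f z)\<^sup>2 \<le> (\<integral>z. indicator {..<x} z * (f z)\<^sup>2 \<partial>lborel) * (indicator {s<..<x} z * a z)"
        unfolding F_def[symmetric]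
        using le z AE_lborel_singleton[of s]
      proof eventually_elim
        case (elim t)
        consider "t < s" | "s < t" "t < x" | "x \<le> t" using elim(3) by linarith
        then show ?case
        proof cases
          case 1 then show ?thesis using elim(2) by (simp add: indicator_def F0 a0)
        next
          case 2
          then have "(f t)\<^sup>2 \<le> a t * F t" using elim(1) s by auto
          also have "\<dots> \<le> a t * F x" using 2 by (intro mult_left_mono Fmono a0) auto
          finally show ?thesis using 2 by (simp add: indicator_def mult.commute)
        next
          case 3 then show ?thesis by (simp add: indicator_def)
        qed
      qed
    qed
    also have "\<dots> = F x * \<alpha> s x" unfolding \<alpha>_def by simp
    finally show ?thesis .
  qed
  have zero: "F x = 0" if "s \<le> x" "x \<le> y" "F s = 0" "\<alpha> s x < 1" for s x
  proof (rule ccontr)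
    assume "F x \<noteq> 0"
    then have "F x > 0" using F0[of x] by simp
    then have "F x * \<alpha> s x < F x * 1" using that(4) by (intro mult_strict_left_mono)
    with step[OF that(1-3)] show False by simp
  qed
  \<comment> \<open>Start of a continuation argument: far to the left the total mass of
    \<open>a\<close> is below 1, which forces \<open>F\<close> to vanish up to some
    \<open>s0\<close>.\<close>
  have tail: "(\<lambda>n. \<integral>z. indicator {..<- real n} z * a z \<partial>lborel) \<longlonglongrightarrow> 0"
  proof -
    have "(\<lambda>n. \<integral>z. indicator {..<- real n} z * a z \<partial>lborel) \<longlonglongrightarrow> (\<integral>z. 0 \<partial>(lborel :: real measure))"
    proof (rule integral_dominated_convergence[where w = a])
      show "AE z in lborel. (\<lambda>n. indicator {..<- real n} z * a z) \<longlonglongrightarrow> 0"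
      proof (rule AE_I2, rule tendsto_eventually)
        fix z :: real
        obtain N :: nat where "- z \<le> real N" using real_arch_simple by blast
        then show "\<forall>\<^sub>F n in sequentially. indicator {..<- real n} z * a z = 0"
          by (intro eventually_sequentiallyI[of N]) (auto simp: indicator_def)
      qed
    qed (use ai a0 in \<open>auto simp: indicator_def\<close>)
    then show ?thesis by simp
  qed
  obtain s0 where s0: "s0 \<le> y" "F s0 = 0"
  proof -
    have "\<forall>\<^sub>F n in sequentially. (\<integral>z. indicator {..<- real n} z * a z \<partial>lborel) < 1"
      using order_tendstoD(2)[OF tail, of 1] by simp
    moreover have "\<forall>\<^sub>F n in sequentially. - y \<le> real n"
    proof -
      obtain N :: nat where "- y \<le> real N" using real_arch_simple by blast
      moreover have "real N \<le> real n" if "N \<le> n" for n using that by simp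
      ultimately show ?thesis by (intro eventually_sequentiallyI[of N]) (meson order_trans)
    qed
    ultimately have "\<forall>\<^sub>F n in sequentially. (\<integral>z. indicator {..<- real n} z * a z \<partial>lborel) < 1 \<and> - y \<le> real n"
      by (rule eventually_conj)
    then obtain n :: nat where n: "(\<integral>z. indicator {..<- real n} z * a z \<partial>lborel) < 1" "- real n \<le> y"
      by (auto simp: eventually_sequentially)
    let ?x = "- real n"
    have "F ?x \<le> (\<integral>z. F ?x * (indicator {..<?x} z * a z) \<partial>lborel)"
      unfolding F_def
    proof (rule integral_mono_AE[OF f2])
      show "integrable lborel (\<lambda>z. (\<integral>z. indicator {..<?x} z * (f z)\<^sup>2 \<partial>lborel) * (indicator {..<?x} z * a z))"
        by (intro integrable_mult_right ia) simp
      show "AE z in lborel. indicator {..<?x} z * (f z)\<^sup>2 \<le> (\<integral>z. indicator {..<?x} z * (f z)\<^sup>2 \<partial>lborel) * (indicator {..<?x} z * a z)"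
        unfolding F_def[symmetric] using le
      proof eventually_elim
        case (elim t)
        show ?case
        proof (cases "t < ?x")
          case True
          then have "(f t)\<^sup>2 \<le> a t * F t" using elim n(2) by auto
          also have "\<dots> \<le> a t * F ?x" using True by (intro mult_left_mono Fmono a0) auto
          finally show ?thesis using True by (simp add: indicator_def mult.commute)
        qed (simp add: indicator_def)
      qed
    qed
    then have "F ?x \<le> F ?x * (\<integral>z. indicator {..<?x} z * a z \<partial>lborel)" by simp
    moreover have "F ?x * (\<integral>z. indicator {..<?x} z * a z \<partial>lborel) < F ?x * 1" if "F ?x > 0"
      using that n(1) by (intro mult_strict_left_mono)
    ultimately have "F ?x = 0" using F0[of ?x] by (cases "F ?x > 0") auto
    then show thesis using n(2) by (intro that[of ?x])
  qed
  \<comment> \<open>Continuation to the right: short intervals on either side of the supremum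
    \<open>t\<close> of \<open>Z\<close> carry mass of \<open>a\<close> below 1, so
    \<open>F t = 0\<close>, and \<open>t\<close> could be pushed further if it were below y.\<close>
  define Z where "Z = {s. s0 \<le> s \<and> s \<le> y \<and> F s = 0}"
  define t where "t = Sup Z"
  have Z: "Z \<noteq> {}" "bdd_above Z" using s0 by (auto simp: Z_def)
  have t: "s0 \<le> t" "t \<le> y"
    unfolding t_def using s0 Z by (auto simp: Z_def intro!: cSup_upper cSup_least)
  have approach_below: "(\<lambda>n. \<alpha> (t - 1 / Suc n) t) \<longlonglongrightarrow> 0"
  proof -
    have "(\<lambda>n. \<integral>z. indicator {t - 1 / Suc n<..<t} z * a z \<partial>lborel) \<longlonglongrightarrow> (\<integral>z. 0 \<partial>(lborel :: real measure))"
    proof (rule integral_dominated_convergence[where w = a])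
      show "AE z in lborel. (\<lambda>n. indicator {t - 1 / Suc n<..<t} z * a z) \<longlonglongrightarrow> 0"
      proof (rule AE_I2)
        fix z :: real
        show "(\<lambda>n. indicator {t - 1 / Suc n<..<t} z * a z) \<longlonglongrightarrow> 0"
        proof (cases "z < t")
          case True
          have "\<forall>\<^sub>F n in sequentially. 1 / real (Suc n) < t - z"
            using order_tendstoD(2)[OF LIMSEQ_inverse_real_of_nat, of "t - z"] True by (simp add: inverse_eq_divide)
          then show ?thesis
            by (rule tendsto_eventually[OF eventually_mono]) (simp add: indicator_def)
        qed (simp add: indicator_def)
      qed
    qed (use ai a0 in \<open>auto simp: indicator_def\<close>)
    then show ?thesis by (simp add: \<alpha>_def)
  qed
  have approach_above: "(\<lambda>n. \<alpha> t (t + 1 / Suc n)) \<longlonglongrightarrow> 0"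
  proof -
    have "(\<lambda>n. \<integral>z. indicator {t<..<t + 1 / Suc n} z * a z \<partial>lborel) \<longlonglongrightarrow> (\<integral>z. 0 \<partial>(lborel :: real measure))"
    proof (rule integral_dominated_convergence[where w = a])
      show "AE z in lborel. (\<lambda>n. indicator {t<..<t + 1 / Suc n} z * a z) \<longlonglongrightarrow> 0"
      proof (rule AE_I2)
        fix z :: real
        show "(\<lambda>n. indicator {t<..<t + 1 / Suc n} z * a z) \<longlonglongrightarrow> 0"
        proof (cases "t < z")
          case True
          have "\<forall>\<^sub>F n in sequentially. 1 / real (Suc n) < z - t"
            using order_tendstoD(2)[OF LIMSEQ_inverse_real_of_nat, of "z - t"] True by (simp add: inverse_eq_divide)
          then show ?thesis
            by (rule tendsto_eventually[OF eventually_mono]) (simp add: indicator_def)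
        qed (simp add: indicator_def)
      qed
    qed (use ai a0 in \<open>auto simp: indicator_def\<close>)
    then show ?thesis by (simp add: \<alpha>_def)
  qed
  have \<alpha>mono: "\<alpha> s x \<le> \<alpha> s' x'" if "s' \<le> s" "x \<le> x'" for s x s' x'
    unfolding \<alpha>_def
    by (rule integral_mono[OF ia ia]) (use that a0 in \<open>auto simp: indicator_def\<close>)
  have Ft: "F t = 0"
  proof -
    obtain n where n: "\<alpha> (t - 1 / Suc n) t < 1"
      using order_tendstoD(2)[OF approach_below, of 1] by (auto simp: eventually_sequentially)
    have "t - 1 / Suc n < t" by simp
    then obtain s where s: "s \<in> Z" "t - 1 / Suc n < s"
      unfolding t_def using less_cSup_iff[OF Z] by blast
    then have "s \<le> t" unfolding t_def using Z(2) by (intro cSup_upper)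
    have "\<alpha> s t \<le> \<alpha> (t - 1 / Suc n) t" using s(2) by (intro \<alpha>mono) auto
    with n have "\<alpha> s t < 1" by simp
    moreover have "F s = 0" using s(1) by (simp add: Z_def)
    ultimately show ?thesis using \<open>s \<le> t\<close> t(2) by (intro zero[of s t])
  qed
  have "t = y"
  proof (rule ccontr)
    assume "t \<noteq> y"
    then have "t < y" using t by simp
    obtain n where n: "\<alpha> t (t + 1 / Suc n) < 1"
      using order_tendstoD(2)[OF approach_above, of 1] by (auto simp: eventually_sequentially)
    define x where "x = min y (t + 1 / Suc n)"
    have x: "t < x" "x \<le> y" using \<open>t < y\<close> by (auto simp: x_def)
    have "\<alpha> t x \<le> \<alpha> t (t + 1 / Suc n)" by (intro \<alpha>mono) (auto simp: x_def)
    with n have "\<alpha> t x < 1" by simp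
    then have "F x = 0" using x Ft by (intro zero[of t x]) simp_all
    then have "x \<in> Z" using x t by (simp add: Z_def)
    then have "x \<le> t" unfolding t_def using Z(2) by (rule cSup_upper)
    with x show False by simp
  qed
  with Ft show ?thesis by (intro F_zero) simp
qed

text \<open>The Volterra equations are treated column by column, so the null set has to be assembled
  with the second variable fixed first.\<close>

lemma AE_lborel_pairI:
  fixes P :: "real \<times> real \<Rightarrow> bool"
  assumes m: "{p \<in> space (lborel \<Otimes>\<^sub>M lborel). P p} \<in> sets (lborel \<Otimes>\<^sub>M lborel)"
    and ae: "AE y in lborel. AE x in lborel. P (x, y)"
  shows "AE p in lborel \<Otimes>\<^sub>M lborel. P p"
proof -
  have m': "{p \<in> space (lborel \<Otimes>\<^sub>M lborel). P (fst p, snd p)} \<in> sets (lborel \<Otimes>\<^sub>M lborel)"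
    using m by simp
  have "AE x in lborel. AE y in lborel. P (x, y)"
    using lborel_pair.AE_commute[of "\<lambda>x y. P (x, y)", OF m'] ae by simp
  with m show ?thesis by (rule lborel_pair.AE_pair_measure)
qed

section \<open>Products and equations of triangular kernels\<close>

lemma lower_kernelD:
  assumes "lower_kernel A"
  shows "A \<in> L2 (lborel \<Otimes>\<^sub>M lborel)" "AE p in lborel \<Otimes>\<^sub>M lborel. fst p < snd p \<longrightarrow> A p = 0"
  using assms by (auto simp: lower_kernel_def split_def)

lemma lower_kernelI:
  assumes "A \<in> L2 (lborel \<Otimes>\<^sub>M lborel)" "AE p in lborel \<Otimes>\<^sub>M lborel. fst p < snd p \<longrightarrow> A p = 0"
  shows "lower_kernel A"
  using assms by (auto simp: lower_kernel_def split_def)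

lemma pred_lower_measurable:
  assumes "A \<in> L2 (lborel \<Otimes>\<^sub>M lborel)"
  shows "{p \<in> space (lborel \<Otimes>\<^sub>M lborel). fst p < (snd p :: real) \<longrightarrow> A p = (0 :: real)} \<in> sets (lborel \<Otimes>\<^sub>M lborel)"
proof -
  have [measurable]: "A \<in> borel_measurable (lborel \<Otimes>\<^sub>M lborel)" by (rule L2_measurable[OF assms])
  show ?thesis by measurable
qed

text \<open>For x < y every z satisfies x < z or z < y, so one of the two factors vanishes.\<close>

lemma comp_kernel_lower:
  assumes A: "lower_kernel A" and B: "lower_kernel B"
  shows "lower_kernel (comp_kernel lborel A B)"
proof (rule lower_kernelI)
  note L = lborel.comp_kernel_L2(1)[OF lower_kernelD(1)[OF A] lower_kernelD(1)[OF B]]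
  show "comp_kernel lborel A B \<in> L2 (lborel \<Otimes>\<^sub>M lborel)" by (rule L)
  show "AE p in lborel \<Otimes>\<^sub>M lborel. fst p < snd p \<longrightarrow> comp_kernel lborel A B p = 0"
  proof (rule AE_lborel_pairI[OF pred_lower_measurable[OF L]])
    show "AE y in lborel. AE x in lborel. fst (x, y) < snd (x, y) \<longrightarrow> comp_kernel lborel A B (x, y) = 0"
      using AE_lborel_pair(2)[OF lower_kernelD(2)[OF B]]
    proof eventually_elim
      case (elim y)
      note By = elim
      show ?case using AE_lborel_pair(1)[OF lower_kernelD(2)[OF A]]
      proof eventually_elim
        case (elim x)
        show ?case
        proof
          assume lt: "fst (x, y) < snd (x, y)"
          have "AE z in lborel. A (x, z) * B (z, y) = 0"
            using elim By by eventually_elim (use lt in force)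
          then show "comp_kernel lborel A B (x, y) = 0"
            unfolding comp_kernel_def by (simp add: integral_eq_zero_AE)
        qed
      qed
    qed
  qed
qed

lemma lower_upper_kernel_eq_0:
  assumes "lower_kernel A" "lower_kernel (transpose_kernel A)"
  shows "AE p in lborel \<Otimes>\<^sub>M lborel. A p = 0"
  using lower_kernelD(2)[OF assms(1)] AE_lborel_swap[OF lower_kernelD(2)[OF assms(2)]] AE_lborel_pair_offdiag
proof eventually_elim
  case (elim p)
  have "fst p < snd p \<or> snd p < fst p" using elim(3) by linarith
  then show ?case using elim(1,2) by (auto simp: transpose_kernel_def)
qed

text \<open>For x < y both \<open>l\<close> and \<open>L\<close> vanish, so column y of
  \<open>W\<close> satisfies the homogeneous Volterra equation on the half line below y and is 0
  there. This takes the place of closure of the lower triangular factors under inversion.\<close>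

lemma lower_kernel_of_equation:
  assumes l: "lower_kernel l" and L: "lower_kernel L" and W: "W \<in> L2 (lborel \<Otimes>\<^sub>M lborel)"
    and eq: "AE p in lborel \<Otimes>\<^sub>M lborel. l p + W p + comp_kernel lborel l W p = L p"
  shows "lower_kernel W"
proof (rule lower_kernelI[OF W], rule AE_lborel_pairI[OF pred_lower_measurable[OF W]])
  show "AE y in lborel. AE x in lborel. fst (x, y) < snd (x, y) \<longrightarrow> W (x, y) = 0"
    using lborel.kernel_column_L2[OF W] AE_lborel_pair(2)[OF eq]
      AE_lborel_pair(2)[OF lower_kernelD(2)[OF l]] AE_lborel_pair(2)[OF lower_kernelD(2)[OF L]]
  proof eventually_elim
    case (elim y)
    have "AE x in lborel. x < y \<longrightarrow> W (x, y) + integral_op lborel l (\<lambda>x. W (x, y)) x = 0"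
      using elim(2,3,4)
      by eventually_elim (auto simp: comp_kernel_column)
    from volterra_injective_below[OF l elim(1) this] show ?case by simp
  qed
qed

section \<open>The upper triangular factor\<close>

text \<open>Lax-Milgram on \<open>L\<^sup>2(\<real>\<^sup>2)\<close> solves the equations for all columns at once, so that no measurable selection is needed.\<close>

lemma upper_kernel_exists:
  assumes S: "S \<in> L2 (lborel \<Otimes>\<^sub>M (lborel :: real measure))" and c: "0 < c" "c \<le> 1"
    and coercive: "\<And>f. f \<in> L2 lborel \<Longrightarrow> c * L2_inner lborel f f \<le> L2_inner lborel f f + L2_inner lborel f (integral_op lborel S f)"
  obtains C where "C \<in> L2 (lborel \<Otimes>\<^sub>M lborel)" "\<And>p. \<not> fst p < snd p \<Longrightarrow> C p = 0"
    "AE p in lborel \<Otimes>\<^sub>M lborel. fst p < snd p \<longrightarrow> S p + C p + comp_kernel lborel S C p = 0"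
proof -
  let ?N = "lborel \<Otimes>\<^sub>M lborel :: (real \<times> real) measure"
  \<comment> \<open>Multiplication by \<open>up\<close> is the orthogonal projection onto strictly
    upper triangular kernels. The operator \<open>T\<close> below is the identity plus the
    compression of composition with \<open>S\<close>; it acts on all kernels, so Lax-Milgram applies
    to the whole space.\<close>
  define up where "up p = (if fst p < snd p then 1 else 0 :: real)" for p :: "real \<times> real"
  have [measurable]: "up \<in> borel_measurable ?N" unfolding up_def by measurable
  have up2: "up p * up p = up p" for p by (simp add: up_def)
  have upL: "(\<lambda>p. up p * D p) \<in> L2 ?N" and upn: "L2_norm ?N (\<lambda>p. up p * D p) \<le> L2_norm ?N D" if D: "D \<in> L2 ?N" for D
  proof -
    have [measurable]: "D \<in> borel_measurable ?N" by (rule L2_measurable[OF D])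
    have "integrable ?N (\<lambda>p. (up p * D p)\<^sup>2)"
      by (rule Bochner_Integration.integrable_bound[OF L2_integrable_square[OF D]]) (auto simp: up_def)
    then show L: "(\<lambda>p. up p * D p) \<in> L2 ?N" by (simp add: L2_def)
    have "L2_inner ?N (\<lambda>p. up p * D p) (\<lambda>p. up p * D p) \<le> L2_inner ?N D D"
      unfolding L2_inner_def by (rule integral_mono[OF L2_integrable_mult[OF L L] L2_integrable_mult[OF D D]]) (simp add: up_def)
    then show "L2_norm ?N (\<lambda>p. up p * D p) \<le> L2_norm ?N D" by (simp add: L2_norm_def)
  qed
  define H where "H D = comp_kernel lborel S (\<lambda>p. up p * D p)" for D
  have HL: "H D \<in> L2 ?N" and Hn: "L2_norm ?N (H D) \<le> L2_norm ?N S * L2_norm ?N D" if D: "D \<in> L2 ?N" for D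
  proof -
    note K = lborel.comp_kernel_L2[OF S upL[OF D]]
    show "H D \<in> L2 ?N" unfolding H_def by (rule K(1))
    have "L2_norm ?N S * L2_norm ?N (\<lambda>p. up p * D p) \<le> L2_norm ?N S * L2_norm ?N D"
      by (intro mult_left_mono upn D L2_norm_nonneg)
    with K(2) show "L2_norm ?N (H D) \<le> L2_norm ?N S * L2_norm ?N D" unfolding H_def by linarith
  qed
  define T where "T D = (\<lambda>p. D p + up p * H D p)" for D
  have Hadd: "AE p in ?N. H (\<lambda>p. D p + E p) p = H D p + H E p" if D: "D \<in> L2 ?N" and E: "E \<in> L2 ?N" for D E
  proof (rule AE_lborel_pairI)
    have [measurable]: "H (\<lambda>p. D p + E p) \<in> borel_measurable ?N" "H D \<in> borel_measurable ?N" "H E \<in> borel_measurable ?N"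
      using HL[OF D] HL[OF E] HL[OF L2_add[OF D E]] by (auto dest: L2_measurable)
    show "{p \<in> space ?N. H (\<lambda>p. D p + E p) p = H D p + H E p} \<in> sets ?N" by measurable
    show "AE y in lborel. AE x in lborel. H (\<lambda>p. D p + E p) (x, y) = H D (x, y) + H E (x, y)"
      using lborel.kernel_column_L2[OF upL[OF D]] lborel.kernel_column_L2[OF upL[OF E]]
    proof eventually_elim
      case (elim y)
      from bounded_operator_add[OF lborel.bounded_integral_op[OF S] elim]
      show ?case by (simp add: H_def comp_kernel_column distrib_left)
    qed
  qed
  have Hscale: "H (\<lambda>p. k * D p) p = k * H D p" for k D p
    unfolding H_def comp_kernel_def
    by (simp add: split_def mult.left_commute[of _ k] flip: integral_mult_right_zero)
  have bT: "bounded_operator ?N T"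
  proof (rule bounded_operatorI[where C = "1 + L2_norm ?N S"])
    show "T D \<in> L2 ?N" if "D \<in> L2 ?N" for D unfolding T_def by (intro L2_add upL HL that)
    show "AE p in ?N. T (\<lambda>t. D t + E t) p = T D p + T E p" if "D \<in> L2 ?N" "E \<in> L2 ?N" for D E
      using Hadd[OF that] by eventually_elim (simp add: T_def algebra_simps)
    show "AE p in ?N. T (\<lambda>t. k * D t) p = k * T D p" for k D
      by (simp add: T_def Hscale algebra_simps)
    show "L2_norm ?N (T D) \<le> (1 + L2_norm ?N S) * L2_norm ?N D" if D: "D \<in> L2 ?N" for D
    proof -
      have "L2_norm ?N (T D) \<le> L2_norm ?N D + L2_norm ?N (\<lambda>p. up p * H D p)"
        unfolding T_def by (rule L2_norm_triangle[OF D upL[OF HL[OF D]]])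
      with upn[OF HL[OF D]] Hn[OF D] show ?thesis by (simp add: distrib_right)
    qed
  qed
  \<comment> \<open>Coercivity of I + S in each column, integrated over the columns, handles the
    projected part \<open>E\<close>; as \<open>c <= 1\<close>, the identity provides at least the
    factor \<open>c\<close> on the rest.\<close>
  have coT: "c * L2_inner ?N D D \<le> L2_inner ?N D (T D)" if D: "D \<in> L2 ?N" for D
  proof -
    define E where "E = (\<lambda>p. up p * D p)"
    have E: "E \<in> L2 ?N" unfolding E_def by (rule upL[OF D])
    define G where "G = comp_kernel lborel S E"
    have G: "G \<in> L2 ?N" unfolding G_def by (rule lborel.comp_kernel_L2(1)[OF S E])
    have EE: "L2_inner ?N E E \<le> L2_inner ?N D D"
      using upn[OF D] by (simp add: E_def L2_norm_def)
    have i1: "integrable ?N (case_prod (\<lambda>x y. E (x, y) * E (x, y)))" "integrable ?N (case_prod (\<lambda>x y. E (x, y) * G (x, y)))"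
      using L2_integrable_mult[OF E E] L2_integrable_mult[OF E G] by (simp_all add: case_prod_beta')
    have col: "(\<integral>x. E (x, y) * G (x, y) \<partial>lborel) = L2_inner lborel (\<lambda>x. E (x, y)) (integral_op lborel S (\<lambda>x. E (x, y)))" for y
      unfolding G_def comp_kernel_column L2_inner_def ..
    have "(c - 1) * L2_inner ?N E E = (\<integral>y. (c - 1) * (\<integral>x. E (x, y) * E (x, y) \<partial>lborel) \<partial>lborel)"
      using lborel_pair.integral_snd[OF i1(1)] by (simp add: L2_inner_def case_prod_beta')
    also have "\<dots> \<le> (\<integral>y. \<integral>x. E (x, y) * G (x, y) \<partial>lborel \<partial>lborel)"
    proof (rule integral_mono_AE)
      show "integrable lborel (\<lambda>y. (c - 1) * (\<integral>x. E (x, y) * E (x, y) \<partial>lborel))"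
        by (intro integrable_mult_right lborel_pair.integrable_snd[OF i1(1)])
      show "integrable lborel (\<lambda>y. \<integral>x. E (x, y) * G (x, y) \<partial>lborel)"
        by (rule lborel_pair.integrable_snd[OF i1(2)])
      show "AE y in lborel. (c - 1) * (\<integral>x. E (x, y) * E (x, y) \<partial>lborel) \<le> (\<integral>x. E (x, y) * G (x, y) \<partial>lborel)"
        using lborel.kernel_column_L2[OF E]
      proof eventually_elim
        case (elim y)
        from coercive[OF elim] show ?case
          unfolding col by (simp add: L2_inner_def left_diff_distrib)
      qed
    qed
    also have "\<dots> = L2_inner ?N E G"
      using lborel_pair.integral_snd[OF i1(2)] by (simp add: L2_inner_def case_prod_beta')
    finally have EG: "(c - 1) * L2_inner ?N E E \<le> L2_inner ?N E G" .
    have "L2_inner ?N D (T D) = L2_inner ?N D D + L2_inner ?N D (\<lambda>p. up p * H D p)"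
      unfolding T_def by (rule L2_inner_add_right[OF D D upL[OF HL[OF D]]])
    also have "L2_inner ?N D (\<lambda>p. up p * H D p) = L2_inner ?N E G"
      unfolding L2_inner_def by (simp add: E_def G_def H_def mult_ac)
    finally have "L2_inner ?N D (T D) = L2_inner ?N D D + L2_inner ?N E G" .
    moreover have "(1 - c) * L2_inner ?N E E \<le> (1 - c) * L2_inner ?N D D"
      using EE c by (intro mult_left_mono) auto
    ultimately show ?thesis using EG by (simp add: algebra_simps)
  qed
  \<comment> \<open>Above the diagonal this is the required equation, with the projection of
    \<open>D\<close> as its solution.\<close>
  obtain D where D: "D \<in> L2 ?N" "AE p in ?N. T D p = - (up p * S p)"
    using coercive_surjective[OF bT c(1) coT L2_uminus[OF upL[OF S]]] by blast
  show thesis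
  proof (rule that[of "\<lambda>p. up p * D p"])
    show "(\<lambda>p. up p * D p) \<in> L2 ?N" by (rule upL[OF D(1)])
    show "up p * D p = 0" if "\<not> fst p < snd p" for p using that by (simp add: up_def)
    show "AE p in ?N. fst p < snd p \<longrightarrow> S p + up p * D p + comp_kernel lborel S (\<lambda>p. up p * D p) p = 0"
      using D(2) by eventually_elim (auto simp: T_def H_def up_def)
  qed
qed

section \<open>Restriction to half lines\<close>

definition extend :: "real \<Rightarrow> (real \<Rightarrow> real) \<Rightarrow> real \<Rightarrow> real" where
  "extend y f = (\<lambda>x. indicator {..<y} x * f x)"

lemma below_measurable_iff: "f \<in> borel_measurable (below y) \<longleftrightarrow> extend y f \<in> borel_measurable lborel"
  unfolding below_def extend_def
  by (subst borel_measurable_restrict_space_iff) auto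

lemma below_integrable_iff: "integrable (below y) f \<longleftrightarrow> integrable lborel (extend y f)"
  unfolding below_def extend_def by (subst integrable_restrict_space) auto

lemma below_integral: "integral\<^sup>L (below y) f = integral\<^sup>L lborel (extend y f)"
  unfolding below_def extend_def by (subst integral_restrict_space) auto

lemma AE_below: "(AE x in below y. P x) \<longleftrightarrow> (AE x in lborel. x < y \<longrightarrow> P x)"
  unfolding below_def by (subst AE_restrict_space_iff) auto

lemma extend_mult: "extend y (\<lambda>x. f x * g x) = (\<lambda>x. extend y f x * extend y g x)"
  by (auto simp: extend_def indicator_def)

lemma L2_below_iff: "f \<in> L2 (below y) \<longleftrightarrow> extend y f \<in> L2 lborel"
  unfolding L2_def power2_eq_square mem_Collect_eq below_measurable_iff below_integrable_iff extend_mult ..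

lemma L2_inner_below: "L2_inner (below y) f g = L2_inner lborel (extend y f) (extend y g)"
  unfolding L2_inner_def below_integral extend_mult ..

lemma extend_L2:
  assumes f: "f \<in> L2 lborel"
  shows "extend y f \<in> L2 lborel"
proof -
  have [measurable]: "f \<in> borel_measurable lborel" by (rule L2_measurable[OF f])
  have "integrable lborel (\<lambda>x. (extend y f x)\<^sup>2)"
    by (rule Bochner_Integration.integrable_bound[OF L2_integrable_square[OF f]]) (auto simp: extend_def indicator_def)
  then show ?thesis unfolding L2_def extend_def by simp
qed

lemma restrict_op_eq: "restrict_op A y f x = integral_op lborel A (extend y f) x"
  unfolding restrict_op_def integral_op_def below_integral
  by (rule Bochner_Integration.integral_cong) (auto simp: extend_def)

lemma sigma_finite_below: "sigma_finite_measure (below y)"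
  unfolding below_def by (rule sigma_finite_measure_restrict_space) (auto intro: lborel.sigma_finite_measure_axioms)

text \<open>Iterated nonnegative integrals are compared, which avoids identifying the product of the
  restricted measures with a restriction of the product measure.\<close>

lemma below_pair_L2:
  assumes A: "A \<in> L2 (lborel \<Otimes>\<^sub>M lborel)"
  shows "A \<in> L2 (below y \<Otimes>\<^sub>M below y)"
proof -
  interpret b: sigma_finite_measure "below y" by (rule sigma_finite_below)
  have id: "(\<lambda>x. x) \<in> measurable (below y) lborel"
    unfolding below_def by (rule measurable_restrict_space1) simp
  have "(\<lambda>p. (fst p, snd p)) \<in> measurable (below y \<Otimes>\<^sub>M below y) (lborel \<Otimes>\<^sub>M lborel)"
    by (intro measurable_Pair measurable_compose[OF measurable_fst id] measurable_compose[OF measurable_snd id])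
  from measurable_compose[OF this L2_measurable[OF A]]
  have m: "A \<in> borel_measurable (below y \<Otimes>\<^sub>M below y)" by simp
  have m2: "(\<lambda>p. ennreal ((A p)\<^sup>2)) \<in> borel_measurable (below y \<Otimes>\<^sub>M below y)"
    by (rule measurable_compose[OF m]) simp
  have [measurable]: "A \<in> borel_measurable (lborel \<Otimes>\<^sub>M lborel)" by (rule L2_measurable[OF A])
  have "(\<integral>\<^sup>+p. ennreal ((A p)\<^sup>2) \<partial>(below y \<Otimes>\<^sub>M below y)) = (\<integral>\<^sup>+x. \<integral>\<^sup>+z. ennreal ((A (x, z))\<^sup>2) \<partial>below y \<partial>below y)"
    by (rule b.nn_integral_fst[OF m2, symmetric])
  also have "\<dots> = (\<integral>\<^sup>+x. (\<integral>\<^sup>+z. ennreal ((A (x, z))\<^sup>2) * indicator {..<y} z \<partial>lborel) * indicator {..<y} x \<partial>lborel)"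
    unfolding below_def by (simp add: nn_integral_restrict_space)
  also have "\<dots> \<le> (\<integral>\<^sup>+x. \<integral>\<^sup>+z. ennreal ((A (x, z))\<^sup>2) \<partial>lborel \<partial>lborel)"
  proof (rule nn_integral_mono)
    fix x :: real
    have "(\<integral>\<^sup>+z. ennreal ((A (x, z))\<^sup>2) * indicator {..<y} z \<partial>lborel) \<le> (\<integral>\<^sup>+z. ennreal ((A (x, z))\<^sup>2) \<partial>lborel)"
      by (rule nn_integral_mono) (simp add: indicator_def)
    then show "(\<integral>\<^sup>+z. ennreal ((A (x, z))\<^sup>2) * indicator {..<y} z \<partial>lborel) * indicator {..<y} x
        \<le> (\<integral>\<^sup>+z. ennreal ((A (x, z))\<^sup>2) \<partial>lborel)"
      by (simp add: indicator_def)
  qed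
  also have "\<dots> = (\<integral>\<^sup>+p. ennreal ((A p)\<^sup>2) \<partial>(lborel \<Otimes>\<^sub>M lborel))"
    by (rule lborel.nn_integral_fst) measurable
  also have "\<dots> = ennreal ((L2_norm (lborel \<Otimes>\<^sub>M lborel) A)\<^sup>2)" by (rule nn_integral_L2_norm[OF A])
  finally show ?thesis by (rule L2I_nn_integral(1)[OF m]) simp
qed

text \<open>The form of the compressed operator A is that of \<open>S\<close> on zero extensions.
  Symmetry and coercivity are thus inherited for every y, and with them invertibility and a positive
  determinant. Column y of \<open>C\<close> lives on the half line up to a null set, so its equation
  reads (I + A) C = - S there; inverting I + A yields the first formula, and C = - S - A C yields
  the second.\<close>

lemma half_line_formula:
  assumes S: "S \<in> L2 (lborel \<Otimes>\<^sub>M lborel)" and sym: "adjoint_op lborel (integral_op lborel S) (integral_op lborel S)"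
    and c: "0 < c" "c \<le> 1"
    and coercive: "\<And>f. f \<in> L2 lborel \<Longrightarrow> c * L2_inner lborel f f \<le> L2_inner lborel f f + L2_inner lborel f (integral_op lborel S f)"
    and C: "C \<in> L2 (lborel \<Otimes>\<^sub>M lborel)" and C0: "AE p in lborel \<Otimes>\<^sub>M lborel. snd p < fst p \<longrightarrow> C p = 0"
    and eq: "AE p in lborel \<Otimes>\<^sub>M lborel. fst p < snd p \<longrightarrow> S p + C p + comp_kernel lborel S C p = 0"
  shows "op_invertible (below y) (id + restrict_op S y)" "det2 (below y) (restrict_op S y) \<noteq> 0"
    and "AE y in lborel. (\<lambda>t. S (t, y)) \<in> L2 (below y) \<and>
      (AE x in below y.
        C (x, y) = - op_inv (below y) (id + restrict_op S y) (\<lambda>t. S (t, y)) x \<and>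
        C (x, y) = - S (x, y) - D2 (below y) (restrict_op S y) (\<lambda>t. S (t, y)) x / det2 (below y) (restrict_op S y))"
proof -
  have all: "bounded_operator (below y) (restrict_op S y) \<and> op_invertible (below y) (id + restrict_op S y) \<and>
      det2 (below y) (restrict_op S y) \<noteq> 0" for y
  proof -
    interpret b: sigma_finite_measure "below y" by (rule sigma_finite_below)
    note Sb = below_pair_L2[OF S, of y]
    have bd: "bounded_operator (below y) (restrict_op S y)"
      unfolding restrict_op_def by (rule b.bounded_integral_op[OF Sb])
    have inner: "L2_inner (below y) f (restrict_op S y g) = L2_inner lborel (extend y f) (integral_op lborel S (extend y g))" for f g
    proof -
      have "(\<lambda>x. extend y f x * extend y (restrict_op S y g) x) = (\<lambda>x. extend y f x * integral_op lborel S (extend y g) x)"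
        by (auto simp: extend_def[of y f] extend_def[of y "restrict_op S y g"] restrict_op_eq indicator_def)
      then show ?thesis unfolding L2_inner_below unfolding L2_inner_def by simp
    qed
    have co: "c * L2_inner (below y) f f \<le> L2_inner (below y) f f + L2_inner (below y) f (restrict_op S y f)"
      if "f \<in> L2 (below y)" for f
      unfolding inner unfolding L2_inner_below[of y f f]
      by (rule coercive) (use that in \<open>simp add: L2_below_iff\<close>)
    have sm: "adjoint_op (below y) (restrict_op S y) (restrict_op S y)"
      unfolding adjoint_op_def
    proof (intro ballI)
      fix f g assume fg: "f \<in> L2 (below y)" "g \<in> L2 (below y)"
      have "L2_inner (below y) (restrict_op S y f) g = L2_inner lborel (extend y g) (integral_op lborel S (extend y f))"
        by (subst L2_inner_commute) (rule inner)
      also have "\<dots> = L2_inner lborel (extend y f) (integral_op lborel S (extend y g))"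
        using sym fg unfolding adjoint_op_def L2_below_iff by (metis L2_inner_commute)
      finally show "L2_inner (below y) (restrict_op S y f) g = L2_inner (below y) f (restrict_op S y g)"
        unfolding inner .
    qed
    obtain R where R: "R > 0" "\<And>f. f \<in> L2 (below y) \<Longrightarrow> L2_norm (below y) (restrict_op S y f) \<le> R * L2_norm (below y) f"
      using bounded_operator_bound[OF bd] by metis
    interpret symmetric_operator "below y" "restrict_op S y" R c
      by unfold_locales (use bd sm R co c in auto)
    \<comment> \<open>The squared norm of the kernel is the Hilbert-Schmidt bound that
      \<open>det2_pos\<close> asks for in every orthonormal basis.\<close>
    have "0 < det2 (below y) (restrict_op S y)"
    proof (rule det2_pos)
      fix B F assume B: "orthonormal_basis (below y) B" and F: "finite F" "F \<subseteq> B"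
      have on: "e \<in> L2 (below y)" "L2_inner (below y) e f = (if e = f then 1 else 0)" if "e \<in> F" "f \<in> F" for e f
        using B F that unfolding orthonormal_basis_def by blast+
      show "(\<Sum>e\<in>F. L2_inner (below y) (restrict_op S y e) (restrict_op S y e)) \<le> L2_inner (below y \<Otimes>\<^sub>M below y) S S"
        unfolding restrict_op_def
        by (rule b.kernel_Bessel[OF Sb F(1), where u = "\<lambda>e. e"]) (use on in auto)
    qed
    moreover have "op_invertible (below y) (id + restrict_op S y)"
    proof (rule coercive_op_invertible[OF bounded_operator_plus[OF bounded_operator_id bd] c(1)])
      fix f assume f: "f \<in> L2 (below y)"
      have "L2_inner (below y) f ((id + restrict_op S y) f) = L2_inner (below y) f f + L2_inner (below y) f (restrict_op S y f)"
        using L2_inner_add_right[OF f f bounded_operator_L2[OF bd f]] by (simp add: plus_fun_def)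
      with co[OF f] show "c * L2_inner (below y) f f \<le> L2_inner (below y) f ((id + restrict_op S y) f)" by simp
    qed
    ultimately show ?thesis using bd by simp
  qed
  show "op_invertible (below y) (id + restrict_op S y)" "det2 (below y) (restrict_op S y) \<noteq> 0"
    using all by blast+
  show "AE y in lborel. (\<lambda>t. S (t, y)) \<in> L2 (below y) \<and>
      (AE x in below y.
        C (x, y) = - op_inv (below y) (id + restrict_op S y) (\<lambda>t. S (t, y)) x \<and>
        C (x, y) = - S (x, y) - D2 (below y) (restrict_op S y) (\<lambda>t. S (t, y)) x / det2 (below y) (restrict_op S y))"
    using lborel.kernel_column_L2[OF S] lborel.kernel_column_L2[OF C] AE_lborel_pair(2)[OF C0] AE_lborel_pair(2)[OF eq]
  proof eventually_elim
    case (elim y)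
    let ?S = "\<lambda>t. S (t, y)" and ?C = "\<lambda>t. C (t, y)" and ?A = "restrict_op S y"
    have A: "bounded_operator (below y) ?A" and inv: "op_invertible (below y) (id + ?A)"
      and d: "det2 (below y) ?A \<noteq> 0" using all by auto
    have T: "bounded_operator (below y) (id + ?A)" by (rule bounded_operator_plus[OF bounded_operator_id A])
    have SL: "?S \<in> L2 (below y)" and CL: "?C \<in> L2 (below y)"
      unfolding L2_below_iff by (intro extend_L2 elim)+
    define V where "V = op_inv (below y) (id + ?A)"
    have V: "bounded_operator (below y) V" "op_eq (below y) (V \<circ> (id + ?A)) id"
      using inv op_inv_is_op_inverse unfolding V_def op_invertible_def is_op_inverse_def by blast+
    \<comment> \<open>Column y of \<open>C\<close> vanishes almost everywhere beyond y, and the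
      point y itself is null, so the cut-off changes nothing.\<close>
    have ext: "AE x in lborel. integral_op lborel S (extend y ?C) x = integral_op lborel S ?C x"
    proof (rule bounded_operator_cong[OF lborel.bounded_integral_op[OF S] extend_L2[OF elim(2)] elim(2)])
      show "AE x in lborel. extend y ?C x = ?C x"
        using elim(3) AE_lborel_singleton[of y]
        by eventually_elim (auto simp: extend_def indicator_def)
    qed
    have TC: "AE x in below y. (id + ?A) ?C x = - ?S x"
      unfolding AE_below using elim(4) ext
      by eventually_elim (auto simp: restrict_op_eq comp_kernel_column)
    have "AE x in below y. V ((id + ?A) ?C) x = V (\<lambda>x. - ?S x) x"
      by (rule bounded_operator_cong[OF V(1) bounded_operator_L2[OF T CL] L2_uminus[OF SL] TC])
    moreover have "AE x in below y. V (\<lambda>x. - ?S x) x = - V ?S x"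
      by (rule bounded_operator_uminus[OF V(1) SL])
    moreover have "AE x in below y. V ((id + ?A) ?C) x = ?C x"
      using V(2) CL by (simp add: op_eq_def)
    ultimately have CV: "AE x in below y. ?C x = - V ?S x" by eventually_elim simp
    then have "AE x in below y. V ?S x = - ?C x" by eventually_elim simp
    from bounded_operator_cong[OF A bounded_operator_L2[OF V(1) SL] L2_uminus[OF CL] this]
    have "AE x in below y. ?A (V ?S) x = ?A (\<lambda>x. - ?C x) x" .
    with CV TC bounded_operator_uminus[OF A CL]
    have "AE x in below y. ?C x = - V ?S x \<and> ?C x = - S (x, y) - D2 (below y) ?A ?S x / det2 (below y) ?A"
    proof eventually_elim
      case (elim x)
      \<comment> \<open>The nonzero determinant cancels against the factor in \<open>D2\<close>. As
        V S = - C, the right side is A C, the term missing in C = - S - A C.\<close>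
      have "D2 (below y) ?A ?S x / det2 (below y) ?A = - ?A (V ?S) x"
        using d by (simp add: D2_def V_def)
      then show ?case using elim by simp
    qed
    then show ?case using SL unfolding V_def by simp
  qed
qed

section \<open>The factorization\<close>

text \<open>Modulo \<open>op_eq\<close>, statements about inverses and adjoints become equations in a monoid.\<close>

quotient_type bop = "real operator" / partial: "\<lambda>T U. bounded_operator lborel T \<and> bounded_operator lborel U \<and> op_eq lborel T U"
proof (rule part_equivpI)
  show "\<exists>T. bounded_operator lborel T \<and> bounded_operator lborel T \<and> op_eq lborel T T"
    using bounded_operator_id op_eq_refl by blast
  show "symp (\<lambda>T U. bounded_operator lborel T \<and> bounded_operator lborel U \<and> op_eq lborel T U)"
    using op_eq_sym by (auto simp: symp_def)
  show "transp (\<lambda>T U. bounded_operator lborel T \<and> bounded_operator lborel U \<and> op_eq lborel T U)"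
    using op_eq_trans by (force simp: transp_def)
qed

instantiation bop :: monoid_mult
begin

lift_definition one_bop :: bop is id
  by (simp add: bounded_operator_id op_eq_refl)

lift_definition times_bop :: "bop \<Rightarrow> bop \<Rightarrow> bop" is "(\<circ>)"
  by (auto intro: bounded_operator_comp op_eq_comp)

instance
proof
  fix a b c :: bop
  show "a * b * c = a * (b * c)"
    by transfer (auto simp: comp_assoc intro!: bounded_operator_comp op_eq_comp)
  show "1 * a = a" by transfer simp
  show "a * 1 = a" by transfer simp
qed

end

text \<open>Operators that are not bounded receive the default value 1; the rules for
  \<open>bop_of\<close> concern bounded operators.\<close>

lift_definition bop_of :: "real operator \<Rightarrow> bop" is "\<lambda>T. if bounded_operator lborel T then T else id"
  by (simp add: bounded_operator_id op_eq_refl)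

lemma bop_of_eq_iff:
  assumes "bounded_operator lborel T" "bounded_operator lborel U"
  shows "bop_of T = bop_of U \<longleftrightarrow> op_eq lborel T U"
  using assms by transfer simp

lemma bop_of_comp:
  assumes "bounded_operator lborel T" "bounded_operator lborel U"
  shows "bop_of (T \<circ> U) = bop_of T * bop_of U"
  using assms bounded_operator_comp[OF assms] by transfer (simp add: op_eq_refl)

lemma bop_of_id: "bop_of id = 1"
  by transfer (simp add: bounded_operator_id op_eq_refl)

section \<open>Operators I + A with square integrable kernels\<close>

abbreviation kernels :: "(real \<times> real \<Rightarrow> real) set" where
  "kernels \<equiv> L2 (lborel \<Otimes>\<^sub>M lborel)"

definition one_plus :: "(real \<times> real \<Rightarrow> real) \<Rightarrow> real operator" where
  "one_plus A = id + integral_op lborel A"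

text \<open>The kernel of (I + A)(I + B) - I.\<close>

definition circ_kernel :: "(real \<times> real \<Rightarrow> real) \<Rightarrow> (real \<times> real \<Rightarrow> real) \<Rightarrow> real \<times> real \<Rightarrow> real" where
  "circ_kernel A B = (\<lambda>p. A p + B p + comp_kernel lborel A B p)"

lemma bounded_one_plus: "A \<in> kernels \<Longrightarrow> bounded_operator lborel (one_plus A)"
  unfolding one_plus_def by (intro bounded_operator_plus bounded_operator_id lborel.bounded_integral_op)

lemma circ_kernel_L2: "A \<in> kernels \<Longrightarrow> B \<in> kernels \<Longrightarrow> circ_kernel A B \<in> kernels"
  unfolding circ_kernel_def by (intro L2_add lborel.comp_kernel_L2)

lemma one_plus_comp:
  assumes A: "A \<in> kernels" and B: "B \<in> kernels"
  shows "op_eq lborel (one_plus A \<circ> one_plus B) (one_plus (circ_kernel A B))"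
  unfolding op_eq_def
proof
  fix f :: "real \<Rightarrow> real" assume f: "f \<in> L2 lborel"
  note Bf = lborel.integral_op_L2(1)[OF B f] and AB = lborel.comp_kernel_L2(1)[OF A B]
  have "AE x in lborel. integral_op lborel A (\<lambda>x. f x + integral_op lborel B f x) x
      = integral_op lborel A f x + integral_op lborel A (integral_op lborel B f) x"
    by (rule bounded_operator_add[OF lborel.bounded_integral_op[OF A] f Bf])
  moreover have "AE x in lborel. integral_op lborel A (integral_op lborel B f) x = integral_op lborel (comp_kernel lborel A B) f x"
    using lborel.integral_op_comp[OF A B] f by (simp add: op_eq_def)
  moreover have "AE x in lborel. integral_op lborel A f x + integral_op lborel B f x = integral_op lborel (\<lambda>p. A p + B p) f x"
    using lborel.integral_op_add[OF A B] f by (simp add: op_eq_def)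
  moreover have "AE x in lborel. integral_op lborel (\<lambda>p. A p + B p) f x + integral_op lborel (comp_kernel lborel A B) f x
      = integral_op lborel (circ_kernel A B) f x"
    using lborel.integral_op_add[OF L2_add[OF A B] AB] f by (simp add: op_eq_def circ_kernel_def)
  ultimately show "AE x in lborel. (one_plus A \<circ> one_plus B) f x = one_plus (circ_kernel A B) f x"
    by eventually_elim (simp add: one_plus_def plus_fun_def)
qed

lemma adjoint_one_plus: "A \<in> kernels \<Longrightarrow> adjoint_op lborel (one_plus A) (one_plus (transpose_kernel A))"
  unfolding one_plus_def
  by (intro adjoint_op_plus bounded_operator_id adjoint_op_id lborel.adjoint_integral_op
      lborel.bounded_integral_op lborel.transpose_kernel_L2)

lemma op_eq_one_plus_iff:
  assumes A: "A \<in> kernels" and B: "B \<in> kernels"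
  shows "op_eq lborel (one_plus A) (one_plus B) \<longleftrightarrow> (AE p in lborel \<Otimes>\<^sub>M lborel. A p = B p)"
proof
  assume "op_eq lborel (one_plus A) (one_plus B)"
  then have "op_eq lborel (integral_op lborel A) (integral_op lborel B)"
    by (simp add: op_eq_def one_plus_def)
  then show "AE p in lborel \<Otimes>\<^sub>M lborel. A p = B p" by (rule integral_op_eq_imp_kernel_eq[OF A B])
next
  assume "AE p in lborel \<Otimes>\<^sub>M lborel. A p = B p"
  from lborel.integral_op_cong_AE[OF A B this] show "op_eq lborel (one_plus A) (one_plus B)"
    by (simp add: op_eq_def one_plus_def)
qed

lemma one_plus_zero: "one_plus (\<lambda>_. 0) = id"
  by (rule ext) (simp add: one_plus_def integral_op_def plus_fun_def)

lemma has_kernel_iff_one_plus: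
  "has_kernel lborel T A \<longleftrightarrow> A \<in> kernels \<and> op_eq lborel (id + T) (one_plus A)"
  by (auto simp: has_kernel_def op_eq_def one_plus_def)

lemma hilbert_schmidt_iff:
  "hilbert_schmidt lborel T \<longleftrightarrow> bounded_operator lborel T \<and> (\<exists>A. has_kernel lborel T A)"
  using lborel.hilbert_schmidt_imp_has_kernel[of T] lborel.has_kernel_imp_hilbert_schmidt[of T]
    hilbert_schmidt_def[of lborel T] by blast

definition kop :: "(real \<times> real \<Rightarrow> real) \<Rightarrow> bop" where
  "kop A = bop_of (one_plus A)"

lemma kop_mult: "A \<in> kernels \<Longrightarrow> B \<in> kernels \<Longrightarrow> kop A * kop B = kop (circ_kernel A B)"
  unfolding kop_def
  by (subst bop_of_comp[symmetric])
     (auto simp: bounded_one_plus bop_of_eq_iff bounded_operator_comp circ_kernel_L2 one_plus_comp)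

lemma kop_eq_iff: "A \<in> kernels \<Longrightarrow> B \<in> kernels \<Longrightarrow> kop A = kop B \<longleftrightarrow> (AE p in lborel \<Otimes>\<^sub>M lborel. A p = B p)"
  unfolding kop_def by (simp add: bop_of_eq_iff bounded_one_plus op_eq_one_plus_iff)

lemma kop_eq_1_iff: "A \<in> kernels \<Longrightarrow> kop A = 1 \<longleftrightarrow> (AE p in lborel \<Otimes>\<^sub>M lborel. A p = 0)"
  using kop_eq_iff[OF _ L2_zero] by (simp add: kop_def one_plus_zero bop_of_id)

text \<open>Adjoints are computed on kernels, not as an operation on \<open>bop\<close>; uniqueness
  of kernels makes the result depend only on the class of the operator.\<close>

lemma kop_transpose_cong:
  assumes A: "A \<in> kernels" and B: "B \<in> kernels" and eq: "kop A = kop B"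
  shows "kop (transpose_kernel A) = kop (transpose_kernel B)"
proof -
  have "AE p in lborel \<Otimes>\<^sub>M lborel. A p = B p" using eq kop_eq_iff[OF A B] by simp
  from AE_lborel_swap[OF this] have "AE p in lborel \<Otimes>\<^sub>M lborel. transpose_kernel A p = transpose_kernel B p"
    by eventually_elim (simp add: transpose_kernel_def split_def)
  then show ?thesis by (simp add: kop_eq_iff A B lborel.transpose_kernel_L2)
qed

lemma kop_transpose_circ:
  assumes A: "A \<in> kernels" and B: "B \<in> kernels"
  shows "kop (transpose_kernel (circ_kernel A B)) = kop (transpose_kernel B) * kop (transpose_kernel A)"
proof -
  have "transpose_kernel (circ_kernel A B) = circ_kernel (transpose_kernel B) (transpose_kernel A)"
    by (auto simp: fun_eq_iff circ_kernel_def comp_kernel_def mult.commute)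
  then show ?thesis using A B by (simp add: kop_mult lborel.transpose_kernel_L2)
qed

lemma lower_kernel_circ: "lower_kernel A \<Longrightarrow> lower_kernel B \<Longrightarrow> lower_kernel (circ_kernel A B)"
proof (rule lower_kernelI)
  assume A: "lower_kernel A" and B: "lower_kernel B"
  show "circ_kernel A B \<in> kernels" by (intro circ_kernel_L2 lower_kernelD(1) A B)
  show "AE p in lborel \<Otimes>\<^sub>M lborel. fst p < snd p \<longrightarrow> circ_kernel A B p = 0"
    using lower_kernelD(2)[OF A] lower_kernelD(2)[OF B] lower_kernelD(2)[OF comp_kernel_lower[OF A B]]
    by eventually_elim (simp add: circ_kernel_def)
qed

text \<open>I + A is injective, since by \<open>volterra_injective_below\<close> a function in its
  null space vanishes on every half line. This turns a one-sided inverse into a two-sided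
  one.\<close>

lemma kop_lower_cancel:
  assumes A: "lower_kernel A" and B: "bounded_operator lborel B" "kop A * bop_of B = kop A"
  shows "bop_of B = 1"
proof -
  have AL: "A \<in> kernels" by (rule lower_kernelD(1)[OF A])
  note b = bounded_one_plus[OF AL]
  have eq: "op_eq lborel (one_plus A \<circ> B) (one_plus A)"
    using B b bounded_operator_comp[OF b B(1)] unfolding kop_def
    by (simp add: bop_of_comp[symmetric] bop_of_eq_iff)
  have "op_eq lborel B id"
    unfolding op_eq_def
  proof
    fix f :: "real \<Rightarrow> real" assume f: "f \<in> L2 lborel"
    note Bf = bounded_operator_L2[OF B(1) f]
    define h where "h = (\<lambda>x. B f x - f x)"
    have h: "h \<in> L2 lborel" unfolding h_def by (rule L2_diff[OF Bf f])
    have "AE x in lborel. one_plus A (B f) x = one_plus A f x" using eq f by (simp add: op_eq_def)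
    with bounded_operator_diff[OF b Bf f] have z: "AE x in lborel. one_plus A h x = 0"
      unfolding h_def by eventually_elim simp
    have hz: "AE x in lborel. x < real n \<longrightarrow> h x = 0" for n :: nat
      by (rule volterra_injective_below[OF A h]) (use z in \<open>auto simp: one_plus_def elim!: eventually_mono\<close>)
    then have "AE x in lborel. \<forall>n::nat. x < real n \<longrightarrow> h x = 0" unfolding AE_all_countable by blast
    then show "AE x in lborel. B f x = id f x"
    proof eventually_elim
      case (elim x)
      obtain n :: nat where "x < real n" using reals_Archimedean2 by blast
      then show ?case using elim by (auto simp: h_def)
    qed
  qed
  then show ?thesis using B(1) bop_of_eq_iff[OF B(1) bounded_operator_id] by (simp add: bop_of_id)
qed

lemma is_op_inverse_iff:
  assumes "bounded_operator lborel T" "bounded_operator lborel V"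
  shows "is_op_inverse lborel T V \<longleftrightarrow> bop_of T * bop_of V = 1 \<and> bop_of V * bop_of T = 1"
  using assms bop_of_eq_iff[OF bounded_operator_comp[OF assms] bounded_operator_id]
    bop_of_eq_iff[OF bounded_operator_comp[OF assms(2,1)] bounded_operator_id]
  by (simp add: is_op_inverse_def bop_of_comp bop_of_id)

lemma op_inv_bop:
  assumes "bounded_operator lborel T" "bounded_operator lborel V"
    "bop_of T * bop_of V = 1" "bop_of V * bop_of T = 1"
  shows "bounded_operator lborel (op_inv lborel T)" "bop_of (op_inv lborel T) = bop_of V"
proof -
  have inv: "is_op_inverse lborel T V" using assms is_op_inverse_iff by blast
  then show b: "bounded_operator lborel (op_inv lborel T)"
    using op_inv_is_op_inverse unfolding is_op_inverse_def by blast
  show "bop_of (op_inv lborel T) = bop_of V"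
    using op_inv_op_eq[OF assms(1) inv] bop_of_eq_iff[OF b assms(2)] by simp
qed

lemma op_adj_kop:
  assumes T: "bounded_operator lborel T" and A: "A \<in> kernels" and eq: "bop_of T = kop A"
  shows "bounded_operator lborel (op_adj lborel T)" "adjoint_op lborel T (op_adj lborel T)"
    "bop_of (op_adj lborel T) = kop (transpose_kernel A)"
proof -
  note A' = lborel.transpose_kernel_L2[OF A]
  have "op_eq lborel (one_plus A) T"
    using eq bop_of_eq_iff[OF T bounded_one_plus[OF A]] op_eq_sym unfolding kop_def by blast
  from adjoint_op_cong[OF adjoint_one_plus[OF A] this op_eq_refl bounded_one_plus[OF A] T bounded_one_plus[OF A'] bounded_one_plus[OF A']]
  have adj: "adjoint_op lborel T (one_plus (transpose_kernel A))" .
  note * = op_adj_adjoint[OF bounded_one_plus[OF A'] adj]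
  show "bounded_operator lborel (op_adj lborel T)" "adjoint_op lborel T (op_adj lborel T)" by (rule *)+
  show "bop_of (op_adj lborel T) = kop (transpose_kernel A)"
    unfolding kop_def using *(3) bop_of_eq_iff[OF *(1) bounded_one_plus[OF A']] by simp
qed

section \<open>The groups in terms of kernels\<close>

lemma hs_kernel:
  assumes "hilbert_schmidt lborel (T - id)"
  obtains A where "A \<in> kernels" "bounded_operator lborel T" "bop_of T = kop A"
proof -
  obtain A where b: "bounded_operator lborel (T - id)" and A: "has_kernel lborel (T - id) A"
    using assms hilbert_schmidt_iff by blast
  have e: "id + (T - id) = T" by simp
  have bT: "bounded_operator lborel T"
    using bounded_operator_plus[OF bounded_operator_id b] unfolding e .
  have "A \<in> kernels" "op_eq lborel T (one_plus A)"
    using A unfolding has_kernel_iff_one_plus e by auto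
  then show thesis
    using bT by (intro that[of A]) (auto simp: kop_def bop_of_eq_iff bounded_one_plus)
qed

lemma hs_of_kop:
  assumes T: "bounded_operator lborel T" and A: "A \<in> kernels" and eq: "bop_of T = kop A"
  shows "has_kernel lborel (T - id) A" "hilbert_schmidt lborel (T - id)"
proof -
  have e: "id + (T - id) = T" by simp
  have "op_eq lborel T (one_plus A)"
    using eq bop_of_eq_iff[OF T bounded_one_plus[OF A]] unfolding kop_def by simp
  then show k: "has_kernel lborel (T - id) A" unfolding has_kernel_iff_one_plus e using A by simp
  show "hilbert_schmidt lborel (T - id)"
    unfolding hilbert_schmidt_iff using k bounded_operator_minus[OF T bounded_operator_id] by blast
qed

lemma kernel_kop:
  assumes "bounded_operator lborel (id + T)" "has_kernel lborel T A"
  shows "A \<in> kernels" "bop_of (id + T) = kop A"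
  using assms unfolding has_kernel_iff_one_plus by (auto simp: kop_def bop_of_eq_iff bounded_one_plus)

lemma volterra_group_iff:
  "T \<in> volterra_group \<longleftrightarrow> bounded_operator lborel T \<and> (\<exists>A. lower_kernel A \<and> bop_of T = kop A)"
proof
  assume "T \<in> volterra_group"
  then obtain A where hs: "hilbert_schmidt lborel (T - id)" and A: "has_kernel lborel (T - id) A"
    and low: "AE (x, y) in lborel \<Otimes>\<^sub>M lborel. x < y \<longrightarrow> A (x, y) = 0"
    by (auto simp: volterra_group_def volterra_ops_def)
  have e: "id + (T - id) = T" by simp
  have bT: "bounded_operator lborel T" using hs_kernel[OF hs] by blast
  from kernel_kop[of "T - id", unfolded e, OF bT A] low
  show "bounded_operator lborel T \<and> (\<exists>A. lower_kernel A \<and> bop_of T = kop A)"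
    using bT by (auto simp: lower_kernel_def)
next
  assume "bounded_operator lborel T \<and> (\<exists>A. lower_kernel A \<and> bop_of T = kop A)"
  then obtain A where T: "bounded_operator lborel T" and A: "lower_kernel A" "bop_of T = kop A" by blast
  note h = hs_of_kop[OF T lower_kernelD(1)[OF A(1)] A(2)]
  then show "T \<in> volterra_group"
    using A(1) unfolding volterra_group_def volterra_ops_def lower_kernel_def by blast
qed

text \<open>With \<open>g\<close> the image of \<open>f\<close> under the adjoint of I + k, one has
  <f, (I + S) f> = |g|^2. As f = (I + k) V f, also |f|^2 = <g, V f> <= |g| D |f|, hence |f| <= D
  |g|.\<close>

lemma coercive_circ_kernel:
  assumes k: "k \<in> kernels" and V: "bounded_operator lborel V" and inv: "kop k * bop_of V = 1"
  defines "S \<equiv> circ_kernel k (transpose_kernel k)"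
  obtains c where "0 < c" "c \<le> 1"
    "\<And>f. f \<in> L2 lborel \<Longrightarrow> c * L2_inner lborel f f \<le> L2_inner lborel f f + L2_inner lborel f (integral_op lborel S f)"
proof -
  note k' = lborel.transpose_kernel_L2[OF k]
  note b = bounded_one_plus[OF k] and b' = bounded_one_plus[OF k']
  have SL: "S \<in> kernels" unfolding S_def by (rule circ_kernel_L2[OF k k'])
  obtain D where D: "D > 0" "\<And>f. f \<in> L2 lborel \<Longrightarrow> L2_norm lborel (V f) \<le> D * L2_norm lborel f"
    using bounded_operator_bound[OF V] by metis
  have kV: "op_eq lborel (one_plus k \<circ> V) id"
    using inv bop_of_eq_iff[OF bounded_operator_comp[OF b V] bounded_operator_id]
    by (simp add: kop_def bop_of_comp[OF b V] bop_of_id)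
  have adj: "L2_inner lborel f (one_plus k g) = L2_inner lborel (one_plus (transpose_kernel k) f) g"
    if "f \<in> L2 lborel" "g \<in> L2 lborel" for f g
    using adjoint_one_plus[OF k] that unfolding adjoint_op_def by (metis L2_inner_commute)
  \<comment> \<open>The minimum with 1 supplies the bound \<open>c <= 1\<close> that the projected
    problem for the upper factor asks for.\<close>
  define c where "c = min 1 (1 / D\<^sup>2)"
  have c: "0 < c" "c \<le> 1" using D(1) by (auto simp: c_def)
  moreover have "c * L2_inner lborel f f \<le> L2_inner lborel f f + L2_inner lborel f (integral_op lborel S f)"
    if f: "f \<in> L2 lborel" for f
  proof -
    define g where "g = one_plus (transpose_kernel k) f"
    have g: "g \<in> L2 lborel" unfolding g_def by (rule bounded_operator_L2[OF b' f])
    note Vf = bounded_operator_L2[OF V f] and Sf = lborel.integral_op_L2(1)[OF SL f]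
    have "L2_inner lborel f f = L2_inner lborel f (one_plus k (V f))"
      by (rule L2_inner_cong_AE[OF f f f bounded_operator_L2[OF b Vf] AE_I2[OF refl]])
         (use kV f in \<open>auto simp: op_eq_def elim!: eventually_mono\<close>)
    also have "\<dots> = L2_inner lborel g (V f)" unfolding g_def by (rule adj[OF f Vf])
    also have "\<dots> \<le> L2_norm lborel g * L2_norm lborel (V f)" using L2_Cauchy_Schwarz[OF g Vf] by linarith
    also have "\<dots> \<le> L2_norm lborel g * (D * L2_norm lborel f)" by (intro mult_left_mono D f L2_norm_nonneg)
    finally have "L2_norm lborel f * L2_norm lborel f \<le> L2_norm lborel f * (D * L2_norm lborel g)"
      by (simp add: L2_norm_power2[symmetric] power2_eq_square mult_ac)
    then have "L2_norm lborel f \<le> D * L2_norm lborel g"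
      using D(1) L2_norm_nonneg[of lborel f] L2_norm_nonneg[of lborel g]
      by (cases "L2_norm lborel f = 0") (auto simp: mult_le_cancel_left)
    then have "(L2_norm lborel f)\<^sup>2 \<le> (D * L2_norm lborel g)\<^sup>2" by (intro power_mono L2_norm_nonneg)
    then have "1 / D\<^sup>2 * L2_inner lborel f f \<le> L2_inner lborel g g"
      using D(1) by (simp add: L2_norm_power2[symmetric] power_mult_distrib field_simps)
    moreover have "c * L2_inner lborel f f \<le> 1 / D\<^sup>2 * L2_inner lborel f f"
      by (intro mult_right_mono L2_inner_self_nonneg) (simp add: c_def)
    moreover have "L2_inner lborel g g = L2_inner lborel f (one_plus k g)"
      using adj[OF f g] by (simp only: g_def)
    moreover have "L2_inner lborel f (one_plus k g) = L2_inner lborel f (\<lambda>x. f x + integral_op lborel S f x)"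
    proof (rule L2_inner_cong_AE[OF f bounded_operator_L2[OF b g] f L2_add[OF f Sf] AE_I2[OF refl]])
      have "AE x in lborel. (one_plus k \<circ> one_plus (transpose_kernel k)) f x = one_plus S f x"
        using one_plus_comp[OF k k'] f by (simp add: op_eq_def S_def)
      then show "AE x in lborel. one_plus k g x = f x + integral_op lborel S f x"
        by eventually_elim (simp add: g_def one_plus_def[of S])
    qed
    moreover have "L2_inner lborel f (\<lambda>x. f x + integral_op lborel S f x) = L2_inner lborel f f + L2_inner lborel f (integral_op lborel S f)"
      by (rule L2_inner_add_right[OF f f Sf])
    ultimately show ?thesis by linarith
  qed
  ultimately show thesis by (rule that)
qed

lemma bop_of_op_eq: "op_eq lborel T U \<Longrightarrow> bounded_operator lborel T \<Longrightarrow> bounded_operator lborel U \<Longrightarrow> bop_of T = bop_of U"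
  by (simp add: bop_of_eq_iff)

text \<open>Orthogonality of \<open>p\<close> gives (I + k)(I + k^T) = (I + l)(I + l^T) for the
  kernel \<open>l\<close> of \<open>b\<close>. With I + w = (I + C^T)(I + l), the product (I + l)(I
  + w^T) is therefore (I + k)(I + k^T)(I + C) = I + L, so w^T is lower triangular by
  \<open>lower_kernel_of_equation\<close>. As \<open>w\<close> is lower triangular too, it vanishes,
  and I + C^T is a left inverse of I + l.\<close>

lemma factorization_unique:
  assumes k: "k \<in> kernels" and bK: "bounded_operator lborel T" and Tk: "bop_of T = kop k"
    and C: "C \<in> kernels" and Cs: "lower_kernel (transpose_kernel C)" and L: "lower_kernel L"
    and PX: "kop k * kop (transpose_kernel k) * kop C = kop L"
    and LX: "kop L * kop (transpose_kernel C) = 1"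
    and b: "b \<in> volterra_group" and p: "p \<in> orthogonal_group"
    and fac: "op_eq lborel T (b \<circ> op_inv lborel p)"
  shows "bounded_operator lborel b" "bop_of b = kop L"
    "bounded_operator lborel p" "kop k * bop_of p = kop L"
proof -
  obtain l where bb: "bounded_operator lborel b" and l: "lower_kernel l" "bop_of b = kop l"
    using b unfolding volterra_group_iff by blast
  note lL = lower_kernelD(1)[OF l(1)]
  have "hilbert_schmidt lborel (p - id)" using p by (simp add: orthogonal_group_def hs_group_def)
  then obtain q where q: "q \<in> kernels" and bp: "bounded_operator lborel p" and pq: "bop_of p = kop q"
    by (rule hs_kernel)
  note q' = lborel.transpose_kernel_L2[OF q] and lT = lborel.transpose_kernel_L2[OF lL]
  note adj = op_adj_kop[OF bp q pq]
  have inv: "kop q * kop (transpose_kernel q) = 1" "kop (transpose_kernel q) * kop q = 1"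
    using p bop_of_eq_iff[OF bounded_operator_comp[OF bp adj(1)] bounded_operator_id]
      bop_of_eq_iff[OF bounded_operator_comp[OF adj(1) bp] bounded_operator_id]
    by (simp_all add: orthogonal_group_def bop_of_comp bp adj pq bop_of_id)
  have iv: "bounded_operator lborel (op_inv lborel p)" "bop_of (op_inv lborel p) = kop (transpose_kernel q)"
    using op_inv_bop[OF bp adj(1)] inv by (simp_all add: adj pq)
  have a: "kop k = kop l * kop (transpose_kernel q)"
    using fac bop_of_eq_iff[OF bK bounded_operator_comp[OF bb iv(1)]]
    by (simp add: Tk bop_of_comp[OF bb iv(1)] l(2) iv(2))
  have as: "kop (transpose_kernel k) = kop q * kop (transpose_kernel l)"
  proof -
    have "kop k = kop (circ_kernel l (transpose_kernel q))" using a lL q' by (simp add: kop_mult)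
    then have "kop (transpose_kernel k) = kop (transpose_kernel (circ_kernel l (transpose_kernel q)))"
      by (intro kop_transpose_cong k circ_kernel_L2 lL q')
    then show ?thesis using kop_transpose_circ[OF lL q'] by simp
  qed
  define w where "w = circ_kernel (transpose_kernel C) l"
  have w: "lower_kernel w" unfolding w_def by (rule lower_kernel_circ[OF Cs l(1)])
  note wT = lborel.transpose_kernel_L2[OF lower_kernelD(1)[OF w]]
  have "kop (transpose_kernel w) = kop (transpose_kernel l) * kop C"
    using kop_transpose_circ[OF lower_kernelD(1)[OF Cs] lL] by (simp add: w_def)
  then have "kop l * kop (transpose_kernel w) = kop l * (kop (transpose_kernel q) * kop q) * kop (transpose_kernel l) * kop C"
    by (simp add: inv mult.assoc)
  also have "\<dots> = kop k * kop (transpose_kernel k) * kop C" by (simp add: a as mult.assoc)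
  finally have "kop (circ_kernel l (transpose_kernel w)) = kop L"
    using PX kop_mult[OF lL wT] by simp
  then have "AE p in lborel \<Otimes>\<^sub>M lborel. circ_kernel l (transpose_kernel w) p = L p"
    using kop_eq_iff[OF circ_kernel_L2[OF lL wT] lower_kernelD(1)[OF L]] by simp
  then have "lower_kernel (transpose_kernel w)"
    unfolding circ_kernel_def by (rule lower_kernel_of_equation[OF l(1) L wT])
  then have "AE p in lborel \<Otimes>\<^sub>M lborel. w p = 0" by (rule lower_upper_kernel_eq_0[OF w])
  then have "kop w = 1" using kop_eq_1_iff[OF lower_kernelD(1)[OF w]] by simp
  then have "kop (transpose_kernel C) * kop l = 1"
    using kop_mult[OF lower_kernelD(1)[OF Cs] lL] by (simp add: w_def)
  \<comment> \<open>Since I + L is inverse to I + C^T on the other side, multiplying by it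
    identifies \<open>l\<close> with \<open>L\<close>.\<close>
  then have "kop L = kop L * kop (transpose_kernel C) * kop l" by (simp add: mult.assoc)
  then have lL': "kop l = kop L" by (simp add: LX)
  then show "bop_of b = kop L" using l(2) by simp
  have "kop k * kop q = kop l * (kop (transpose_kernel q) * kop q)" by (simp add: a mult.assoc)
  then show "kop k * bop_of p = kop L" by (simp add: pq inv lL')
  show "bounded_operator lborel b" "bounded_operator lborel p" by (rule bb bp)+
qed

text \<open>Additivity of \<open>K\<close> holds only almost everywhere, so the product expands up
  to \<open>op_eq\<close>.\<close>

lemma op_eq_S:
  fixes K U :: "real operator"
  assumes K: "bounded_operator lborel K" and U: "bounded_operator lborel U"
  shows "op_eq lborel ((id + K) \<circ> (id + U)) (id + (K + U + (K \<circ> U)))"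
  unfolding op_eq_def
proof
  fix f :: "real \<Rightarrow> real" assume f: "f \<in> L2 lborel"
  from bounded_operator_add[OF K f bounded_operator_L2[OF U f]]
  show "AE x in lborel. ((id + K) \<circ> (id + U)) f x = (id + (K + U + (K \<circ> U))) f x"
    by eventually_elim (simp add: plus_fun_def)
qed

theorem theorem3p1:
  fixes K :: "real operator"
  assumes "id + K \<in> hs_group"
  shows "\<exists>b_minus b_plus.
    b_minus \<in> volterra_group \<and> b_plus \<in> orthogonal_group \<and>
    op_eq lborel (id + K) (b_minus \<circ> op_inv lborel b_plus) \<and>
    (\<forall>b_minus' b_plus'.
       b_minus' \<in> volterra_group \<and> b_plus' \<in> orthogonal_group \<and>
       op_eq lborel (id + K) (b_minus' \<circ> op_inv lborel b_plus') \<longrightarrow>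
       op_eq lborel b_minus' b_minus \<and> op_eq lborel b_plus' b_plus) \<and>
    (let S_op = K + op_adj lborel K + (K \<circ> op_adj lborel K);
         C_op = op_adj lborel (op_inv lborel b_minus) - id
     in hilbert_schmidt lborel S_op \<and> hilbert_schmidt lborel C_op \<and>
        (\<exists>S. has_kernel lborel S_op S) \<and> (\<exists>C. has_kernel lborel C_op C) \<and>
        (\<forall>S C. has_kernel lborel S_op S \<and> has_kernel lborel C_op C \<longrightarrow>
           (\<forall>y. op_invertible (below y) (id + restrict_op S y) \<and>
                det2 (below y) (restrict_op S y) \<noteq> 0) \<and>
           (AE y in lborel.
              (\<lambda>t. S (t, y)) \<in> L2 (below y) \<and>
              (AE x in below y.
                 C (x, y) = - op_inv (below y) (id + restrict_op S y) (\<lambda>t. S (t, y)) x \<and>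
                 C (x, y) = - S (x, y)
                   - D2 (below y) (restrict_op S y) (\<lambda>t. S (t, y)) x
                     / det2 (below y) (restrict_op S y))) \<and>
           (AE (x, y) in lborel \<Otimes>\<^sub>M lborel. y < x \<longrightarrow> C (x, y) = 0)))"
proof -
  have idK: "id + K - id = K" by simp
  have hs: "hilbert_schmidt lborel (id + K - id)" and inv: "op_invertible lborel (id + K)"
    using assms by (auto simp: hs_group_def)
  obtain k where k: "k \<in> kernels" and bK: "bounded_operator lborel (id + K)" and Kk: "bop_of (id + K) = kop k"
    using hs by (rule hs_kernel)
  obtain V where V: "is_op_inverse lborel (id + K) V" using inv by (auto simp: op_invertible_def)
  then have bV: "bounded_operator lborel V" by (simp add: is_op_inverse_def)
  define v where "v = bop_of V"
  have av: "kop k * v = 1" "v * kop k = 1"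
    using V is_op_inverse_iff[OF bK bV] by (simp_all add: v_def Kk)
  define ks where "ks = transpose_kernel k"
  have ks: "ks \<in> kernels" unfolding ks_def by (rule lborel.transpose_kernel_L2[OF k])
  define S where "S = circ_kernel k ks"
  have S: "S \<in> kernels" unfolding S_def by (rule circ_kernel_L2[OF k ks])
  have kS: "kop S = kop k * kop ks" unfolding S_def using kop_mult[OF k ks] by simp
  have ST: "transpose_kernel S = S"
    by (auto simp: fun_eq_iff S_def ks_def circ_kernel_def comp_kernel_def mult.commute add.commute)
  obtain c where c: "0 < c" "c \<le> 1"
    and coS: "\<And>f. f \<in> L2 lborel \<Longrightarrow> c * L2_inner lborel f f \<le> L2_inner lborel f f + L2_inner lborel f (integral_op lborel S f)"
    using coercive_circ_kernel[OF k bV] av(1) unfolding v_def S_def ks_def by blast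
  obtain C where C: "C \<in> kernels" and C0: "\<And>p. \<not> fst p < snd p \<Longrightarrow> C p = 0"
    and Ceq: "AE p in lborel \<Otimes>\<^sub>M lborel. fst p < snd p \<longrightarrow> S p + C p + comp_kernel lborel S C p = 0"
    using upper_kernel_exists[OF S c coS] by blast
  define L where "L = circ_kernel S C"
  have L: "lower_kernel L"
    unfolding L_def by (rule lower_kernelI[OF circ_kernel_L2[OF S C]]) (use Ceq in \<open>simp add: circ_kernel_def\<close>)
  note LL = lower_kernelD(1)[OF L]
  define Cs where "Cs = transpose_kernel C"
  have Cs: "lower_kernel Cs"
    unfolding Cs_def by (rule lower_kernelI[OF lborel.transpose_kernel_L2[OF C]]) (auto simp: transpose_kernel_def split_def C0)
  note CsL = lower_kernelD(1)[OF Cs]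
  have kL: "kop L = kop k * kop ks * kop C" unfolding L_def using kop_mult[OF S C] kS by simp
  have XsL: "kop Cs * kop L = 1"
  proof -
    define N where "N = circ_kernel Cs L"
    have N: "lower_kernel N" unfolding N_def by (rule lower_kernel_circ[OF Cs L])
    note NL = lower_kernelD(1)[OF N] and NT = lborel.transpose_kernel_L2[OF lower_kernelD(1)[OF N]]
    have kN: "kop N = kop Cs * kop S * kop C"
      unfolding N_def using kop_mult[OF CsL LL] by (simp add: kL kS mult.assoc)
    have "kop (transpose_kernel N) = kop (transpose_kernel L) * kop C"
      unfolding N_def using kop_transpose_circ[OF CsL LL] by (simp add: Cs_def)
    also have "kop (transpose_kernel L) = kop Cs * kop S"
      unfolding L_def using kop_transpose_circ[OF S C] by (simp add: Cs_def ST)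
    finally have "kop (transpose_kernel N) = kop N" by (simp add: kN)
    then have ae: "AE p in lborel \<Otimes>\<^sub>M lborel. transpose_kernel N p = N p"
      using kop_eq_iff[OF NT NL] by simp
    have "lower_kernel (transpose_kernel N)"
    proof (rule lower_kernelI[OF NT])
      show "AE p in lborel \<Otimes>\<^sub>M lborel. fst p < snd p \<longrightarrow> transpose_kernel N p = 0"
        using ae lower_kernelD(2)[OF N] by eventually_elim simp
    qed
    then have "AE p in lborel \<Otimes>\<^sub>M lborel. N p = 0" by (rule lower_upper_kernel_eq_0[OF N])
    then have "kop N = 1" using kop_eq_1_iff[OF NL] by simp
    then show ?thesis unfolding N_def using kop_mult[OF CsL LL] by simp
  qed
  \<comment> \<open>Multiplying \<open>XsL\<close> by \<open>kop Cs\<close> on the right gives Cs (L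
    Cs) = Cs, and the left factor may be cancelled.\<close>
  have LXs: "kop L * kop Cs = 1"
  proof -
    let ?B = "one_plus L \<circ> one_plus Cs"
    note bL = bounded_one_plus[OF LL] and bC = bounded_one_plus[OF CsL]
    have B: "bop_of ?B = kop L * kop Cs" unfolding kop_def by (rule bop_of_comp[OF bL bC])
    have "kop Cs * bop_of ?B = kop Cs" unfolding B mult.assoc[symmetric] XsL by simp
    from kop_lower_cancel[OF Cs bounded_operator_comp[OF bL bC] this] show ?thesis unfolding B .
  qed
  define bm where "bm = one_plus L"
  define bp where "bp = one_plus (circ_kernel ks C)"
  note ksC = circ_kernel_L2[OF ks C]
  have bbm: "bounded_operator lborel bm" unfolding bm_def by (rule bounded_one_plus[OF LL])
  have bbp: "bounded_operator lborel bp" unfolding bp_def by (rule bounded_one_plus[OF ksC])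
  have km: "bop_of bm = kop L" by (simp add: bm_def kop_def)
  have kp': "bop_of bp = kop (circ_kernel ks C)" by (simp add: bp_def kop_def)
  then have kp: "bop_of bp = kop ks * kop C" using kop_mult[OF ks C] by simp
  \<comment> \<open>In this form, which says (I + K) b_+ = b_-, the operator enters the computation
    of its inverse and the uniqueness argument.\<close>
  have pv: "bop_of bp = v * kop L"
    unfolding kp kL mult.assoc[symmetric] av(2) by simp
  \<comment> \<open>\<open>ip\<close> has two roles: \<open>pip\<close> shows that it inverts
    \<open>bp\<close>, and \<open>kadj\<close> that it represents the adjoint. Together they give
    orthogonality.\<close>
  define ip where "ip = one_plus Cs \<circ> (id + K)"
  have bip: "bounded_operator lborel ip"
    unfolding ip_def by (rule bounded_operator_comp[OF bounded_one_plus[OF CsL] bK])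
  have kip: "bop_of ip = kop Cs * kop k"
    unfolding ip_def bop_of_comp[OF bounded_one_plus[OF CsL] bK] Kk by (simp add: kop_def)
  have pip: "bop_of bp * bop_of ip = 1" "bop_of ip * bop_of bp = 1"
  proof -
    have "bop_of bp * bop_of ip = v * (kop L * kop Cs) * kop k" by (simp add: pv kip mult.assoc)
    then show "bop_of bp * bop_of ip = 1" by (simp add: LXs av)
    have "bop_of ip * bop_of bp = kop Cs * kop L" by (simp add: kip kp kL mult.assoc)
    then show "bop_of ip * bop_of bp = 1" by (simp add: XsL)
  qed
  have vol: "bm \<in> volterra_group" unfolding volterra_group_iff using bbm L km by blast
  note hp = hs_of_kop[OF bbp ksC kp']
  note adjp = op_adj_kop[OF bbp ksC kp']
  have kadj: "bop_of (op_adj lborel bp) = bop_of ip"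
    unfolding adjp(3) kop_transpose_circ[OF ks C] kip by (simp add: Cs_def ks_def)
  have orth: "bp \<in> orthogonal_group"
    unfolding orthogonal_group_def hs_group_def mem_Collect_eq op_invertible_def
  proof (intro conjI exI)
    show "is_op_inverse lborel bp ip" using is_op_inverse_iff[OF bbp bip] pip by simp
    show "op_eq lborel (bp \<circ> op_adj lborel bp) id"
      using bop_of_eq_iff[OF bounded_operator_comp[OF bbp adjp(1)] bounded_operator_id]
      by (simp add: bop_of_comp[OF bbp adjp(1)] kadj pip bop_of_id)
    show "op_eq lborel (op_adj lborel bp \<circ> bp) id"
      using bop_of_eq_iff[OF bounded_operator_comp[OF adjp(1) bbp] bounded_operator_id]
      by (simp add: bop_of_comp[OF adjp(1) bbp] kadj pip bop_of_id)
  qed (use bbp hp in auto)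
  note ivp = op_inv_bop[OF bbp bip pip]
  have fac: "op_eq lborel (id + K) (bm \<circ> op_inv lborel bp)"
  proof -
    have "bop_of (bm \<circ> op_inv lborel bp) = kop L * kop Cs * kop k"
      by (simp add: bop_of_comp[OF bbm ivp(1)] km ivp(2) kip mult.assoc)
    then show ?thesis
      using bop_of_eq_iff[OF bK bounded_operator_comp[OF bbm ivp(1)]] by (simp add: Kk LXs)
  qed
  \<comment> \<open>\<open>factorization_unique\<close> identifies \<open>b'\<close> and gives (I +
    K) p' = I + L; multiplying by the inverse \<open>v\<close> identifies \<open>p'\<close>.\<close>
  have uniq: "op_eq lborel b' bm \<and> op_eq lborel p' bp"
    if "b' \<in> volterra_group" "p' \<in> orthogonal_group" "op_eq lborel (id + K) (b' \<circ> op_inv lborel p')" for b' p'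
  proof -
    note u = factorization_unique[OF k bK Kk C Cs[unfolded Cs_def] L _ _ that]
    have PX: "kop k * kop (transpose_kernel k) * kop C = kop L" by (simp add: kL ks_def)
    have LX: "kop L * kop (transpose_kernel C) = 1" using LXs by (simp add: Cs_def)
    note u = u[OF PX LX]
    have "bop_of p' = v * kop k * bop_of p'" by (simp add: av)
    also have "\<dots> = bop_of bp" by (simp add: mult.assoc u(4) pv)
    finally show ?thesis
      using u bop_of_eq_iff[OF u(1) bbm] bop_of_eq_iff[OF u(3) bbp] by (simp add: km)
  qed
  have bK0: "bounded_operator lborel K"
    using bounded_operator_minus[OF bK bounded_operator_id] unfolding idK .
  \<comment> \<open>Here \<open>op_adj\<close> is applied to \<open>K\<close> alone and not to I +
    K, so its kernel is identified directly.\<close>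
  define U where "U = op_adj lborel K"
  have U: "bounded_operator lborel U" "bop_of (id + U) = kop ks"
  proof -
    have "op_eq lborel K (integral_op lborel k)"
      using hs_of_kop(1)[OF bK k Kk] unfolding idK has_kernel_def by simp
    from adjoint_op_cong[OF lborel.adjoint_integral_op[OF k] op_eq_sym[OF this] op_eq_refl
        lborel.bounded_integral_op[OF k] bK0 lborel.bounded_integral_op lborel.bounded_integral_op]
    have "adjoint_op lborel K (integral_op lborel ks)" using ks by (simp add: ks_def)
    note a = op_adj_adjoint[OF lborel.bounded_integral_op[OF ks] this]
    show bU: "bounded_operator lborel U" unfolding U_def by (rule a(1))
    have "op_eq lborel (id + U) (one_plus ks)"
      unfolding one_plus_def U_def by (rule op_eq_plus[OF op_eq_refl a(3)])
    then show "bop_of (id + U) = kop ks"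
      unfolding kop_def
      by (rule bop_of_op_eq[OF _ bounded_operator_plus[OF bounded_operator_id bU] bounded_one_plus[OF ks]])
  qed
  define S_op where "S_op = K + U + (K \<circ> U)"
  have bS: "bounded_operator lborel S_op"
    unfolding S_op_def by (intro bounded_operator_plus bounded_operator_comp bK0 U(1))
  have bS1: "bounded_operator lborel (id + S_op)" by (rule bounded_operator_plus[OF bounded_operator_id bS])
  have kSop: "bop_of (id + S_op) = kop S"
  proof -
    have bU1: "bounded_operator lborel (id + U)" by (rule bounded_operator_plus[OF bounded_operator_id U(1)])
    have "bop_of (id + S_op) = bop_of ((id + K) \<circ> (id + U))"
      unfolding S_op_def
      by (rule bop_of_op_eq[OF op_eq_sym[OF op_eq_S[OF bK0 U(1)]] bS1[unfolded S_op_def] bounded_operator_comp[OF bK bU1]])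
    then show ?thesis by (simp add: bop_of_comp[OF bK bU1] Kk U(2) kS)
  qed
  have idS: "id + S_op - id = S_op" by simp
  note hS = hs_of_kop[OF bS1 S kSop, unfolded idS]
  have bCs: "bounded_operator lborel (one_plus Cs)" by (rule bounded_one_plus[OF CsL])
  have ivm: "bounded_operator lborel (op_inv lborel bm)" "bop_of (op_inv lborel bm) = kop Cs"
    using op_inv_bop[OF bbm bCs] by (simp_all add: km LXs XsL flip: kop_def)
  note adjm = op_adj_kop[OF ivm(1) CsL ivm(2)]
  have adjm3: "bop_of (op_adj lborel (op_inv lborel bm)) = kop C" using adjm(3) by (simp add: Cs_def)
  define C_op where "C_op = op_adj lborel (op_inv lborel bm) - id"
  note hC = hs_of_kop[OF adjm(1) C adjm3, folded C_op_def]
  \<comment> \<open>Kernels are determined only up to null sets, so the formula is proved for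
    arbitrary representatives \<open>S'\<close> and \<open>C'\<close>; symmetry, coercivity and the
    equation for \<open>C\<close> are transferred to them first.\<close>
  have final: "(\<forall>y. op_invertible (below y) (id + restrict_op S' y) \<and> det2 (below y) (restrict_op S' y) \<noteq> 0) \<and>
      (AE y in lborel. (\<lambda>t. S' (t, y)) \<in> L2 (below y) \<and>
        (AE x in below y.
          C' (x, y) = - op_inv (below y) (id + restrict_op S' y) (\<lambda>t. S' (t, y)) x \<and>
          C' (x, y) = - S' (x, y) - D2 (below y) (restrict_op S' y) (\<lambda>t. S' (t, y)) x / det2 (below y) (restrict_op S' y))) \<and>
      (AE (x, y) in lborel \<Otimes>\<^sub>M lborel. y < x \<longrightarrow> C' (x, y) = 0)"
    if S': "has_kernel lborel S_op S'" and C': "has_kernel lborel C_op C'" for S' C'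
  proof -
    note s = kernel_kop[OF bS1 S']
    have e: "id + C_op = op_adj lborel (op_inv lborel bm)" by (simp add: C_op_def)
    note t = kernel_kop[of C_op C', unfolded e, OF adjm(1) C']
    have SS: "AE p in lborel \<Otimes>\<^sub>M lborel. S p = S' p"
      using s kSop kop_eq_iff[OF S s(1)] by simp
    have CC: "AE p in lborel \<Otimes>\<^sub>M lborel. C p = C' p"
      using t adjm3 kop_eq_iff[OF C t(1)] by simp
    have SSop: "op_eq lborel (integral_op lborel S) (integral_op lborel S')"
      by (rule lborel.integral_op_cong_AE[OF S s(1) SS])
    note iS = lborel.bounded_integral_op[OF S] and iS' = lborel.bounded_integral_op[OF s(1)]
    have sym: "adjoint_op lborel (integral_op lborel S') (integral_op lborel S')"
      using adjoint_op_cong[OF lborel.adjoint_integral_op[OF S, unfolded ST] SSop SSop iS iS' iS iS'] .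
    have co: "c * L2_inner lborel f f \<le> L2_inner lborel f f + L2_inner lborel f (integral_op lborel S' f)"
      if f: "f \<in> L2 lborel" for f
    proof -
      have "L2_inner lborel f (integral_op lborel S f) = L2_inner lborel f (integral_op lborel S' f)"
        by (rule L2_inner_cong_AE[OF f bounded_operator_L2[OF iS f] f bounded_operator_L2[OF iS' f] AE_I2[OF refl]])
           (use SSop f in \<open>simp add: op_eq_def\<close>)
      with coS[OF f] show ?thesis by simp
    qed
    have C0': "AE p in lborel \<Otimes>\<^sub>M lborel. snd p < fst p \<longrightarrow> C' p = 0"
      using CC by eventually_elim (use C0 in force)
    have "kop (circ_kernel S' C') = kop L"
    proof -
      have "kop (circ_kernel S' C') = kop S' * kop C'" using kop_mult[OF s(1) t(1)] by simp
      also have "\<dots> = kop S * kop C" using s(2) kSop t(2) adjm3 by simp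
      finally show ?thesis by (simp add: kL kS)
    qed
    then have "AE p in lborel \<Otimes>\<^sub>M lborel. circ_kernel S' C' p = L p"
      using kop_eq_iff[OF circ_kernel_L2[OF s(1) t(1)] LL] by simp
    then have eq': "AE p in lborel \<Otimes>\<^sub>M lborel. fst p < snd p \<longrightarrow> S' p + C' p + comp_kernel lborel S' C' p = 0"
      using lower_kernelD(2)[OF L] by eventually_elim (simp add: circ_kernel_def)
    note h = half_line_formula[OF s(1) sym c co t(1) C0' eq']
    have "AE (x, y) in lborel \<Otimes>\<^sub>M lborel. y < x \<longrightarrow> C' (x, y) = 0"
      using C0' by (simp add: split_def)
    with h(1,2) h(3) show ?thesis by blast
  qed
  show ?thesis
    unfolding Let_def U_def[symmetric] S_op_def[symmetric]
  proof (rule exI[of _ bm], rule exI[of _ bp], unfold C_op_def[symmetric], intro conjI)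
    show "bm \<in> volterra_group" by (rule vol)
    show "bp \<in> orthogonal_group" by (rule orth)
    show "op_eq lborel (id + K) (bm \<circ> op_inv lborel bp)" by (rule fac)
    show "\<forall>b_minus' b_plus'. b_minus' \<in> volterra_group \<and> b_plus' \<in> orthogonal_group \<and>
       op_eq lborel (id + K) (b_minus' \<circ> op_inv lborel b_plus') \<longrightarrow>
       op_eq lborel b_minus' bm \<and> op_eq lborel b_plus' bp"
      using uniq by blast
    show "hilbert_schmidt lborel S_op" by (rule hS(2))
    show "hilbert_schmidt lborel C_op" by (rule hC(2))
    show "\<exists>S. has_kernel lborel S_op S" using hS(1) by blast
    show "\<exists>C. has_kernel lborel C_op C" using hC(1) by blast
    show "\<forall>S C. has_kernel lborel S_op S \<and> has_kernel lborel C_op C \<longrightarrow>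
        (\<forall>y. op_invertible (below y) (id + restrict_op S y) \<and> det2 (below y) (restrict_op S y) \<noteq> 0) \<and>
        (AE y in lborel. (\<lambda>t. S (t, y)) \<in> L2 (below y) \<and>
          (AE x in below y.
            C (x, y) = - op_inv (below y) (id + restrict_op S y) (\<lambda>t. S (t, y)) x \<and>
            C (x, y) = - S (x, y) - D2 (below y) (restrict_op S y) (\<lambda>t. S (t, y)) x / det2 (below y) (restrict_op S y))) \<and>
        (AE (x, y) in lborel \<Otimes>\<^sub>M lborel. y < x \<longrightarrow> C (x, y) = 0)"
      by (intro allI impI, elim conjE, rule final)
  qed
qed

end
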